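(* Suppose that $F$ is a quadratically closed field and that $f:V\times V\to F$ is a non-degenerate split bilinear form on a non-zero finite dimensional $F$-vector space $V$. Then $f$ admits as Gram matrix a direct sum of matrices taken from the following list (of varying sizes $k\ge1$): $A_k=\Gamma_k$ ($k$ odd, $\mathrm{char}(F)\neq2$); $B_k=\Gamma_k^0$ ($k$ odd, $\mathrm{char}(F)=2$); $C_k=\Gamma_k$ ($k$ even, $\mathrm{char}(F)\ne2$); $D_k=\begin{pmatrix}0&J_m(1)\\ I_m&0\end{pmatrix}$ ($k=2m$, $m$ even); $E_k=\begin{pmatrix}0&J_m(1)\\ I_m&0\end{pmatrix}$ ($k=2m$, $m$ odd, $\mathrm{char}(F)=2$); $F_k=\begin{pmatrix}0&J_m(-1)\\ I_m&0\end{pmatrix}$ ($k=2m$, $m$ odd, $\mathrm{char}(F)\neq2$); $G_k(\lambda)=\begin{pmatrix}0&J_m(\lambda)\\ I_m&0\end{pmatrix}$ ($k=2m$, $0\ne\lambda\in F$, $\lambda^2\neq1$); without simultaneously using summands $B_\ell$ and $E_{2\ell}$, for any odd $\ell$, when $\mathrm{char}(F)=2$. The summands of such a decomposition (with multiplicities, up to order) are uniquely determined by $f$, except only for the fact that $G_k(\lambda)$ and $G_k(\lambda^{-1})$ are interchangeable.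
   Context: A field $F$ is quadratically closed if it has no quadratic extensions, i.e. every polynomial of degree 2 over $F$ has a root in $F$. The Gram matrix of a bilinear form $f$ relative to a basis $v_1,\dots,v_n$ of $V$ is $(f(v_i,v_j))$; $f$ is non-degenerate if its Gram matrices are invertible. If $f$ is non-degenerate, its asymmetry is the unique $\sigma\in\mathrm{GL}(V)$ with $f(v,u)=f(u,\sigma v)$ for all $u,v\in V$. A non-degenerate form is split if the minimal polynomial of its asymmetry splits into linear factors over $F$. The direct sum of square matrices $B,C$ is the block diagonal matrix $\begin{pmatrix}B&0\\0&C\end{pmatrix}$. $J_m(\lambda)$ is the $m\times m$ lower triangular Jordan block with $\lambda$ on the diagonal and $1$ on the subdiagonal; $I_m$ is the identity matrix. $\Gamma_k$ is the $k\times k$ matrix whose $(i,j)$ entry is $(-1)^{k-i}$ if $i+j\in\{k+1,k+2\}$ and $0$ otherwise; e.g. $\Gamma_1=(1)$, $\Gamma_2=\begin{pmatrix}0&-1\\1&1\end{pmatrix}$, $\Gamma_3=\begin{pmatrix}0&0&1\\0&-1&-1\\1&1&0\end{pmatrix}$. For $k$ odd, $\Gamma_k^0$ is the $k\times k$ matrix whose $(i,j)$ entry is $1$ if $i+j=k+1$, or if $i+j=k+2$ and $i>(k+1)/2$, and $0$ otherwise; e.g. $\Gamma_1^0=(1)$, $\Gamma_3^0=\begin{pmatrix}0&0&1\\0&1&0\\1&1&0\end{pmatrix}$. *)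

theory Defs
  imports
    "Jordan_Normal_Form.Jordan_Normal_Form"
    "HOL-Library.Multiset"
    "HOL-Computational_Algebra.Polynomial"
begin

definition quadratically_closed :: "'a::field itself \<Rightarrow> bool" where
  "quadratically_closed _ \<longleftrightarrow> (\<forall>p :: 'a poly. degree p = 2 \<longrightarrow> (\<exists>x. poly p x = 0))"

definition ordered_basis ::
    "('a::field \<Rightarrow> 'v::ab_group_add \<Rightarrow> 'v) \<Rightarrow> 'v list \<Rightarrow> bool" where
  "ordered_basis scale vs \<longleftrightarrow>
     distinct vs \<and> \<not> Modules.module.dependent scale (set vs) \<and>
     Modules.module.span scale (set vs) = UNIV"

definition bilinear_form ::
    "('a::field \<Rightarrow> 'v::ab_group_add \<Rightarrow> 'v) \<Rightarrow> ('v \<Rightarrow> 'v \<Rightarrow> 'a) \<Rightarrow> bool" where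
  "bilinear_form scale f \<longleftrightarrow>
     (\<forall>u. Vector_Spaces.linear scale (*) (\<lambda>v. f u v)) \<and>
     (\<forall>v. Vector_Spaces.linear scale (*) (\<lambda>u. f u v))"

definition gram_matrix :: "('v \<Rightarrow> 'v \<Rightarrow> 'a) \<Rightarrow> 'v list \<Rightarrow> 'a mat" where
  "gram_matrix f vs = mat (length vs) (length vs) (\<lambda>(i, j). f (vs ! i) (vs ! j))"

definition nondegenerate_form ::
    "('a::field \<Rightarrow> 'v::ab_group_add \<Rightarrow> 'v) \<Rightarrow> ('v \<Rightarrow> 'v \<Rightarrow> 'a) \<Rightarrow> bool" where
  "nondegenerate_form scale f \<longleftrightarrow>
     (\<forall>vs. ordered_basis scale vs \<longrightarrow> invertible_mat (gram_matrix f vs))"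

text \<open>The asymmetry is meaningful only for non-degenerate bilinear forms on finite dimensional
  spaces, for which it exists and is unique.\<close>

definition asymmetry ::
    "('a::field \<Rightarrow> 'v::ab_group_add \<Rightarrow> 'v) \<Rightarrow> ('v \<Rightarrow> 'v \<Rightarrow> 'a) \<Rightarrow> 'v \<Rightarrow> 'v" where
  "asymmetry scale f = (THE \<sigma>. Vector_Spaces.linear scale scale \<sigma> \<and> bij \<sigma> \<and>
     (\<forall>u v. f v u = f u (\<sigma> v)))"

definition poly_map ::
    "('a::field \<Rightarrow> 'v::ab_group_add \<Rightarrow> 'v) \<Rightarrow> 'a poly \<Rightarrow> ('v \<Rightarrow> 'v) \<Rightarrow> 'v \<Rightarrow> 'v" where
  "poly_map scale p T v = (\<Sum>i\<le>degree p. scale (coeff p i) ((T ^^ i) v))"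

text \<open>Meaningful only for linear endomorphisms of finite dimensional spaces.\<close>

definition minimal_poly ::
    "('a::field \<Rightarrow> 'v::ab_group_add \<Rightarrow> 'v) \<Rightarrow> ('v \<Rightarrow> 'v) \<Rightarrow> 'a poly" where
  "minimal_poly scale T = (THE p. lead_coeff p = 1 \<and> (\<forall>v. poly_map scale p T v = 0) \<and>
     (\<forall>q. q \<noteq> 0 \<and> (\<forall>v. poly_map scale q T v = 0) \<longrightarrow> degree p \<le> degree q))"

definition split_form ::
    "('a::field \<Rightarrow> 'v::ab_group_add \<Rightarrow> 'v) \<Rightarrow> ('v \<Rightarrow> 'v \<Rightarrow> 'a) \<Rightarrow> bool" where
  "split_form scale f \<longleftrightarrow>
     (\<exists>as. minimal_poly scale (asymmetry scale f) = (\<Prod>a\<leftarrow>as. [:- a, 1:]))"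

text \<open>\<^const>\<open>jordan_block\<close> is upper triangular.\<close>

definition lower_jordan :: "nat \<Rightarrow> 'a::field \<Rightarrow> 'a mat" where
  "lower_jordan m x = transpose_mat (jordan_block m x)"

text \<open>Matrix indices start at 0, so the index pair \<open>(i, j)\<close> below is the pair
  \<open>(i + 1, j + 1)\<close> of the usual convention.\<close>

definition Gamma_mat :: "nat \<Rightarrow> 'a::field mat" where
  "Gamma_mat k = mat k k (\<lambda>(i, j).
     if Suc i + Suc j \<in> {k + 1, k + 2} then (- 1) ^ (k - Suc i) else 0)"

definition Gamma0_mat :: "nat \<Rightarrow> 'a::field mat" where
  "Gamma0_mat k = mat k k (\<lambda>(i, j).
     if Suc i + Suc j = k + 1 \<or> (Suc i + Suc j = k + 2 \<and> Suc i > (k + 1) div 2) then 1 else 0)"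

definition hyperbolic_jordan :: "nat \<Rightarrow> 'a::field \<Rightarrow> 'a mat" where
  "hyperbolic_jordan m x = four_block_mat (0\<^sub>m m m) (lower_jordan m x) (1\<^sub>m m) (0\<^sub>m m m)"

text \<open>The number carried by a label is always the size of the matrix, that is,
  \<open>k = 2 m\<close> in the last four families.\<close>

datatype 'a summand =
    Summand_A nat
  | Summand_B nat
  | Summand_C nat
  | Summand_D nat
  | Summand_E nat
  | Summand_F nat
  | Summand_G nat 'a

fun summand_mat :: "'a::field summand \<Rightarrow> 'a mat" where
  "summand_mat (Summand_A k) = Gamma_mat k"
| "summand_mat (Summand_B k) = Gamma0_mat k"
| "summand_mat (Summand_C k) = Gamma_mat k"
| "summand_mat (Summand_D k) = hyperbolic_jordan (k div 2) 1"
| "summand_mat (Summand_E k) = hyperbolic_jordan (k div 2) 1"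
| "summand_mat (Summand_F k) = hyperbolic_jordan (k div 2) (- 1)"
| "summand_mat (Summand_G k x) = hyperbolic_jordan (k div 2) x"

fun admissible_summand :: "'a::field summand \<Rightarrow> bool" where
  "admissible_summand (Summand_A k) \<longleftrightarrow> k \<ge> 1 \<and> odd k \<and> CHAR('a) \<noteq> 2"
| "admissible_summand (Summand_B k) \<longleftrightarrow> k \<ge> 1 \<and> odd k \<and> CHAR('a) = 2"
| "admissible_summand (Summand_C k) \<longleftrightarrow> k \<ge> 1 \<and> even k \<and> CHAR('a) \<noteq> 2"
| "admissible_summand (Summand_D k) \<longleftrightarrow> k \<ge> 1 \<and> (\<exists>m. k = 2 * m \<and> even m)"
| "admissible_summand (Summand_E k) \<longleftrightarrow> k \<ge> 1 \<and> (\<exists>m. k = 2 * m \<and> odd m) \<and> CHAR('a) = 2"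
| "admissible_summand (Summand_F k) \<longleftrightarrow> k \<ge> 1 \<and> (\<exists>m. k = 2 * m \<and> odd m) \<and> CHAR('a) \<noteq> 2"
| "admissible_summand (Summand_G k x) \<longleftrightarrow> k \<ge> 1 \<and> (\<exists>m. k = 2 * m) \<and> x \<noteq> 0 \<and> x\<^sup>2 \<noteq> 1"

definition interchangeable :: "'a::field summand \<Rightarrow> 'a summand \<Rightarrow> bool" where
  "interchangeable s t \<longleftrightarrow>
     s = t \<or> (\<exists>k x. s = Summand_G k x \<and> t = Summand_G k (inverse x))"

definition canonical_decomposition ::
    "('a::field \<Rightarrow> 'v::ab_group_add \<Rightarrow> 'v) \<Rightarrow> ('v \<Rightarrow> 'v \<Rightarrow> 'a) \<Rightarrow> 'a summand list \<Rightarrow> bool" where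
  "canonical_decomposition scale f ss \<longleftrightarrow>
     (\<forall>s \<in> set ss. admissible_summand s) \<and>
     (CHAR('a) = 2 \<longrightarrow>
        \<not> (\<exists>l. odd l \<and> Summand_B l \<in> set ss \<and> Summand_E (2 * l) \<in> set ss)) \<and>
     (\<exists>vs. ordered_basis scale vs \<and> gram_matrix f vs = diag_block_mat (map summand_mat ss))"

end

theory Submission
  imports Defs
begin

text \<open>
  The asymmetry \<open>\<sigma>\<close> is an isometry of \<open>f\<close>, and the adjoint of \<open>\<sigma> - \<lambda>\<close> is \<open>\<sigma>\<^sup>-\<^sup>1 - \<lambda>\<close>, so the
  generalized eigenspace of \<open>\<lambda>\<close> is orthogonal to that of \<open>\<mu>\<close> unless \<open>\<lambda> \<mu> = 1\<close>. For existence one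
  splits off orthogonal summands. Take an eigenvalue \<open>\<lambda>\<close> whose generalized eigenspace is killed by
  \<open>N\<^sup>m\<close>, where \<open>N = \<sigma> - \<lambda>\<close> and \<open>m\<close> is minimal. If \<open>\<lambda>\<^sup>2 \<noteq> 1\<close>, a cyclic subspace for \<open>\<lambda>\<close> pairs with one
  for the inverse of \<open>\<lambda>\<close>. If \<open>\<lambda> = \<plusminus>1\<close>, the form \<open>f u (N\<^sup>m\<^sup>-\<^sup>1 v)\<close> is symmetric or skew-symmetric. Either
  it takes a non-zero value at some \<open>(v, v)\<close>, and then \<open>v\<close> can be corrected until it generates a
  summand \<open>\<Gamma>\<close> or \<open>\<Gamma>\<^sup>0\<close>, or it is alternating, and then two vectors can be corrected until they
  generate a hyperbolic summand. The correction for \<open>\<Gamma>\<close> uses the Cayley transform of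
  \<open>\<lambda> \<sigma>\<close>, the others use the self-adjoint operator \<open>(\<sigma> - \<lambda>) (\<sigma>\<^sup>-\<^sup>1 - \<lambda>)\<close>. In
  characteristic 2 the sum of \<open>B\<^sub>l\<close> and \<open>E\<^sub>2\<^sub>l\<close> splits into three summands, so a decomposition with the
  largest number of summands does not contain both. Uniqueness follows since the Jordan form of
  \<open>\<sigma>\<close> determines all summands up to the choice between \<open>B\<^sub>l\<close> (twice) and \<open>E\<^sub>2\<^sub>l\<close>, which is settled
  by whether \<open>f x ((\<sigma> - 1)\<^sup>l\<^sup>-\<^sup>1 x)\<close> vanishes on the kernel of \<open>(\<sigma> - 1)\<^sup>l\<close>.
\<close>

text \<open>The power \<open>m\<close> is maximal over all eigenvalues on the current subspace, not
  only over one. Non-degeneracy yields a partner of the top vector \<open>(N a ^^ (m - 1)) v\<close>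
  in the generalized eigenspace of \<open>inverse a\<close>, and by maximality the same power kills
  this partner. If 2 is invertible, the Cayley transform \<open>S\<close> is skew-adjoint for
  \<open>b x y = f x y + e * f y x\<close>, and \<open>2 * f x y = b x y + b x (S y)\<close>. So
  \<open>f\<close> on a chain is encoded by the numbers \<open>b x ((S ^^ l) x)\<close>. Elsewhere,
  notably without 1/2, the numbers \<open>f x ((Q e ^^ l) x)\<close> take over. Each correction
  settles one more of these numbers, in descending order of \<open>l\<close>, and leaves the settled
  ones alone. For \<open>S\<close> the equation to be solved is linear; for \<open>Q e\<close> it
  has degree at most 2 and a non-zero linear coefficient. Such equations and the square roots that
  normalize a top value are the only uses of quadratic closedness. Uniqueness needs
  \<sigma>-invariant blocks, which a Gram matrix does not mention; invariance follows from
  orthogonality and non-degeneracy.\<close>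

context vector_space
begin

lemma span_list_lincomb:
  "x \<in> span (set us) \<Longrightarrow> \<exists>c. x = (\<Sum>j<length us. scale (c j) (us ! j))"
proof (induction us arbitrary: x)
  case (Cons u us)
  then obtain k where "x - scale k u \<in> span (set us)" by (auto simp: span_insert)
  then obtain c where c: "x - scale k u = (\<Sum>j<length us. scale (c j) (us ! j))" using Cons.IH by blast
  have "x = (\<Sum>j<length (u # us). scale (case j of 0 \<Rightarrow> k | Suc i \<Rightarrow> c i) ((u # us) ! j))"
    using c[unfolded diff_eq_eq] by (simp add: sum.lessThan_Suc_shift add.commute del: sum.lessThan_Suc)
  then show ?case by blast
qed simp

end

text \<open>The asymmetry and its inverse are parameters, so that all arguments rest on the identity
  \<open>f_swap\<close> instead of a definite description. \<open>form_space_exists\<close> provides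
  them, and \<open>asymmetry_eq\<close> identifies \<sigma> with the defined asymmetry.\<close>

locale form_space = finite_dimensional_vector_space scale Basis
  for scale :: "'a::field \<Rightarrow> 'v::ab_group_add \<Rightarrow> 'v" (infixr \<open>*s\<close> 75) and Basis +
  fixes f :: "'v \<Rightarrow> 'v \<Rightarrow> 'a" and \<sigma> \<tau> :: "'v \<Rightarrow> 'v"
  assumes f_add_left: "f (x + y) z = f x z + f y z"
    and f_scale_left: "f (c *s x) z = c * f x z"
    and f_add_right: "f z (x + y) = f z x + f z y"
    and f_scale_right: "f z (c *s x) = c * f z x"
    and \<sigma>_add: "\<sigma> (x + y) = \<sigma> x + \<sigma> y"
    and \<sigma>_scale: "\<sigma> (c *s x) = c *s \<sigma> x"
    and \<sigma>_\<tau> [simp]: "\<sigma> (\<tau> x) = x"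
    and \<tau>_\<sigma> [simp]: "\<tau> (\<sigma> x) = x"
    and f_swap: "f v u = f u (\<sigma> v)"
    and nondeg: "(\<And>u. f u x = 0) \<Longrightarrow> x = 0"
begin

definition lin :: "('v \<Rightarrow> 'v) \<Rightarrow> bool" where
  "lin T \<longleftrightarrow> (\<forall>x y. T (x + y) = T x + T y) \<and> (\<forall>c x. T (c *s x) = c *s T x)"

lemma lin_add: "lin T \<Longrightarrow> T (x + y) = T x + T y"
  and lin_scale: "lin T \<Longrightarrow> T (c *s x) = c *s T x"
  by (simp_all add: lin_def)

lemma lin_0: "lin T \<Longrightarrow> T 0 = 0"
  using lin_scale[of T 0 0] by simp

lemma lin_minus: "lin T \<Longrightarrow> T (- x) = - T x"
  using lin_scale[of T "-1" x] by simp

lemma lin_diff: "lin T \<Longrightarrow> T (x - y) = T x - T y"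
  using lin_add[of T x "- y"] lin_minus[of T y] by simp

lemma lin_sum: "lin T \<Longrightarrow> T (sum g A) = (\<Sum>a\<in>A. T (g a))"
  by (induction A rule: infinite_finite_induct) (auto simp: lin_add lin_0)

lemma lin_linear: "lin T \<Longrightarrow> Vector_Spaces.linear scale scale T"
  by (simp add: Vector_Spaces.linear_iff lin_def vector_space_axioms)

lemmas lin_simps = lin_add lin_scale lin_0 lin_minus lin_diff lin_sum

text \<open>This stands in for the algebra of polynomials in \<sigma> and \<tau>: such operators
  commute with \<open>N a\<close>, \<open>M a\<close> and their powers, and no polynomial calculus
  is needed.\<close>

definition opr :: "('v \<Rightarrow> 'v) \<Rightarrow> bool" where
  "opr T \<longleftrightarrow> lin T \<and> (\<forall>x. T (\<sigma> x) = \<sigma> (T x))"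

lemma opr_lin: "opr T \<Longrightarrow> lin T" by (simp add: opr_def)

lemma opr_\<sigma>': "opr T \<Longrightarrow> T (\<sigma> x) = \<sigma> (T x)" by (simp add: opr_def)

lemma opr_\<tau>': "opr T \<Longrightarrow> T (\<tau> x) = \<tau> (T x)"
  by (metis opr_\<sigma>' \<sigma>_\<tau> \<tau>_\<sigma>)

lemma opr_id: "opr (\<lambda>x. x)" by (simp add: opr_def lin_def)

lemma opr_comp: "opr S \<Longrightarrow> opr T \<Longrightarrow> opr (\<lambda>x. S (T x))"
  by (simp add: opr_def lin_def)

lemma opr_pow: "opr T \<Longrightarrow> opr (T ^^ n)"
  by (induction n) (auto simp: opr_def lin_def)

lemma opr_scale: "opr T \<Longrightarrow> opr (\<lambda>x. c *s T x)"
  by (simp add: opr_def lin_def scale_right_distrib \<sigma>_scale scale_left_commute)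

lemma opr_add: "opr S \<Longrightarrow> opr T \<Longrightarrow> opr (\<lambda>x. S x + T x)"
  by (simp add: opr_def lin_def scale_right_distrib \<sigma>_add)

lemma lin_\<sigma>: "lin \<sigma>" by (simp add: lin_def \<sigma>_add \<sigma>_scale)

lemma lin_\<tau>: "lin \<tau>"
  unfolding lin_def by (metis \<sigma>_add \<sigma>_scale \<sigma>_\<tau> \<tau>_\<sigma>)

lemma opr_\<sigma>: "opr \<sigma>" by (simp add: opr_def lin_\<sigma>)
lemma opr_\<tau>: "opr \<tau>" by (simp add: opr_def lin_\<tau>)

definition N :: "'a \<Rightarrow> 'v \<Rightarrow> 'v" where "N a x = \<sigma> x - a *s x"
definition M :: "'a \<Rightarrow> 'v \<Rightarrow> 'v" where "M a x = \<tau> x - a *s x"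

lemma opr_N: "opr (N a)"
  unfolding opr_def lin_def N_def
  by (simp add: \<sigma>_add \<sigma>_scale lin_diff[OF lin_\<sigma>] scale_right_distrib scale_right_diff_distrib
      scale_left_commute)

lemma opr_M: "opr (M a)"
  unfolding opr_def lin_def M_def
  by (simp add: lin_simps[OF lin_\<tau>] lin_simps[OF lin_\<sigma>] scale_right_distrib scale_right_diff_distrib
      scale_left_commute)

lemmas lin_N = opr_N[THEN opr_lin] and lin_M = opr_M[THEN opr_lin]
lemmas lin_pow = opr_pow[THEN opr_lin]

lemma opr_N': "opr T \<Longrightarrow> T (N a x) = N a (T x)"
  by (simp add: N_def lin_diff[OF opr_lin] lin_scale[OF opr_lin] opr_\<sigma>')

lemma opr_M': "opr T \<Longrightarrow> T (M a x) = M a (T x)"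
  by (simp add: M_def lin_diff[OF opr_lin] lin_scale[OF opr_lin] opr_\<tau>')

lemma pow_commute: "(\<And>x. T (S x) = S (T x)) \<Longrightarrow> T ((S ^^ n) x) = (S ^^ n) (T x)"
  by (induction n arbitrary: x) auto

lemma opr_N_pow: "opr T \<Longrightarrow> T ((N a ^^ n) x) = (N a ^^ n) (T x)"
  by (rule pow_commute) (rule opr_N')

lemma opr_\<sigma>_pow: "opr T \<Longrightarrow> T ((\<sigma> ^^ n) x) = (\<sigma> ^^ n) (T x)"
  by (rule pow_commute) (rule opr_\<sigma>')

lemma opr_\<tau>_pow: "opr T \<Longrightarrow> T ((\<tau> ^^ n) x) = (\<tau> ^^ n) (T x)"
  by (rule pow_commute) (rule opr_\<tau>')

lemma f_0_left [simp]: "f 0 y = 0" and f_0_right [simp]: "f y 0 = 0"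
  using f_scale_left[of 0 0 y] f_scale_right[of y 0 0] by simp_all

lemma f_minus_left: "f (- x) y = - f x y" and f_minus_right: "f y (- x) = - f y x"
  using f_scale_left[of "-1" x y] f_scale_right[of y "-1" x] by simp_all

lemma f_diff_left: "f (x - y) z = f x z - f y z"
  and f_diff_right: "f z (x - y) = f z x - f z y"
  using f_add_left[of x "-y" z] f_add_right[of z x "-y"] by (simp_all add: f_minus_left f_minus_right)

lemma f_sum_left: "f (sum g A) z = (\<Sum>a\<in>A. f (g a) z)"
  by (induction A rule: infinite_finite_induct) (auto simp: f_add_left)

lemma f_sum_right: "f z (sum g A) = (\<Sum>a\<in>A. f z (g a))"
  by (induction A rule: infinite_finite_induct) (auto simp: f_add_right)

lemmas f_simps = f_add_left f_add_right f_scale_left f_scale_right f_diff_left f_diff_right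
  f_minus_left f_minus_right f_sum_left f_sum_right

lemma f_\<sigma>\<sigma>: "f (\<sigma> x) (\<sigma> y) = f x y"
  by (metis f_swap)

lemma f_\<sigma>: "f (\<sigma> x) y = f x (\<tau> y)"
  by (metis f_\<sigma>\<sigma> \<sigma>_\<tau>)

lemma f_\<tau>: "f (\<tau> x) y = f x (\<sigma> y)"
  by (metis f_\<sigma>\<sigma> \<sigma>_\<tau>)

lemma f_N: "f (N a x) y = f x (M a y)"
  by (simp add: N_def M_def f_simps f_\<sigma>)

lemma f_M: "f (M a x) y = f x (N a y)"
  by (simp add: N_def M_def f_simps f_\<tau>)

lemma f_pow: "(\<And>x y. f (S x) y = f x (T y)) \<Longrightarrow> f ((S ^^ n) x) y = f x ((T ^^ n) y)"
proof (induction n arbitrary: y)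
  case (Suc n)
  have "f ((S ^^ Suc n) x) y = f ((S ^^ n) x) (T y)" by (simp add: Suc.prems)
  also have "\<dots> = f x ((T ^^ n) (T y))" using Suc by blast
  finally show ?case by (simp add: funpow_swap1)
qed simp

lemma f_N_pow: "f ((N a ^^ n) x) y = f x ((M a ^^ n) y)"
  by (rule f_pow) (rule f_N)
lemma f_M_pow: "f ((M a ^^ n) x) y = f x ((N a ^^ n) y)"
  by (rule f_pow) (rule f_M)
lemma f_\<tau>_pow: "f ((\<tau> ^^ n) x) y = f x ((\<sigma> ^^ n) y)"
  by (rule f_pow) (rule f_\<tau>)

lemma \<tau>\<sigma>_pow [simp]: "(\<tau> ^^ n) ((\<sigma> ^^ n) x) = x"
  by (induction n arbitrary: x) (simp_all, metis funpow_swap1 \<tau>_\<sigma>)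

lemma \<sigma>\<tau>_pow [simp]: "(\<sigma> ^^ n) ((\<tau> ^^ n) x) = x"
  by (induction n arbitrary: x) (simp_all, metis funpow_swap1 \<sigma>_\<tau>)

lemma eigen_\<tau>: "\<sigma> x = a *s x \<Longrightarrow> a \<noteq> 0 \<Longrightarrow> \<tau> x = inverse a *s x"
proof -
  assume h: "\<sigma> x = a *s x" "a \<noteq> 0"
  have "x = a *s \<tau> x" using arg_cong[OF h(1), of \<tau>] by (simp add: lin_scale[OF lin_\<tau>])
  then have "inverse a *s x = inverse a *s (a *s \<tau> x)" by simp
  also have "\<dots> = \<tau> x" using h(2) by (simp only: scale_scale) simp
  finally show ?thesis by simp
qed

lemma pow_eigen: "lin T \<Longrightarrow> T x = a *s x \<Longrightarrow> (T ^^ n) x = a ^ n *s x"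
  by (induction n) (auto simp: lin_scale mult.commute)

lemma N_eq_0: "N a x = 0 \<longleftrightarrow> \<sigma> x = a *s x" by (simp add: N_def)

text \<open>\<open>M a\<close> is the adjoint of \<open>N a\<close>. Up to a unit it is
  \<open>N (inverse a)\<close>, which is why a generalized eigenspace pairs with that of the inverse
  eigenvalue.\<close>

lemma M_conv_N: "a \<noteq> 0 \<Longrightarrow> M a x = (- a) *s \<tau> (N (inverse a) x)"
  by (simp add: M_def N_def lin_simps[OF lin_\<tau>] scale_right_diff_distrib)

lemma M_pow_conv_N:
  assumes "a \<noteq> 0"
  shows "(M a ^^ n) x = (- a) ^ n *s (\<tau> ^^ n) ((N (inverse a) ^^ n) x)"
proof (induction n)
  case (Suc n)
  have "(M a ^^ Suc n) x = (- a) *s \<tau> (N (inverse a) ((- a) ^ n *s (\<tau> ^^ n) ((N (inverse a) ^^ n) x)))"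
    by (simp only: funpow.simps o_apply Suc M_conv_N[OF assms])
  also have "\<dots> = (- a) ^ Suc n *s \<tau> (N (inverse a) ((\<tau> ^^ n) ((N (inverse a) ^^ n) x)))"
    by (simp add: lin_scale[OF lin_N] lin_minus[OF lin_N] lin_scale[OF lin_\<tau>] lin_minus[OF lin_\<tau>])
  also have "N (inverse a) ((\<tau> ^^ n) ((N (inverse a) ^^ n) x)) = (\<tau> ^^ n) ((N (inverse a) ^^ Suc n) x)"
    by (simp add: opr_\<tau>_pow[OF opr_N])
  finally show ?case by simp
qed simp

lemma M_pow_eq_0:
  assumes "a \<noteq> 0" "(N (inverse a) ^^ n) x = 0"
  shows "(M a ^^ n) x = 0"
  using assms by (simp add: M_pow_conv_N lin_0[OF lin_pow[OF opr_\<tau>]])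

lemma pow_eq_0_mono: "lin T \<Longrightarrow> (T ^^ m) x = 0 \<Longrightarrow> m \<le> n \<Longrightarrow> (T ^^ n) x = 0"
proof -
  assume h: "lin T" "(T ^^ m) x = 0" "m \<le> n"
  have "lin (T ^^ k)" for k
    by (induction k) (use h(1) in \<open>auto simp: lin_def\<close>)
  then have "(T ^^ (n - m)) ((T ^^ m) x) = 0" using h(2) by (simp add: lin_0)
  then show ?thesis using h(3) by (metis funpow_add le_add_diff_inverse2 o_apply)
qed

lemma N_pow_mono: "(N a ^^ m) x = 0 \<Longrightarrow> m \<le> n \<Longrightarrow> (N a ^^ n) x = 0"
  using pow_eq_0_mono lin_N by blast

lemma M_pow_mono: "(M a ^^ m) x = 0 \<Longrightarrow> m \<le> n \<Longrightarrow> (M a ^^ n) x = 0"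
  using pow_eq_0_mono lin_M by blast

subsection \<open>Invariant subspaces\<close>

definition inv_sub :: "'v set \<Rightarrow> bool" where
  "inv_sub W \<longleftrightarrow> subspace W \<and> (\<forall>x\<in>W. \<sigma> x \<in> W) \<and> (\<forall>x\<in>W. \<tau> x \<in> W)"

lemma inv_subspace: "inv_sub W \<Longrightarrow> subspace W" by (simp add: inv_sub_def)
lemma inv_\<sigma>: "inv_sub W \<Longrightarrow> x \<in> W \<Longrightarrow> \<sigma> x \<in> W" by (simp add: inv_sub_def)
lemma inv_\<tau>: "inv_sub W \<Longrightarrow> x \<in> W \<Longrightarrow> \<tau> x \<in> W" by (simp add: inv_sub_def)
lemma inv_0: "inv_sub W \<Longrightarrow> 0 \<in> W" by (simp add: inv_sub_def subspace_0)
lemma inv_add: "inv_sub W \<Longrightarrow> x \<in> W \<Longrightarrow> y \<in> W \<Longrightarrow> x + y \<in> W" by (simp add: inv_sub_def subspace_add)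
lemma inv_diff: "inv_sub W \<Longrightarrow> x \<in> W \<Longrightarrow> y \<in> W \<Longrightarrow> x - y \<in> W" by (simp add: inv_sub_def subspace_diff)
lemma inv_scale: "inv_sub W \<Longrightarrow> x \<in> W \<Longrightarrow> c *s x \<in> W" by (simp add: inv_sub_def subspace_scale)
lemma inv_sum: "inv_sub W \<Longrightarrow> (\<And>a. a \<in> A \<Longrightarrow> g a \<in> W) \<Longrightarrow> sum g A \<in> W"
  by (simp add: inv_sub_def subspace_sum)
lemma inv_N: "inv_sub W \<Longrightarrow> x \<in> W \<Longrightarrow> N a x \<in> W"
  by (simp add: N_def inv_diff inv_scale inv_\<sigma>)
lemma inv_M: "inv_sub W \<Longrightarrow> x \<in> W \<Longrightarrow> M a x \<in> W"
  by (simp add: M_def inv_diff inv_scale inv_\<tau>)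

lemma pow_mem: "(\<And>x. x \<in> W \<Longrightarrow> T x \<in> W) \<Longrightarrow> x \<in> W \<Longrightarrow> (T ^^ n) x \<in> W"
  by (induction n) auto

lemma inv_N_pow: "inv_sub W \<Longrightarrow> x \<in> W \<Longrightarrow> (N a ^^ n) x \<in> W"
  using pow_mem inv_N by metis
lemma inv_M_pow: "inv_sub W \<Longrightarrow> x \<in> W \<Longrightarrow> (M a ^^ n) x \<in> W"
  using pow_mem inv_M by metis
lemma inv_\<sigma>_pow: "inv_sub W \<Longrightarrow> x \<in> W \<Longrightarrow> (\<sigma> ^^ n) x \<in> W"
  using pow_mem inv_\<sigma> by metis
lemma inv_\<tau>_pow: "inv_sub W \<Longrightarrow> x \<in> W \<Longrightarrow> (\<tau> ^^ n) x \<in> W"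
  using pow_mem inv_\<tau> by metis

lemma inv_UNIV: "inv_sub UNIV" by (simp add: inv_sub_def)

lemma inv_Int: "inv_sub U \<Longrightarrow> inv_sub W \<Longrightarrow> inv_sub (U \<inter> W)"
  by (simp add: inv_sub_def subspace_inter)

lemma inv_ker: "opr T \<Longrightarrow> inv_sub {x. T x = 0}"
  by (auto simp: inv_sub_def subspace_def lin_simps[OF opr_lin] opr_\<sigma>' opr_\<tau>'
      lin_0[OF lin_\<sigma>] lin_0[OF lin_\<tau>])

lemma inv_plus: "inv_sub U \<Longrightarrow> inv_sub W \<Longrightarrow> inv_sub {x + y | x y. x \<in> U \<and> y \<in> W}"
  unfolding inv_sub_def using subspace_sums
  by (auto simp: lin_add[OF lin_\<sigma>] lin_add[OF lin_\<tau>]) blast+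

lemma ex_least_pow:
  fixes T :: "'v \<Rightarrow> 'v"
  assumes "(T ^^ j) x = (0::'v)" "x \<noteq> 0"
  obtains i where "i < j" "(T ^^ Suc i) x = 0" "(T ^^ i) x \<noteq> 0"
proof -
  define k where "k = (LEAST k. (T ^^ k) x = 0)"
  have k: "(T ^^ k) x = 0" "k \<le> j"
    using assms(1) unfolding k_def by (rule LeastI, rule Least_le)
  have "k \<noteq> 0"
  proof
    assume "k = 0"
    with k(1) assms(2) show False by simp
  qed
  then obtain i where i: "k = Suc i" by (cases k) auto
  have "(T ^^ i) x \<noteq> 0" using not_less_Least[of i "\<lambda>k. (T ^^ k) x = 0"] i unfolding k_def by auto
  then show ?thesis using that[of i] k i by auto
qed

text \<open>\<sigma> is injective and dimensions are finite, so \<sigma> maps \<open>W\<close> onto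
  itself and \<tau> preserves it too.\<close>

lemma subset_\<sigma>_imp_inv:
  assumes W: "subspace W" and \<sigma>W: "\<And>x. x \<in> W \<Longrightarrow> \<sigma> x \<in> W"
  shows "inv_sub W"
proof -
  interpret P: finite_dimensional_vector_space_pair_1 scale Basis scale ..
  have lin: "Vector_Spaces.linear scale scale \<sigma>" by (rule lin_linear[OF lin_\<sigma>])
  have "inj \<sigma>" by (metis injI \<tau>_\<sigma>)
  then have "dim (\<sigma> ` W) = dim W"
    using P.dim_image_eq[OF lin, of W] by (meson inj_on_subset subset_UNIV)
  moreover have "subspace (\<sigma> ` W)"
    using P.linear_subspace_image[OF lin W] .
  ultimately have "\<sigma> ` W = W" using subspace_dim_equal[of "\<sigma> ` W" W] W \<sigma>W by auto
  then have "\<tau> x \<in> W" if "x \<in> W" for x using that by (metis imageE \<tau>_\<sigma>)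
  then show ?thesis using W \<sigma>W by (simp add: inv_sub_def)
qed

lemma subset_\<tau>_imp_inv:
  assumes W: "subspace W" and \<tau>W: "\<And>x. x \<in> W \<Longrightarrow> \<tau> x \<in> W"
  shows "inv_sub W"
proof -
  interpret P: finite_dimensional_vector_space_pair_1 scale Basis scale ..
  have lin: "Vector_Spaces.linear scale scale \<tau>" by (rule lin_linear[OF lin_\<tau>])
  have "inj \<tau>" by (metis injI \<sigma>_\<tau>)
  then have "dim (\<tau> ` W) = dim W"
    using P.dim_image_eq[OF lin, of W] by (meson inj_on_subset subset_UNIV)
  moreover have "subspace (\<tau> ` W)"
    using P.linear_subspace_image[OF lin W] .
  ultimately have "\<tau> ` W = W" using subspace_dim_equal[of "\<tau> ` W" W] W \<tau>W by auto
  then have "\<sigma> x \<in> W" if "x \<in> W" for x using that by (metis imageE \<sigma>_\<tau>)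
  then show ?thesis using W \<tau>W by (simp add: inv_sub_def)
qed

lemma span_induct_lin:
  assumes "x \<in> span S" "lin T" "subspace W" "\<And>y. y \<in> S \<Longrightarrow> T y \<in> W"
  shows "T x \<in> W"
  using assms(1)
proof (induction rule: span_induct_alt)
  case base show ?case using assms by (simp add: lin_0 subspace_0)
next
  case (step c y z)
  then show ?case using assms by (simp add: lin_add lin_scale subspace_add subspace_scale)
qed

lemma f_span_zero:
  assumes "x \<in> span S" "y \<in> span T" "\<And>u v. u \<in> S \<Longrightarrow> v \<in> T \<Longrightarrow> f u v = 0"
  shows "f x y = 0"
proof -
  have 1: "f u y = 0" if "u \<in> S" for u
    using assms(2)
  proof (induction rule: span_induct_alt)
    case (step c y z) then show ?case using that assms(3) by (simp add: f_simps)
  qed simp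
  show ?thesis using assms(1)
  proof (induction rule: span_induct_alt)
    case (step c y z) then show ?case using 1 by (simp add: f_simps)
  qed simp
qed

lemma inv_span_\<sigma>:
  assumes "\<And>y. y \<in> S \<Longrightarrow> \<sigma> y \<in> span S"
  shows "inv_sub (span S)"
  using subset_\<sigma>_imp_inv[of "span S"] span_induct_lin[OF _ lin_\<sigma>, of _ S "span S"] assms by auto

lemma inv_span_\<tau>:
  assumes "\<And>y. y \<in> S \<Longrightarrow> \<tau> y \<in> span S"
  shows "inv_sub (span S)"
  using subset_\<tau>_imp_inv[of "span S"] span_induct_lin[OF _ lin_\<tau>, of _ S "span S"] assms by auto

text \<open>The last non-zero iterate of \<open>N a\<close> on \<open>x\<close> is an eigenvector
  for \<open>a\<close>, on which \<open>N b\<close> acts as the non-zero scalar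
  \<open>a - b\<close>.\<close>

lemma eigen_ker_disjoint:
  assumes "(N a ^^ j) x = 0" "(N b ^^ k) x = 0" "a \<noteq> b"
  shows "x = 0"
proof (rule ccontr)
  assume "x \<noteq> 0"
  then obtain i where i: "(N a ^^ Suc i) x = 0" "(N a ^^ i) x \<noteq> 0"
    using ex_least_pow assms(1) by blast
  define y where "y = (N a ^^ i) x"
  have "N a y = 0" using i by (simp add: y_def)
  then have "N b y = (a - b) *s y" by (simp add: N_def scale_left_diff_distrib)
  then have "(N b ^^ k) y = (a - b) ^ k *s y" using pow_eigen[OF lin_N] by blast
  moreover have "(N b ^^ k) y = 0"
    unfolding y_def using opr_N_pow[OF opr_pow[OF opr_N], where x=x] assms(2)
    by (simp add: lin_0[OF lin_pow[OF opr_N]])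
  ultimately show False using i assms(3) by (simp add: y_def)
qed

text \<open>As \<sigma> is an isometry, \<open>f x y\<close> equals
  \<open>f (N a x + a *s x) (N b y + b *s y)\<close>; by induction on the sum of the exponents only
  \<open>a * b * f x y\<close> survives.\<close>

lemma f_ker_orth:
  assumes "(N a ^^ i) x = 0" "(N b ^^ j) y = 0" "a * b \<noteq> 1"
  shows "f x y = 0"
  using assms(1,2)
proof (induction "i + j" arbitrary: i j x y rule: less_induct)
  case less
  show ?case
  proof (cases "i = 0 \<or> j = 0")
    case True then show ?thesis using less.prems by auto
  next
    case False
    then obtain i' j' where ij: "i = Suc i'" "j = Suc j'" by (meson not0_implies_Suc)
    have x': "(N a ^^ i') (N a x) = 0" and y': "(N b ^^ j') (N b y) = 0"
      using less.prems ij by (simp_all add: funpow_swap1)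
    have 1: "f x (N b y) = 0" using less.hyps[of i j' x "N b y"] less.prems y' ij by simp
    have 2: "f (N a x) y = 0" using less.hyps[of i' j "N a x" y] less.prems x' ij by simp
    have 3: "f (N a x) (N b y) = 0" using less.hyps[of i' j' "N a x" "N b y"] x' y' ij by simp
    have "f x y = f (N a x + a *s x) (N b y + b *s y)" by (simp add: N_def f_\<sigma>\<sigma>)
    also have "\<dots> = a * b * f x y" using 1 2 3 by (simp add: f_simps)
    finally have "(1 - a * b) * f x y = 0" by (simp add: algebra_simps)
    then show ?thesis using assms(3) by simp
  qed
qed

end

text \<open>By the determinant, uniqueness of solutions gives existence. It serves to project
  orthogonally and to construct \<sigma>.\<close>

lemma square_system_solvable:
  fixes a :: "nat \<Rightarrow> nat \<Rightarrow> 'a::field"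
  assumes "\<And>c. (\<And>i. i < n \<Longrightarrow> (\<Sum>j<n. a i j * c j) = 0) \<Longrightarrow> (\<forall>j<n. c j = 0)"
  shows "\<exists>c. \<forall>i<n. (\<Sum>j<n. a i j * c j) = b i"
proof -
  define A where "A = mat n n (\<lambda>(i, j). a i j)"
  have A: "A \<in> carrier_mat n n" by (simp add: A_def)
  have row: "(A *\<^sub>v vec n c) $ i = (\<Sum>j<n. a i j * c j)" if "i < n" for c i
    using that by (simp add: A_def scalar_prod_def atLeast0LessThan)
  have "det A \<noteq> 0"
  proof
    assume "det A = 0"
    then obtain v where v: "v \<in> carrier_vec n" "v \<noteq> 0\<^sub>v n" "A *\<^sub>v v = 0\<^sub>v n"
      using det_0_iff_vec_prod_zero_field[OF A] by blast
    have vv: "v = vec n (\<lambda>i. v $ i)" using v(1) by auto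
    have "\<forall>j<n. v $ j = 0"
    proof (rule assms)
      fix i assume i: "i < n"
      have "(\<Sum>j<n. a i j * v $ j) = (A *\<^sub>v vec n (\<lambda>i. v $ i)) $ i" by (rule row[OF i, symmetric])
      also have "\<dots> = 0" using v(3) vv i by simp
      finally show "(\<Sum>j<n. a i j * v $ j) = 0" .
    qed
    then have "v = 0\<^sub>v n" using v(1) by auto
    then show False using v(2) by simp
  qed
  then have "A \<in> Units (ring_mat TYPE('a) n n)" by (rule det_non_zero_imp_unit[OF A])
  then obtain B where B: "B \<in> carrier_mat n n" "A * B = 1\<^sub>m n"
    unfolding Units_def by (auto simp: ring_mat_simps)
  define c where "c = (\<lambda>j. (B *\<^sub>v vec n b) $ j)"
  have "vec n c = B *\<^sub>v vec n b" using B(1) by (auto simp: c_def)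
  then have "A *\<^sub>v vec n c = vec n b"
    using B A assoc_mult_mat_vec[OF A B(1), of "vec n b"] by simp
  then have "\<forall>i<n. (\<Sum>j<n. a i j * c j) = b i" using row by (metis index_vec)
  then show ?thesis by blast
qed

lemma hyperbolic_jordan_dim [simp]:
  "dim_row (hyperbolic_jordan m x) = 2 * m" "dim_col (hyperbolic_jordan m x) = 2 * m"
  by (simp_all add: hyperbolic_jordan_def lower_jordan_def jordan_block_def mult_2)

lemma hyperbolic_jordan_index:
  assumes "i < 2 * m" "j < 2 * m"
  shows "hyperbolic_jordan m x $$ (i, j) =
    (if i < m then (if j = i + m then x else if Suc j = i + m \<and> m \<le> j then 1 else 0)
     else (if i = j + m then 1 else 0))"
  using assms by (auto simp: hyperbolic_jordan_def lower_jordan_def jordan_block_def mult_2)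

section \<open>Non-degenerate subspaces and orthogonal complements\<close>

context form_space
begin

definition nondeg_on :: "'v set \<Rightarrow> bool" where
  "nondeg_on U \<longleftrightarrow> (\<forall>x\<in>U. (\<forall>u\<in>U. f u x = 0) \<longrightarrow> x = 0)"

text \<open>Independence refers to the indices of the list, so it includes that the entries are
  distinct.\<close>

definition indep_list :: "'v list \<Rightarrow> bool" where
  "indep_list us \<longleftrightarrow>
    (\<forall>c. (\<Sum>j<length us. c j *s us ! j) = 0 \<longrightarrow> (\<forall>j<length us. c j = 0))"

lemma lincomb_in_span: "(\<Sum>j<length us. c j *s us ! j) \<in> span (set us)"
  by (intro span_sum span_scale span_base) simp

lemma indep_list_distinct:
  assumes "indep_list us" shows "distinct us"
proof (rule ccontr)
  assume "\<not> distinct us"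
  then obtain i j where ij: "i < length us" "j < length us" "i \<noteq> j" "us ! i = us ! j"
    by (auto simp: distinct_conv_nth)
  define c where "c = (\<lambda>k. if k = i then 1 else if k = j then -1 else (0::'a))"
  have "(\<Sum>k<length us. c k *s us ! k) = (\<Sum>k\<in>{i, j}. c k *s us ! k)"
    by (rule sum.mono_neutral_right) (use ij in \<open>auto simp: c_def\<close>)
  also have "\<dots> = 0" using ij by (simp add: c_def)
  finally have "c i = 0" using assms ij(1) unfolding indep_list_def by blast
  then show False by (simp add: c_def)
qed

lemma sum_set_distinct:
  "distinct us \<Longrightarrow> (\<Sum>v\<in>set us. g v) = (\<Sum>j<length us. g (us ! j))"
  using sum.reindex_bij_betw[OF bij_betw_nth[OF _ refl refl], of us g] by simp

lemma indep_list_independent: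
  assumes "indep_list us" shows "independent (set us)"
  unfolding independent_explicit
proof (intro conjI allI impI ballI)
  fix c v assume "(\<Sum>v\<in>set us. c v *s v) = 0" and v: "v \<in> set us"
  then have "(\<Sum>j<length us. c (us ! j) *s us ! j) = 0"
    using sum_set_distinct[OF indep_list_distinct[OF assms], of "\<lambda>v. c v *s v"] by simp
  then have "\<forall>j<length us. c (us ! j) = 0"
    using assms[unfolded indep_list_def, rule_format, of "\<lambda>j. c (us ! j)"] by blast
  then show "c v = 0" using v by (auto simp: in_set_conv_nth)
qed simp

lemma indep_list_dim:
  assumes "indep_list us" shows "dim (span (set us)) = length us"
  using dim_eq_card_independent[OF indep_list_independent[OF assms]]
    distinct_card[OF indep_list_distinct[OF assms]] by simp

lemma independent_indep_list:
  assumes "distinct us" "independent (set us)" shows "indep_list us"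
  unfolding indep_list_def
proof (intro allI impI)
  fix c j assume c: "(\<Sum>j<length us. c j *s us ! j) = 0" and j: "j < length us"
  define g where "g = (\<lambda>v. c (the_inv_into {..<length us} ((!) us) v))"
  have inj: "inj_on ((!) us) {..<length us}" using assms(1) by (simp add: inj_on_nth)
  have g: "g (us ! j) = c j" if "j < length us" for j
    unfolding g_def using the_inv_into_f_f[OF inj, of j] that by simp
  have "(\<Sum>v\<in>set us. g v *s v) = (\<Sum>j<length us. c j *s us ! j)"
    unfolding sum_set_distinct[OF assms(1)] by (rule sum.cong) (auto simp: g)
  then have "\<forall>v\<in>set us. g v = 0" using assms(2) c unfolding independent_explicit by auto
  then show "c j = 0" using g j by (metis nth_mem)
qed

text \<open>Row \<open>i\<close> of the Gram matrix applied to \<open>c\<close> is the pairing of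
  \<open>us ! i\<close> with the combination that has coefficients \<open>c\<close>. For each family
  of matrices it then suffices to use their triangular shape.\<close>

lemma gram_kernel_imp:
  assumes ker: "\<And>c. (\<And>i. i < length us \<Longrightarrow> (\<Sum>j<length us. f (us ! i) (us ! j) * c j) = 0)
      \<Longrightarrow> (\<forall>j<length us. c j = 0)"
  shows "indep_list us" and "nondeg_on (span (set us))"
proof -
  have eq: "f (us ! i) (\<Sum>j<length us. c j *s us ! j) = (\<Sum>j<length us. f (us ! i) (us ! j) * c j)" for i c
    by (simp add: f_simps mult.commute)
  show "indep_list us"
    unfolding indep_list_def
  proof (intro allI impI)
    fix c assume "(\<Sum>j<length us. c j *s us ! j) = 0"
    then have "(\<Sum>j<length us. f (us ! i) (us ! j) * c j) = 0" for i
      using eq[of i c] by simp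
    then show "\<And>j. j < length us \<Longrightarrow> c j = 0" using ker by blast
  qed
  show "nondeg_on (span (set us))"
    unfolding nondeg_on_def
  proof (intro ballI impI)
    fix x assume x: "x \<in> span (set us)" and o: "\<forall>u\<in>span (set us). f u x = 0"
    then obtain c where c: "x = (\<Sum>j<length us. c j *s us ! j)" using span_list_lincomb by blast
    have "(\<Sum>j<length us. f (us ! i) (us ! j) * c j) = 0" if "i < length us" for i
      using o eq[of i c] c that by (metis nth_mem span_base)
    then have "\<forall>j<length us. c j = 0" using ker by blast
    then show "x = 0" unfolding c by (intro sum.neutral) auto
  qed
qed

lemma basis_list_exists:
  assumes "subspace U"
  obtains us where "indep_list us" "span (set us) = U"
proof -
  obtain B where B: "B \<subseteq> U" "independent B" "U \<subseteq> span B"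
    using basis_exists by metis
  have "finite B" using B(2) by (rule finiteI_independent)
  then obtain us where us: "set us = B" "distinct us" using finite_distinct_list by blast
  have "span B = U" using B assms span_minimal by blast
  then show ?thesis using that[of us] us B independent_indep_list by blast
qed

text \<open>It transfers invariance: an adjusted list inside the span of a Jordan chain of the same
  length has that same span.\<close>

lemma indep_list_span_eq:
  assumes "indep_list us" "set us \<subseteq> span (set ws)" "length ws \<le> length us"
  shows "span (set us) = span (set ws)"
proof -
  have "dim (span (set ws)) \<le> card (set ws)" by (simp add: dim_le_card span_superset)
  also have "\<dots> \<le> length us" using card_length assms(3) le_trans by blast
  finally have "dim (span (set ws)) \<le> dim (span (set us))" using indep_list_dim[OF assms(1)] by simp
  moreover have "span (set us) \<subseteq> span (set ws)" using assms(2) by (simp add: span_minimal)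
  ultimately show ?thesis using subspace_dim_equal by (metis subspace_span)
qed

text \<open>This is the right orthogonal complement. For an invariant \<open>U\<close> it is also
  orthogonal from the left: \<open>f x u = f u (\<sigma> x)\<close>, and the complement is
  \<sigma>-invariant.\<close>

definition perp :: "'v set \<Rightarrow> 'v set" where
  "perp U = {x. \<forall>u\<in>U. f u x = 0}"

text \<open>The coordinates of the projection solve the Gram system of a basis of \<open>U\<close>,
  whose kernel is zero by non-degeneracy.\<close>

lemma perp_decomp:
  assumes U: "subspace U" and nd: "nondeg_on U"
  shows "\<exists>u\<in>U. z - u \<in> perp U"
proof -
  obtain us where us: "indep_list us" "span (set us) = U" using basis_list_exists[OF U] .
  define n where "n = length us"
  have "\<exists>c. \<forall>i<n. (\<Sum>j<n. f (us ! i) (us ! j) * c j) = f (us ! i) z"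
  proof (rule square_system_solvable)
    fix c assume c: "\<And>i. i < n \<Longrightarrow> (\<Sum>j<n. f (us ! i) (us ! j) * c j) = 0"
    define x where "x = (\<Sum>j<n. c j *s us ! j)"
    have "x \<in> U" unfolding x_def n_def us(2)[symmetric] by (rule lincomb_in_span)
    have "f (us ! i) x = 0" if "i < n" for i
      using c[OF that] by (simp add: x_def f_simps mult.commute)
    then have "f u x = 0" if "u \<in> U" for u
      using f_span_zero[of u "set us" x "{x}"] that us(2)
      by (metis in_set_conv_nth n_def singletonD singletonI span_base)
    then have "x = 0" using nd \<open>x \<in> U\<close> unfolding nondeg_on_def by blast
    then show "\<forall>j<n. c j = 0" using us(1) unfolding indep_list_def x_def n_def by blast
  qed
  then obtain c where c: "\<And>i. i < n \<Longrightarrow> (\<Sum>j<n. f (us ! i) (us ! j) * c j) = f (us ! i) z" by blast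
  define y where "y = (\<Sum>j<n. c j *s us ! j)"
  have y: "y \<in> U" unfolding y_def n_def us(2)[symmetric] by (rule lincomb_in_span)
  have "f (us ! i) (z - y) = 0" if "i < n" for i
    using c[OF that] by (simp add: y_def f_simps mult.commute)
  then have "f u (z - y) = 0" if "u \<in> U" for u
    using f_span_zero[of u "set us" "z - y" "{z - y}"] that us(2)
    by (metis in_set_conv_nth n_def singletonD singletonI span_base)
  then show ?thesis using y unfolding perp_def by blast
qed

lemma perp_inv:
  assumes "inv_sub U" shows "inv_sub (perp U)"
proof -
  have "f u (\<sigma> x) = 0" if "x \<in> perp U" "u \<in> U" for u x
    using that inv_\<tau>[OF assms that(2)] by (simp add: perp_def f_\<tau>[symmetric])
  moreover have "f u (\<tau> x) = 0" if "x \<in> perp U" "u \<in> U" for u x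
    using that inv_\<sigma>[OF assms that(2)] by (simp add: perp_def f_\<sigma>[symmetric])
  ultimately show ?thesis
    by (auto simp: inv_sub_def subspace_def perp_def f_simps)
qed

lemma perp_left:
  assumes "inv_sub U" "x \<in> perp U" "u \<in> U"
  shows "f x u = 0"
  using inv_\<sigma>[OF perp_inv[OF assms(1)] assms(2)] assms(3) f_swap[of x u] by (simp add: perp_def)

lemma nondeg_on_perp:
  assumes U: "inv_sub U" "nondeg_on U" and W: "inv_sub W" "nondeg_on W" "U \<subseteq> W"
  shows "nondeg_on (W \<inter> perp U)"
  unfolding nondeg_on_def
proof (intro ballI impI)
  fix x assume x: "x \<in> W \<inter> perp U" and o: "\<forall>u\<in>W \<inter> perp U. f u x = 0"
  have "f w x = 0" if w: "w \<in> W" for w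
  proof -
    obtain u where u: "u \<in> U" "w - u \<in> perp U" using perp_decomp inv_subspace U by blast
    then have "w - u \<in> W" using W w inv_diff by blast
    then have "f (w - u) x = 0" using o u by blast
    moreover have "f u x = 0" using x u by (simp add: perp_def)
    ultimately show ?thesis by (simp add: f_simps)
  qed
  then show "x = 0" using W(2) x unfolding nondeg_on_def by blast
qed

lemma perp_Int:
  assumes "nondeg_on U" shows "U \<inter> perp U \<subseteq> {0}"
  using assms by (auto simp: nondeg_on_def perp_def)

lemma perp_sum:
  assumes U: "inv_sub U" "nondeg_on U" and W: "inv_sub W" "U \<subseteq> W"
  shows "W = {x + y |x y. x \<in> U \<and> y \<in> W \<inter> perp U}"
proof (intro equalityI subsetI)
  fix w assume w: "w \<in> W"
  obtain u where u: "u \<in> U" "w - u \<in> perp U" using perp_decomp inv_subspace U by blast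
  then have "w = u + (w - u)" "w - u \<in> W" using W w inv_diff by auto
  then show "w \<in> {x + y |x y. x \<in> U \<and> y \<in> W \<inter> perp U}" using u by blast
next
  fix w assume "w \<in> {x + y |x y. x \<in> U \<and> y \<in> W \<inter> perp U}"
  then show "w \<in> W" using W inv_add by blast
qed

lemma dim_direct_sum:
  assumes "subspace U" "subspace W" "U \<inter> W \<subseteq> {0}"
  shows "dim {x + y |x y. x \<in> U \<and> y \<in> W} = dim U + dim W"
proof -
  have "dim (U \<inter> W) = 0" using assms(3) by simp
  then show ?thesis using dim_sums_Int[OF assms(1,2)] by linarith
qed

lemma dim_perp:
  assumes U: "inv_sub U" "nondeg_on U" and W: "inv_sub W" "U \<subseteq> W"
  shows "dim W = dim U + dim (W \<inter> perp U)"
proof -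
  have "dim W = dim {x + y |x y. x \<in> U \<and> y \<in> W \<inter> perp U}" using perp_sum[OF assms] by simp
  also have "\<dots> = dim U + dim (W \<inter> perp U)"
    using perp_Int[OF U(2)]
    by (intro dim_direct_sum) (auto simp: inv_subspace U W inv_Int perp_inv)
  finally show ?thesis .
qed

section \<open>Gram matrices and hyperbolic pieces\<close>

lemma gram_nth:
  "gram_matrix f us = A \<Longrightarrow> i < length us \<Longrightarrow> j < length us \<Longrightarrow> f (us ! i) (us ! j) = A $$ (i, j)"
  by (auto simp: gram_matrix_def)

lemma gram_length: "gram_matrix f us = A \<Longrightarrow> length us = dim_row A"
  by (auto simp: gram_matrix_def)

text \<open>The rows of the identity block kill the first half of the coefficients; the rows of the
  Jordan block then form a lower triangular system with \<open>x\<close> on the diagonal.\<close>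

lemma hyperbolic_gram:
  assumes g: "gram_matrix f us = hyperbolic_jordan m x" and x: "x \<noteq> 0"
  shows "indep_list us" "nondeg_on (span (set us))"
proof -
  have len: "length us = 2 * m" using gram_length[OF g] by simp
  have main: "\<forall>j<length us. c j = 0"
    if c: "\<And>i. i < length us \<Longrightarrow> (\<Sum>j<length us. f (us ! i) (us ! j) * c j) = 0" for c
  proof -
    have 1: "c p = 0" if p: "p < m" for p
    proof -
      have "0 = (\<Sum>j<2*m. f (us ! (p + m)) (us ! j) * c j)" using c[of "p + m"] p len by simp
      also have "\<dots> = (\<Sum>j<2*m. if j = p then c j else 0)"
        by (rule sum.cong) (use gram_nth[OF g] len p in \<open>auto simp: hyperbolic_jordan_index\<close>)
      also have "\<dots> = c p" using p by simp
      finally show ?thesis by simp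
    qed
    have 2: "c (p + m) = 0" if "p < m" for p
      using that
    proof (induction p)
      case 0
      have "0 = (\<Sum>j<2*m. f (us ! 0) (us ! j) * c j)" using c[of 0] 0 len by simp
      also have "\<dots> = (\<Sum>j<2*m. if j = m then x * c j else 0)"
        by (rule sum.cong) (use gram_nth[OF g] len 0 in \<open>auto simp: hyperbolic_jordan_index\<close>)
      also have "\<dots> = x * c m" using 0 by simp
      finally show ?case using x by simp
    next
      case (Suc p)
      have "0 = (\<Sum>j<2*m. f (us ! Suc p) (us ! j) * c j)" using c[of "Suc p"] Suc len by simp
      also have "\<dots> = (\<Sum>j<2*m. (if j = Suc p + m then x * c j else 0) + (if j = p + m then c j else 0))"
        by (rule sum.cong) (use gram_nth[OF g] len Suc in \<open>auto simp: hyperbolic_jordan_index\<close>)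
      also have "\<dots> = x * c (Suc p + m)" using Suc by (simp add: sum.distrib)
      finally show ?case using x by simp
    qed
    show ?thesis
    proof (intro allI impI)
      fix j assume "j < length us"
      then show "c j = 0" using 1[of j] 2[of "j - m"] len by (cases "j < m") auto
    qed
  qed
  show "indep_list us" "nondeg_on (span (set us))" using gram_kernel_imp[OF main] by blast+
qed

text \<open>The pairings of \<open>w\<close> with the chain of \<open>v\<close> are cleared from the
  top down. Subtracting a multiple of \<open>(M \<mu> ^^ Suc t) g\<close> from \<open>g\<close>
  alters the pairing with \<open>(N \<mu> ^^ b) v\<close> by a multiple of the one with
  \<open>(N \<mu> ^^ (Suc t + b)) v\<close>, which is 1 at \<open>b0\<close> and 0 above.\<close>

lemma dual_vector_exists:
  assumes B: "inv_sub B" "w \<in> B" and v: "(N \<mu> ^^ m) v = 0" and w: "(M \<mu> ^^ m) w = 0"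
    and p: "f w ((N \<mu> ^^ (m - 1)) v) \<noteq> 0" and m: "0 < m"
  shows "\<exists>g\<in>B. (M \<mu> ^^ m) g = 0 \<and> (\<forall>b. f g ((N \<mu> ^^ b) v) = (if b = m - 1 then 1 else 0))"
proof -
  have "\<exists>g\<in>B. (M \<mu> ^^ m) g = 0 \<and>
      (\<forall>b. m \<le> b + Suc t \<longrightarrow> f g ((N \<mu> ^^ b) v) = (if b = m - 1 then 1 else 0))" for t
  proof (induction t)
    case 0
    define g where "g = inverse (f w ((N \<mu> ^^ (m - 1)) v)) *s w"
    have "(M \<mu> ^^ m) g = 0" using w by (simp add: g_def lin_scale[OF lin_pow[OF opr_M]])
    moreover have "f g ((N \<mu> ^^ b) v) = (if b = m - 1 then 1 else 0)" if "m \<le> Suc b" for b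
    proof (cases "b = m - 1")
      case True then show ?thesis using p by (simp add: g_def f_simps)
    next
      case False
      then have "(N \<mu> ^^ b) v = 0" using that m by (intro N_pow_mono[OF v]) simp
      then show ?thesis using False by simp
    qed
    ultimately show ?case using B by (intro bexI[of _ g]) (auto simp: g_def inv_scale)
  next
    case (Suc t)
    then obtain g where g: "g \<in> B" "(M \<mu> ^^ m) g = 0"
      "\<And>b. m \<le> b + Suc t \<Longrightarrow> f g ((N \<mu> ^^ b) v) = (if b = m - 1 then 1 else 0)" by blast
    show ?case
    proof (cases "m < Suc (Suc t)")
      case True
      have "f g ((N \<mu> ^^ b) v) = (if b = m - 1 then 1 else 0)" for b
        using g(3) True by simp
      then show ?thesis using g by blast
    next
      case False
      define b0 where "b0 = m - Suc (Suc t)"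
      have b0: "b0 + Suc t = m - 1" "b0 < m - 1" using False by (auto simp: b0_def)
      define h where "h = g - f g ((N \<mu> ^^ b0) v) *s (M \<mu> ^^ Suc t) g"
      have "h \<in> B" using g B by (simp add: h_def inv_diff inv_scale inv_M_pow del: funpow.simps)
      moreover have "(M \<mu> ^^ m) h = 0"
      proof -
        have "(M \<mu> ^^ m) ((M \<mu> ^^ Suc t) g) = (M \<mu> ^^ Suc t) ((M \<mu> ^^ m) g)"
          by (rule pow_commute) (metis funpow_swap1)
        then have "(M \<mu> ^^ m) ((M \<mu> ^^ Suc t) g) = 0" using g(2) lin_0[OF lin_pow[OF opr_M]] by metis
        then show ?thesis using g(2)
          by (simp add: h_def lin_diff[OF lin_pow[OF opr_M]] lin_scale[OF lin_pow[OF opr_M]] del: funpow.simps)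
      qed
      moreover have "f h ((N \<mu> ^^ b) v) = (if b = m - 1 then 1 else 0)" if b: "m \<le> b + Suc (Suc t)" for b
      proof -
        have "f h ((N \<mu> ^^ b) v) = f g ((N \<mu> ^^ b) v) - f g ((N \<mu> ^^ b0) v) * f g ((N \<mu> ^^ (Suc t + b)) v)"
          by (simp only: h_def f_simps f_M_pow funpow_add o_apply)
        also have "\<dots> = (if b = m - 1 then 1 else 0)"
        proof (cases "b = b0")
          case True then show ?thesis using b0 g(3)[of "Suc t + b"] by (simp add: add.commute)
        next
          case False
          then have "m \<le> b + Suc t" using b by (auto simp: b0_def)
          then have "f g ((N \<mu> ^^ (Suc t + b)) v) = 0"
            using g(3)[of "Suc t + b"] m by auto
          then show ?thesis using g(3)[of b] \<open>m \<le> b + Suc t\<close> by simp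
        qed
        finally show ?thesis .
      qed
      ultimately show ?thesis by blast
    qed
  qed
  from this[of m] show ?thesis by auto
qed

text \<open>The isotropic halves carry dual bases, so the remaining block of the Gram matrix is the
  matrix of \<sigma> on the first half:
  \<open>f (e i) (d j) = f (d j) (\<sigma> (e i))\<close>.\<close>

lemma hyperbolic_piece:
  assumes \<mu>: "\<mu> \<noteq> 0" and m: "0 < m" and A: "inv_sub A" and B: "inv_sub B"
    and isoA: "\<And>x y. x \<in> A \<Longrightarrow> y \<in> A \<Longrightarrow> f x y = 0"
    and isoB: "\<And>x y. x \<in> B \<Longrightarrow> y \<in> B \<Longrightarrow> f x y = 0"
    and vA: "v \<in> A" and wB: "w \<in> B" and v: "(N \<mu> ^^ m) v = 0" and w: "(M \<mu> ^^ m) w = 0"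
    and p: "f w ((N \<mu> ^^ (m - 1)) v) \<noteq> 0"
  shows "\<exists>us. set us \<subseteq> A \<union> B \<and> gram_matrix f us = hyperbolic_jordan m \<mu> \<and> inv_sub (span (set us))"
proof -
  obtain g where g: "g \<in> B" "(M \<mu> ^^ m) g = 0"
    "\<And>b. f g ((N \<mu> ^^ b) v) = (if b = m - 1 then 1 else 0)"
    using dual_vector_exists[OF B wB v w p m] by blast
  \<comment> \<open>The chain is listed from its eigenvector upwards. Then \<sigma> maps
    \<open>e i\<close> to \<open>\<mu> *s e i\<close> plus \<open>e (i - 1)\<close>, which puts the
    ones on the subdiagonal.\<close>
  define e where "e = (\<lambda>i. (N \<mu> ^^ (m - 1 - i)) v)"
  define d where "d = (\<lambda>j. (M \<mu> ^^ j) g)"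
  define us where "us = map e [0..<m] @ map d [0..<m]"
  have len: "length us = 2 * m" by (simp add: us_def)
  have nth: "us ! i = (if i < m then e i else d (i - m))" if "i < 2 * m" for i
    using that by (auto simp: us_def nth_append)
  have eA: "e i \<in> A" and dB: "d i \<in> B" for i
    using A B vA g by (auto simp: e_def d_def inv_N_pow inv_M_pow)
  have de: "f (d j) (e i) = (if i = j then 1 else 0)" if "i < m" "j < m" for i j
  proof -
    have "f (d j) (e i) = f g ((N \<mu> ^^ (j + (m - 1 - i))) v)"
      by (simp add: d_def e_def f_M_pow funpow_add)
    then show ?thesis using g(3) that by auto
  qed
  have \<sigma>e: "\<sigma> (e i) = \<mu> *s e i + (if i = 0 then 0 else e (i - 1))" if "i < m" for i
  proof -
    have "N \<mu> (e i) = (if i = 0 then 0 else e (i - 1))"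
    proof (cases "i = 0")
      case True
      have "N \<mu> (e 0) = (N \<mu> ^^ Suc (m - 1)) v" by (simp add: e_def)
      then show ?thesis using True v m by simp
    next
      case False
      have "N \<mu> (e i) = (N \<mu> ^^ Suc (m - 1 - i)) v" by (simp add: e_def)
      also have "Suc (m - 1 - i) = m - 1 - (i - 1)" using False that by simp
      finally show ?thesis using False by (simp add: e_def)
    qed
    then show ?thesis by (simp add: N_def algebra_simps)
  qed
  have ed: "f (e i) (d j) = (if i = j then \<mu> else if i = Suc j then 1 else 0)" if "i < m" "j < m" for i j
    using that de[of i j] de[of "i - 1" j]
    by (auto simp: f_swap[of "e i"] \<sigma>e f_simps)
  have \<tau>d: "\<tau> (d j) = \<mu> *s d j + (if Suc j = m then 0 else d (Suc j))" if "j < m" for j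
  proof -
    have "M \<mu> (d j) = (if Suc j = m then 0 else d (Suc j))"
    proof (cases "Suc j = m")
      case True
      have "M \<mu> (d j) = (M \<mu> ^^ Suc j) g" by (simp add: d_def)
      then show ?thesis using True g(2) by simp
    qed (simp add: d_def)
    then show ?thesis by (simp add: M_def algebra_simps)
  qed
  have "gram_matrix f us = hyperbolic_jordan m \<mu>"
  proof (rule eq_matI)
    fix i j assume "i < dim_row (hyperbolic_jordan m \<mu>)" "j < dim_col (hyperbolic_jordan m \<mu>)"
    then have ij: "i < 2 * m" "j < 2 * m" by simp_all
    have "gram_matrix f us $$ (i, j) = f (us ! i) (us ! j)"
      using ij len by (simp add: gram_matrix_def)
    also have "\<dots> = hyperbolic_jordan m \<mu> $$ (i, j)"
    proof (cases "i < m")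
      case True
      then show ?thesis
        using ij ed[of i "j - m"]
        by (cases "j < m") (auto simp: hyperbolic_jordan_index[OF ij] nth isoA[OF eA eA])
    next
      case False
      then show ?thesis
        using ij de[of j "i - m"]
        by (cases "j < m") (auto simp: hyperbolic_jordan_index[OF ij] nth isoB[OF dB dB])
    qed
    finally show "gram_matrix f us $$ (i, j) = hyperbolic_jordan m \<mu> $$ (i, j)" .
  qed (simp_all add: gram_matrix_def len)
  moreover have "inv_sub (span (set us))"
  proof -
    define E where "E = span (e ` {..<m})"
    define D where "D = span (d ` {..<m})"
    have "inv_sub E" unfolding E_def
    proof (rule inv_span_\<sigma>)
      fix y assume "y \<in> e ` {..<m}"
      then obtain i where i: "i < m" "y = e i" by auto
      have "e i \<in> span (e ` {..<m})" "(if i = 0 then 0 else e (i - 1)) \<in> span (e ` {..<m})"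
        using i(1) by (auto intro: span_base simp: span_zero)
      then show "\<sigma> y \<in> span (e ` {..<m})" unfolding i(2) \<sigma>e[OF i(1)]
        by (intro span_add span_scale)
    qed
    moreover have "inv_sub D" unfolding D_def
    proof (rule inv_span_\<tau>)
      fix y assume "y \<in> d ` {..<m}"
      then obtain i where i: "i < m" "y = d i" by auto
      have "d i \<in> span (d ` {..<m})" "(if Suc i = m then 0 else d (Suc i)) \<in> span (d ` {..<m})"
        using i(1) by (auto intro: span_base simp: span_zero)
      then show "\<tau> y \<in> span (d ` {..<m})" unfolding i(2) \<tau>d[OF i(1)]
        by (intro span_add span_scale)
    qed
    moreover have "span (set us) = {x + y |x y. x \<in> E \<and> y \<in> D}"
    proof -
      have "set us = e ` {..<m} \<union> d ` {..<m}" by (auto simp: us_def)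
      then show ?thesis by (simp only: span_Un E_def D_def)
    qed
    ultimately show ?thesis by (simp add: inv_plus)
  qed
  moreover have "set us \<subseteq> A \<union> B" using eA dB by (auto simp: us_def)
  ultimately show ?thesis by blast
qed

end

lemma Gamma_mat_dim [simp]: "dim_row (Gamma_mat k) = k" "dim_col (Gamma_mat k) = k"
  and Gamma0_mat_dim [simp]: "dim_row (Gamma0_mat k) = k" "dim_col (Gamma0_mat k) = k"
  by (simp_all add: Gamma_mat_def Gamma0_mat_def)

text \<open>A non-zero linear coefficient covers the case \<open>\<gamma> = 0\<close>, in which
  quadratic closedness says nothing.\<close>

lemma quadratic_solvable:
  fixes \<alpha> \<beta> \<gamma> :: "'a::field"
  assumes "quadratically_closed TYPE('a)" "\<beta> \<noteq> 0"
  shows "\<exists>c. \<alpha> + \<beta> * c + \<gamma> * c\<^sup>2 = 0"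
proof (cases "\<gamma> = 0")
  case True
  then show ?thesis using assms(2) by (intro exI[of _ "- \<alpha> / \<beta>"]) simp
next
  case False
  then have "degree [:\<alpha>, \<beta>, \<gamma>:] = 2" by simp
  then obtain c where "poly [:\<alpha>, \<beta>, \<gamma>:] c = 0" using assms(1) unfolding quadratically_closed_def by blast
  then show ?thesis by (intro exI[of _ c]) (simp add: algebra_simps power2_eq_square)
qed

lemma square_root_exists:
  fixes a :: "'a::field"
  assumes "quadratically_closed TYPE('a)"
  shows "\<exists>c. c\<^sup>2 = a"
proof -
  have "degree [:- a, 0, 1:] = 2" by simp
  then obtain c where "poly [:- a, 0, 1:] c = 0" using assms unfolding quadratically_closed_def by blast
  then show ?thesis by (intro exI[of _ c]) (simp add: algebra_simps power2_eq_square)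
qed

section \<open>Eigenvalues and the summands \<open>Gamma_mat\<close>\<close>

context form_space
begin

lemma opr_fold_N: "opr (fold N bs)"
  by (induction bs) (simp_all add: opr_id opr_comp opr_N comp_def id_def)

lemma N_pow_length:
  "(N a ^^ j) x = 0 \<Longrightarrow> fold N bs x = 0 \<Longrightarrow> (N a ^^ length bs) x = 0"
proof (induction bs arbitrary: x)
  case (Cons b bs)
  have "(N a ^^ j) (N b x) = 0" using Cons.prems opr_N_pow[OF opr_N[of b], of j a x] lin_0[OF lin_N] by metis
  then have "(N a ^^ length bs) (N b x) = 0" using Cons by simp
  then have z: "N b ((N a ^^ length bs) x) = 0" using opr_N_pow[OF opr_N, of b] by metis
  show ?case
  proof (cases "a = b")
    case True then show ?thesis using z by simp
  next
    case False
    have "(N a ^^ j) ((N a ^^ length bs) x) = 0"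
      using opr_N_pow[OF opr_pow[OF opr_N]] Cons.prems(1) lin_0[OF lin_pow[OF opr_N]] by metis
    then have "(N a ^^ length bs) x = 0"
      using eigen_ker_disjoint[of j a _ 1 b] z False by simp
    then show ?thesis by (simp add: lin_0[OF lin_N])
  qed
qed simp

text \<open>The factors are applied one after another; the last non-zero vector obtained is an
  eigenvector.\<close>

lemma eigenvector_exists:
  "inv_sub W \<Longrightarrow> x \<in> W \<Longrightarrow> x \<noteq> 0 \<Longrightarrow> fold N bs x = 0 \<Longrightarrow> \<exists>a v. v \<in> W \<and> v \<noteq> 0 \<and> N a v = 0"
proof (induction bs arbitrary: x)
  case (Cons b bs)
  show ?case
  proof (cases "N b x = 0")
    case True
    then show ?thesis using Cons.prems by blast
  next
    case False
    then show ?thesis using Cons.IH[of "N b x"] Cons.prems by (simp add: inv_N)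
  qed
qed simp

text \<open>Multiplying \<^term>\<open>w\<close> by the factors \<^term>\<open>N b\<close> with \<^prop>\<open>b \<noteq> a\<close> projects it to the
  generalized eigenspace of \<^term>\<open>a\<close>; on an eigenvector for \<^term>\<open>inverse a\<close> this only rescales
  the pairing.\<close>

lemma eigen_partner:
  assumes W: "inv_sub W" and x: "\<sigma> x = inverse a *s x" and a: "a \<noteq> 0"
  shows "w \<in> W \<Longrightarrow> f w x \<noteq> 0 \<Longrightarrow> (N a ^^ j) (fold N bs w) = 0 \<Longrightarrow>
    \<exists>w' j'. w' \<in> W \<and> f w' x \<noteq> 0 \<and> (N a ^^ j') w' = 0"
proof (induction bs arbitrary: w j)
  case Nil then show ?case by auto
next
  case (Cons b bs)
  show ?case
  proof (cases "b = a")
    case True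
    have "fold N bs (N a w) = N a (fold N bs w)" by (rule opr_N'[OF opr_fold_N])
    then have "(N a ^^ Suc j) (fold N bs w) = 0"
      using Cons.prems(3) True by (simp add: funpow_swap1)
    then show ?thesis using Cons by blast
  next
    case False
    have \<tau>x: "\<tau> x = a *s x" using eigen_\<tau>[OF x] a by simp
    have "f (N b w) x = (a - b) * f w x"
      by (simp add: f_N M_def \<tau>x f_simps algebra_simps)
    then have "f (N b w) x \<noteq> 0" using False Cons.prems by simp
    moreover have "(N a ^^ j) (fold N bs (N b w)) = 0" using Cons.prems by simp
    ultimately show ?thesis using Cons.IH[of "N b w" j] Cons.prems(1) W inv_N by blast
  qed
qed

text \<open>One index serves all eigenvalues \<open>b\<close>, since a partner of \<open>v\<close>
  belongs to the inverse eigenvalue. A largest index exists because none exceeds the number of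
  linear factors.\<close>

lemma max_index_exists:
  assumes W: "inv_sub W" "x \<in> W" "x \<noteq> 0" and s: "\<And>x. fold N as x = 0"
  shows "\<exists>m a v. 0 < m \<and> v \<in> W \<and> (N a ^^ m) v = 0 \<and> (N a ^^ (m - 1)) v \<noteq> 0 \<and>
    (\<forall>b y j. y \<in> W \<longrightarrow> (N b ^^ j) y = 0 \<longrightarrow> (N b ^^ m) y = 0)"
proof -
  define P where "P = (\<lambda>k. \<exists>a v. v \<in> W \<and> (N a ^^ Suc k) v = 0 \<and> (N a ^^ k) v \<noteq> 0)"
  obtain a v where "v \<in> W" "v \<noteq> 0" "N a v = 0"
    using eigenvector_exists[OF W s] by blast
  then have P0: "P 0" unfolding P_def by auto
  have bound: "k \<le> length as" if Pk: "P k" for k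
  proof (rule ccontr)
    assume k: "\<not> k \<le> length as"
    obtain a v where v: "(N a ^^ Suc k) v = 0" "(N a ^^ k) v \<noteq> 0" using Pk unfolding P_def by blast
    have "(N a ^^ length as) v = 0" by (rule N_pow_length[OF v(1) s])
    then show False using v(2) N_pow_mono k by (meson nle_le)
  qed
  obtain k where k: "P k" "\<And>l. P l \<Longrightarrow> l \<le> k"
    using GreatestI_nat[of P 0 "length as"] Greatest_le_nat[of P _ "length as"] P0 bound by blast
  obtain a v where v: "v \<in> W" "(N a ^^ Suc k) v = 0" "(N a ^^ k) v \<noteq> 0" using k(1) unfolding P_def by blast
  have "(N b ^^ Suc k) y = 0" if yy: "y \<in> W" "(N b ^^ j) y = 0" for b y j
  proof (cases "y = 0")
    case True then show ?thesis by (simp add: lin_0[OF lin_pow[OF opr_N]] lin_0[OF lin_N])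
  next
    case False
    then obtain i where i: "(N b ^^ Suc i) y = 0" "(N b ^^ i) y \<noteq> 0" using ex_least_pow[OF yy(2) False] by blast
    then have "P i" unfolding P_def using yy by blast
    then have "i \<le> k" by (rule k(2))
    then show ?thesis using N_pow_mono[OF i(1), of "Suc k"] by simp
  qed
  then show ?thesis using v by (intro exI[of _ "Suc k"] exI[of _ a] exI[of _ v]) auto
qed

lemma chain_inv:
  assumes "(N a ^^ m) v = 0"
  shows "inv_sub (span ((\<lambda>i. (N a ^^ i) v) ` {..<m}))"
proof (rule inv_span_\<sigma>)
  fix y assume "y \<in> (\<lambda>i. (N a ^^ i) v) ` {..<m}"
  then obtain i where i: "i < m" "y = (N a ^^ i) v" by auto
  have "(N a ^^ Suc i) v \<in> span ((\<lambda>i. (N a ^^ i) v) ` {..<m})"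
  proof (cases "Suc i = m")
    case True then show ?thesis using assms span_zero by metis
  next
    case False then show ?thesis using i by (intro span_base) (metis Suc_lessI image_eqI lessThan_iff)
  qed
  moreover have "\<sigma> y = (N a ^^ Suc i) v + a *s y" using i by (simp add: N_def)
  ultimately show "\<sigma> y \<in> span ((\<lambda>i. (N a ^^ i) v) ` {..<m})"
    using i span_base[of y "(\<lambda>i. (N a ^^ i) v) ` {..<m}"] by (auto intro: span_add span_scale)
qed

text \<open>The matrix is triangular with respect to the antidiagonal: row 0 has a single non-zero
  entry, and each later row determines one new coefficient from the preceding one.\<close>

lemma Gamma_gram:
  assumes g: "gram_matrix f us = Gamma_mat k"
  shows "indep_list us" "nondeg_on (span (set us))"
proof -
  have len: "length us = k" using gram_length[OF g] by simp
  have main: "\<forall>j<length us. c j = 0"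
    if c: "\<And>i. i < length us \<Longrightarrow> (\<Sum>j<length us. f (us ! i) (us ! j) * c j) = 0" for c
  proof -
    have cz: "c (k - 1 - p) = 0" if "p < k" for p
      using that
    proof (induction p)
      case 0
      have "0 = (\<Sum>j<k. f (us ! 0) (us ! j) * c j)" using c[of 0] 0 len by simp
      also have "\<dots> = (\<Sum>j<k. if j = k - 1 then (-1) ^ (k - 1) * c j else 0)"
        by (rule sum.cong) (use gram_nth[OF g] len 0 in \<open>auto simp: Gamma_mat_def\<close>)
      also have "\<dots> = (-1) ^ (k - 1) * c (k - 1)" using 0 by simp
      finally show ?case by simp
    next
      case (Suc p)
      have "0 = (\<Sum>j<k. f (us ! Suc p) (us ! j) * c j)" using c[of "Suc p"] Suc len by simp
      also have "\<dots> = (\<Sum>j<k. (if j = k - 1 - Suc p then (-1) ^ (k - 1 - Suc p) * c j else 0) +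
          (if j = k - 1 - p then (-1) ^ (k - 1 - Suc p) * c j else 0))"
        by (rule sum.cong) (use gram_nth[OF g] len Suc in \<open>auto simp: Gamma_mat_def\<close>)
      also have "\<dots> = (-1) ^ (k - 1 - Suc p) * c (k - 1 - Suc p)" using Suc by (simp add: sum.distrib)
      finally show ?case by simp
    qed
    show ?thesis
    proof (intro allI impI)
      fix j assume "j < length us"
      then show "c j = 0" using cz[of "k - 1 - j"] len by simp
    qed
  qed
  show "indep_list us" "nondeg_on (span (set us))" using gram_kernel_imp[OF main] by blast+
qed

lemma Gamma0_gram:
  assumes g: "gram_matrix f us = Gamma0_mat k"
  shows "indep_list us" "nondeg_on (span (set us))"
proof -
  have len: "length us = k" using gram_length[OF g] by simp
  have main: "\<forall>j<length us. c j = 0"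
    if c: "\<And>i. i < length us \<Longrightarrow> (\<Sum>j<length us. f (us ! i) (us ! j) * c j) = 0" for c
  proof -
    have cz: "c (k - 1 - p) = 0" if "p < k" for p
      using that
    proof (induction p)
      case 0
      have "0 = (\<Sum>j<k. f (us ! 0) (us ! j) * c j)" using c[of 0] 0 len by simp
      also have "\<dots> = (\<Sum>j<k. if j = k - 1 then c j else 0)"
        by (rule sum.cong) (use gram_nth[OF g] len 0 in \<open>auto simp: Gamma0_mat_def\<close>)
      also have "\<dots> = c (k - 1)" using 0 by simp
      finally show ?case by simp
    next
      case (Suc p)
      have "0 = (\<Sum>j<k. f (us ! Suc p) (us ! j) * c j)" using c[of "Suc p"] Suc len by simp
      also have "\<dots> = (\<Sum>j<k. (if j = k - 1 - Suc p then c j else 0) +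
          (if j = k - 1 - p then of_bool (Suc (Suc p) > (k + 1) div 2) * c j else 0))"
      proof (rule sum.cong[OF refl])
        fix j assume "j \<in> {..<k}"
        then have j: "j < k" by simp
        have *: "(Suc (Suc p) + Suc j = k + 1) = (j = k - 1 - Suc p)"
          "(Suc (Suc p) + Suc j = k + 2) = (j = k - 1 - p)" "k - 1 - p \<noteq> k - 1 - Suc p"
          using j Suc.prems by auto
        show "f (us ! Suc p) (us ! j) * c j = (if j = k - 1 - Suc p then c j else 0) +
            (if j = k - 1 - p then of_bool (Suc (Suc p) > (k + 1) div 2) * c j else 0)"
          using gram_nth[OF g, of "Suc p" j] len j Suc.prems *(3)
          by (simp only: Gamma0_mat_def index_mat split * if_True) (use Suc.prems in auto)
      qed
      also have "\<dots> = c (k - 1 - Suc p)" using Suc by (simp add: sum.distrib)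
      finally show ?case by simp
    qed
    show ?thesis
    proof (intro allI impI)
      fix j assume "j < length us"
      then show "c j = 0" using cz[of "k - 1 - j"] len by simp
    qed
  qed
  show "indep_list us" "nondeg_on (span (set us))" using gram_kernel_imp[OF main] by blast+
qed

text \<open>The Cayley transform of \<^term>\<open>\<lambda>x. e *s \<sigma> x\<close>, as a polynomial in \<^term>\<open>N e\<close> on the kernel
  of a power of \<^term>\<open>N e\<close>.\<close>

lemma cayley_exists:
  assumes two: "(2::'a) \<noteq> 0" and e: "e * e = 1" and m: "0 < m"
  obtains S h where "opr S" "h \<noteq> 0" "\<And>W x. inv_sub W \<Longrightarrow> x \<in> W \<Longrightarrow> S x \<in> W"
    "\<And>x. (N e ^^ m) x = 0 \<Longrightarrow> S x + e *s \<sigma> (S x) = x - e *s \<sigma> x"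
    "\<And>j x. (N e ^^ j) x = 0 \<Longrightarrow> (S ^^ j) x = 0"
    "\<And>x. (N e ^^ m) x = 0 \<Longrightarrow> (S ^^ (m - 1)) x = h ^ (m - 1) *s (N e ^^ (m - 1)) x"
proof -
  \<comment> \<open>Write N for \<open>N e\<close>. Since e \<sigma> = 1 + e N, the quotient (1 - e
    \<sigma>)/(1 + e \<sigma>) is - e N/(2 + e N) = h N/(1 - h N).\<close>
  define h where "h = - e / 2"
  have h2: "2 * h = - e" using two by (simp add: h_def)
  have h0: "h \<noteq> 0" using h2 e by auto
  \<comment> \<open>For \<open>n = m\<close> this geometric series inverts 1 - h N on the kernel of
    \<open>N e ^^ m\<close>.\<close>
  define G where "G = (\<lambda>n x. \<Sum>k<n. h ^ k *s (N e ^^ k) x)"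
  have oprG: "opr (G n)" for n
    by (induction n) (simp_all add: G_def opr_add opr_scale opr_pow opr_N,
        simp add: opr_def lin_def lin_0[OF lin_\<sigma>])
  have tele: "G n x - h *s N e (G n x) = x - h ^ n *s (N e ^^ n) x" for n x
  proof (induction n)
    case 0 show ?case by (simp add: G_def lin_0[OF lin_N])
  next
    case (Suc n)
    have G: "G (Suc n) x = G n x + h ^ n *s (N e ^^ n) x" by (simp add: G_def)
    have "G (Suc n) x - h *s N e (G (Suc n) x) =
        (G n x - h *s N e (G n x)) + h ^ n *s (N e ^^ n) x - h ^ Suc n *s (N e ^^ Suc n) x"
      unfolding G by (simp add: lin_add[OF lin_N] lin_scale[OF lin_N] scale_right_distrib)
    then show ?case unfolding Suc by simp
  qed
  define S where "S = (\<lambda>x. h *s N e (G m x))"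
  have oprS: "opr S" unfolding S_def by (intro opr_scale opr_comp[OF opr_N oprG])
  have Ginv: "G n x \<in> W" if "inv_sub W" "x \<in> W" for n x W
    unfolding G_def using that by (intro inv_sum inv_scale inv_N_pow)
  have Sinv: "S x \<in> W" if "inv_sub W" "x \<in> W" for x W
    unfolding S_def using that by (intro inv_scale inv_N Ginv)
  have cay: "S x + e *s \<sigma> (S x) = x - e *s \<sigma> x" if x: "(N e ^^ m) x = 0" for x
  proof -
    have G: "G m x = x + S x" using tele[of m x] x by (simp add: S_def algebra_simps)
    have "S x = h *s N e x + h *s N e (S x)"
      using G by (subst S_def) (simp add: lin_add[OF lin_N] scale_right_distrib)
    then have "2 *s S x = (2 * h) *s N e x + (2 * h) *s N e (S x)"
      by (metis scale_right_distrib scale_scale)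
    then have "2 *s S x = - (e *s \<sigma> x - x) - (e *s \<sigma> (S x) - S x)"
      unfolding h2 by (simp add: N_def e scale_right_diff_distrib algebra_simps)
    moreover have "2 *s S x = S x + S x" by (metis one_add_one scale_left_distrib scale_one)
    ultimately show ?thesis by (simp add: algebra_simps)
  qed
  have Spow: "(S ^^ j) x = h ^ j *s (N e ^^ j) ((G m ^^ j) x)" for j x
  proof (induction j)
    case (Suc j)
    have "(S ^^ Suc j) x = h *s N e (G m (h ^ j *s (N e ^^ j) ((G m ^^ j) x)))"
      using Suc by (simp add: S_def)
    also have "\<dots> = h ^ Suc j *s N e (G m ((N e ^^ j) ((G m ^^ j) x)))"
      by (simp add: lin_scale[OF lin_N] lin_scale[OF opr_lin[OF oprG]])
    finally show ?case by (simp add: opr_N_pow[OF oprG])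
  qed simp
  have "(S ^^ j) x = 0" if "(N e ^^ j) x = 0" for j x
    using that opr_N_pow[OF opr_pow[OF oprG, of j m], of j e x]
    by (simp add: Spow lin_0[OF lin_pow[OF oprG]])
  moreover have "(S ^^ (m - 1)) x = h ^ (m - 1) *s (N e ^^ (m - 1)) x" if x: "(N e ^^ m) x = 0" for x
  proof -
    define z where "z = (N e ^^ (m - 1)) x"
    have "N e z = (N e ^^ Suc (m - 1)) x" by (simp add: z_def)
    then have Nz: "N e z = 0" using x m by simp
    \<comment> \<open>\<open>N e\<close> kills \<open>z\<close>, so only the constant term of the
      series acts on it.\<close>
    have Gz: "G m z = z"
    proof -
      have "G n z = z" if "0 < n" for n
        using that
      proof (induction n)
        case (Suc n)
        have "(N e ^^ n) z = 0" if "0 < n" using N_pow_mono[of 1 e z n] Nz that by simp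
        then show ?case using Suc by (cases "n = 0") (simp_all add: G_def)
      qed simp
      then show ?thesis using m by blast
    qed
    have "(G m ^^ j) z = z" for j by (induction j) (simp_all add: Gz)
    then show ?thesis
      using opr_N_pow[OF opr_pow[OF oprG, of "m - 1" m], of "m - 1" e x] by (simp add: Spow z_def)
  qed
  ultimately show ?thesis using that[of S h] oprS h0 Sinv cay by blast
qed

text \<open>Let \<open>b x y = f x y + e * f y x\<close> and
  \<open>\<beta> x l = b x ((S ^^ l) x)\<close> with the Cayley transform \<open>S\<close>.
  Skew-adjointness gives \<open>\<beta> x l = (-1) ^ l * e * \<beta> x l\<close>. At the non-zero
  top value this fixes \<open>e\<close>, and it then makes all values vanish whose index has the
  other parity. Once the top value is 2 and the rest is 0, the identity
  \<open>2 * f x y = b x y + b x (S y)\<close> produces exactly the two antidiagonals of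
  \<open>Gamma_mat\<close>.\<close>

lemma Gamma_piece:
  assumes qc: "quadratically_closed TYPE('a)" and two: "(2::'a) \<noteq> 0" and e: "e * e = 1"
    and m: "0 < m" and W: "inv_sub W" and v: "v \<in> W" "(N e ^^ m) v = 0"
    and p: "f v ((N e ^^ (m - 1)) v) \<noteq> 0"
  shows "e = (-1) ^ (m - 1)"
    and "\<exists>us. set us \<subseteq> W \<and> gram_matrix f us = Gamma_mat m \<and> inv_sub (span (set us))"
proof -
  obtain S h where oprS: "opr S" and h0: "h \<noteq> 0" and Sinv: "\<And>W x. inv_sub W \<Longrightarrow> x \<in> W \<Longrightarrow> S x \<in> W"
    and cay: "\<And>x. (N e ^^ m) x = 0 \<Longrightarrow> S x + e *s \<sigma> (S x) = x - e *s \<sigma> x"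
    and S0: "\<And>j x. (N e ^^ j) x = 0 \<Longrightarrow> (S ^^ j) x = 0"
    and Stop: "\<And>x. (N e ^^ m) x = 0 \<Longrightarrow> (S ^^ (m - 1)) x = h ^ (m - 1) *s (N e ^^ (m - 1)) x"
    using cayley_exists[OF two e m] by blast
  have linS: "lin S" using oprS by (rule opr_lin)
  have linSp: "lin (S ^^ j)" for j using oprS by (rule lin_pow)
  define K where "K = W \<inter> {x. (N e ^^ m) x = 0}"
  have K: "inv_sub K" unfolding K_def by (intro inv_Int W inv_ker opr_pow opr_N)
  have vK: "v \<in> K" using v by (simp add: K_def)
  have KN: "(N e ^^ m) x = 0" if "x \<in> K" for x using that by (simp add: K_def)
  have SK: "(S ^^ j) x \<in> K" if "x \<in> K" for j x using pow_mem[of K S] Sinv[OF K] that by blast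
  have Sm: "(S ^^ j) x = 0" if "x \<in> K" "m \<le> j" for x j using pow_eq_0_mono[OF linS S0[OF KN]] that by blast
  define b where "b = (\<lambda>x y. f x y + e * f y x)"
  have bS: "b x (S y) = f x y - e * f y x" if "y \<in> K" for x y
  proof -
    have "b x (S y) = f x (S y + e *s \<sigma> (S y))" by (simp add: b_def f_simps f_swap[of "S y" x])
    also have "\<dots> = f x y - e * f y x" by (simp add: cay[OF KN[OF that]] f_simps f_swap[of y x])
    finally show ?thesis .
  qed
  have bsym: "b x y = e * b y x" for x y
    using e by (simp add: b_def distrib_left mult.assoc[symmetric])
  have skew: "b (S x) y = - b x (S y)" if "x \<in> K" "y \<in> K" for x y
    using e bsym[of "S x" y] bS[OF that(1), of y] bS[OF that(2), of x]
    by (simp add: right_diff_distrib mult.assoc[symmetric])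
  have bpow: "b ((S ^^ a) x) y = (-1) ^ a * b x ((S ^^ a) y)" if "x \<in> K" "y \<in> K" for a x y
    using that(2)
  proof (induction a arbitrary: y)
    case (Suc a)
    have "b ((S ^^ Suc a) x) y = - b ((S ^^ a) x) (S y)"
      using skew[OF SK[OF that(1)] Suc.prems] by simp
    also have "\<dots> = - ((-1) ^ a * b x ((S ^^ a) (S y)))" using Suc Sinv[OF K] by simp
    finally show ?case by (simp add: funpow_swap1)
  qed simp
  have f2: "2 * f x y = b x y + b x (S y)" if "y \<in> K" for x y
    using bS[OF that, of x] by (simp add: b_def)
  have b_simps: "b (x + y) z = b x z + b y z" "b z (x + y) = b z x + b z y"
    "b (c *s x) z = c * b x z" "b z (c *s x) = c * b z x" "b 0 z = 0" "b z 0 = 0" for x y z c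
    by (simp_all add: b_def f_simps algebra_simps)
  define \<beta> where "\<beta> = (\<lambda>x l. b x ((S ^^ l) x))"
  have \<beta>par: "\<beta> x l = (-1) ^ l * e * \<beta> x l" if "x \<in> K" for x l
    using bsym[of x "(S ^^ l) x"] bpow[OF that that, of l] by (simp add: \<beta>_def mult_ac)
  have Nv: "\<sigma> ((N e ^^ (m - 1)) v) = e *s (N e ^^ (m - 1)) v"
  proof -
    have "N e ((N e ^^ (m - 1)) v) = (N e ^^ Suc (m - 1)) v" by simp
    then show ?thesis using v m by (simp add: N_eq_0)
  qed
  have top: "\<beta> v (m - 1) \<noteq> 0"
  proof -
    have "\<beta> v (m - 1) = h ^ (m - 1) * (f v ((N e ^^ (m - 1)) v) + e * f v (\<sigma> ((N e ^^ (m - 1)) v)))"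
      unfolding \<beta>_def Stop[OF v(2)] b_simps unfolding b_def
      by (simp add: f_swap[of _ v] lin_scale[OF lin_\<sigma>] f_simps distrib_left)
    also have "\<dots> = 2 * h ^ (m - 1) * f v ((N e ^^ (m - 1)) v)"
      unfolding Nv using e by (simp add: f_simps mult.assoc[symmetric])
    finally show ?thesis using p h0 two by simp
  qed
  then have e': "(-1) ^ (m - 1) * e = 1" using \<beta>par[OF vK, of "m - 1"] by simp
  have sgn: "(-1) ^ n * (-1) ^ n = (1::'a)" for n by (simp flip: power_mult_distrib)
  show eq: "e = (-1) ^ (m - 1)"
    using arg_cong[OF e', of "\<lambda>x. (-1) ^ (m - 1) * x"] sgn[of "m - 1"] by (simp add: mult.assoc[symmetric])
  \<comment> \<open>The target value is 2 because the Gram entries are halves of the values of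
    \<beta>.\<close>
  have "\<exists>v\<in>K. \<beta> v (m - 1) = 2 \<and> (\<forall>l. m \<le> l + Suc t \<longrightarrow> l < m - 1 \<longrightarrow> \<beta> v l = 0)" for t
  proof (induction t)
    case 0
    obtain c where c: "c\<^sup>2 = 2 / \<beta> v (m - 1)" using square_root_exists[OF qc] by blast
    have "\<beta> (c *s v) (m - 1) = c\<^sup>2 * \<beta> v (m - 1)"
      by (simp add: \<beta>_def b_simps lin_scale[OF linSp] power2_eq_square)
    then have "\<beta> (c *s v) (m - 1) = 2" using c top by simp
    then show ?case using vK K by (intro bexI[of _ "c *s v"]) (auto simp: inv_scale)
  next
    case (Suc t)
    then obtain x where x: "x \<in> K" "\<beta> x (m - 1) = 2"
      "\<And>l. m \<le> l + Suc t \<Longrightarrow> l < m - 1 \<Longrightarrow> \<beta> x l = 0" by blast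
    show ?case
    proof (cases "m < Suc (Suc t)")
      case True then show ?thesis using x by (intro bexI[of _ x]) auto
    next
      case False
      define l0 where "l0 = m - Suc (Suc t)"
      have l0: "l0 + Suc t = m - 1" using False by (simp add: l0_def)
      have l0': "l = l0 \<or> m \<le> l + Suc t" if "m \<le> l + Suc (Suc t)" for l
        using that by (auto simp: l0_def)
      show ?thesis
      proof (cases "even (Suc t)")
        case False
        \<comment> \<open>For odd \<open>Suc t\<close> the parity relation \<open>\<beta>par\<close>
          by itself makes the value at \<open>l0\<close> zero, and \<open>x\<close> stays as it
          is.\<close>
        have "(-1) ^ l0 * e = -1"
        proof -
          have "(-1::'a) ^ (m - 1) = (-1) ^ l0 * (-1) ^ Suc t" by (simp only: l0[symmetric] power_add)
          also have "(-1) ^ Suc t = (-1::'a)" using False by (rule neg_one_odd_power)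
          finally have e0: "e = - ((-1) ^ l0)" using eq by simp
          show ?thesis unfolding e0 using sgn[of l0] by simp
        qed
        then have "\<beta> x l0 = - \<beta> x l0" using \<beta>par[OF x(1), of l0] by simp
        then have "2 * \<beta> x l0 = 0" by (metis add.right_inverse mult_2)
        then have "\<beta> x l0 = 0" using two by simp
        then show ?thesis using x l0' by blast
      next
        case True
        \<comment> \<open>Adding an even power of \<open>S\<close> changes the value at
          \<open>l0\<close> by \<open>2 * c * \<beta> x (m - 1)\<close>, that is by
          \<open>4 * c\<close>. The quadratic term involves a power of \<open>S\<close> beyond
          \<open>m - 1\<close> and vanishes.\<close>
        define c where "c = - \<beta> x l0 / 4"
        define y where "y = x + c *s (S ^^ Suc t) x"
        have yK: "y \<in> K" unfolding y_def using x K SK inv_add inv_scale by blast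
        have four: "(4::'a) \<noteq> 0" using two by (metis mult_eq_0_iff numeral_Bit0 mult_2)
        have \<beta>y: "\<beta> y l = \<beta> x l + 2 * c * \<beta> x (l + Suc t) + c\<^sup>2 * \<beta> x (l + 2 * Suc t)" for l
        proof -
          have 1: "b ((S ^^ Suc t) x) ((S ^^ k) x) = b x ((S ^^ (k + Suc t)) x)" for k
          proof -
            have "(S ^^ Suc t) ((S ^^ k) x) = (S ^^ (k + Suc t)) x"
              by (metis add.commute funpow_add o_apply)
            moreover have "(-1) ^ Suc t = (1::'a)" using True by (rule neg_one_even_power)
            ultimately show ?thesis using bpow[OF x(1) SK[OF x(1)], of "Suc t" k] by (simp del: funpow.simps power_Suc)
          qed
          have 2: "(S ^^ l) ((S ^^ Suc t) x) = (S ^^ (l + Suc t)) x" by (metis funpow_add o_apply)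
          have 3: "l + Suc t + Suc t = l + 2 * Suc t" by simp
          show ?thesis
            unfolding y_def \<beta>_def lin_add[OF linSp] lin_scale[OF linSp] b_simps 2 1 3
            by (simp only: power2_eq_square distrib_left distrib_right mult.assoc add.assoc mult_2)
        qed
        have \<beta>0: "\<beta> x l = 0" if "m \<le> l" for l using Sm[OF x(1) that] by (simp add: \<beta>_def b_simps)
        have "\<beta> y (m - 1) = 2" unfolding \<beta>y using x m by (simp add: \<beta>0)
        moreover have "\<beta> y l = 0" if "m \<le> l + Suc (Suc t)" "l < m - 1" for l
        proof (cases "l = l0")
          case True
          then show ?thesis using x(2) l0 m four
            by (simp add: \<beta>y \<beta>0 c_def add.commute)
        next
          case False
          then have "m \<le> l + Suc t" using l0' that by blast
          then show ?thesis using x(3) that by (simp add: \<beta>y \<beta>0)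
        qed
        ultimately show ?thesis using yK by blast
      qed
    qed
  qed
  from this[of m] obtain x where x: "x \<in> K" "\<beta> x (m - 1) = 2" "\<And>l. l < m - 1 \<Longrightarrow> \<beta> x l = 0" by auto
  have \<beta>x: "\<beta> x l = (if l = m - 1 then 2 else 0)" for l
    using x Sm[OF x(1), of l] by (cases "m \<le> l") (auto simp: \<beta>_def b_simps)
  define us where "us = map (\<lambda>i. (S ^^ (m - 1 - i)) x) [0..<m]"
  have len: "length us = m" by (simp add: us_def)
  have g: "gram_matrix f us = Gamma_mat m"
  proof (rule eq_matI)
    fix i j assume "i < dim_row (Gamma_mat m :: 'a mat)" "j < dim_col (Gamma_mat m :: 'a mat)"
    then have ij: "i < m" "j < m" by simp_all
    define p q where "p = m - 1 - i" and "q = m - 1 - j"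
    have bb: "b ((S ^^ p) x) ((S ^^ r) x) = (-1) ^ p * \<beta> x (p + r)" for r
      using bpow[OF x(1) SK[OF x(1)], of p r] by (simp add: \<beta>_def funpow_add)
    have "2 * f ((S ^^ p) x) ((S ^^ q) x) = (-1) ^ p * \<beta> x (p + q) + (-1) ^ p * \<beta> x (p + Suc q)"
      using f2[OF SK[OF x(1)], of "(S ^^ p) x" q] bb[of q] bb[of "Suc q"] by simp
    then have "f ((S ^^ p) x) ((S ^^ q) x) =
        (-1) ^ p * (\<beta> x (p + q) / 2) + (-1) ^ p * (\<beta> x (p + Suc q) / 2)"
      using two by (simp add: field_simps)
    then have "f ((S ^^ p) x) ((S ^^ q) x) =
        (-1) ^ p * ((if p + q = m - 1 then 1 else 0) + (if p + Suc q = m - 1 then 1 else 0))"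
      using two by (simp add: \<beta>x distrib_left)
    moreover have "p + q = m - 1 \<longleftrightarrow> Suc i + Suc j = m + 1" "p + Suc q = m - 1 \<longleftrightarrow> Suc i + Suc j = m + 2"
      using ij by (auto simp: p_def q_def)
    ultimately show "gram_matrix f us $$ (i, j) = Gamma_mat m $$ (i, j)"
      using ij len by (auto simp: gram_matrix_def Gamma_mat_def us_def p_def q_def)
  qed (simp_all add: gram_matrix_def len)
  \<comment> \<open>\<open>S\<close> preserves the span of the Jordan chain of \<open>x\<close>, and
    the chain is as long as \<open>us\<close>; so both spans agree and invariance is
    inherited.\<close>
  define cs where "cs = map (\<lambda>i. (N e ^^ i) x) [0..<m]"
  have set_cs: "set cs = (\<lambda>i. (N e ^^ i) x) ` {..<m}" by (auto simp: cs_def)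
  have C: "inv_sub (span (set cs))" unfolding set_cs by (rule chain_inv[OF KN[OF x(1)]])
  have "x \<in> set cs" unfolding set_cs using m by (auto intro!: image_eqI[of _ _ 0])
  then have "set us \<subseteq> span (set cs)"
    using pow_mem[of "span (set cs)" S x] Sinv[OF C] by (auto simp: us_def span_base)
  then have "span (set us) = span (set cs)"
    by (rule indep_list_span_eq[OF Gamma_gram(1)[OF g]]) (simp add: cs_def len)
  then have "inv_sub (span (set us))" using C by simp
  moreover have "set us \<subseteq> W" using SK[OF x(1)] by (auto simp: us_def K_def)
  ultimately show "\<exists>us. set us \<subseteq> W \<and> gram_matrix f us = Gamma_mat m \<and> inv_sub (span (set us))"
    using g by blast
qed

subsection \<open>The eigenvalues \<open>1\<close> and \<open>-1\<close>\<close>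

definition Q :: "'a \<Rightarrow> 'v \<Rightarrow> 'v" where "Q e x = N e (M e x)"

lemma opr_Q: "opr (Q e)"
  unfolding Q_def[abs_def] by (rule opr_comp[OF opr_N opr_M])

lemmas opr_Q_pow = opr_pow[OF opr_Q]
lemmas lin_Q_pow = lin_pow[OF opr_Q]

lemma f_Q_pow: "f ((Q e ^^ l) x) y = f x ((Q e ^^ l) y)"
  by (rule f_pow) (simp add: Q_def f_N f_M)

lemma Q_eq:
  assumes "e * e = 1" shows "Q e x = 2 *s x - e *s (\<sigma> x + \<tau> x)"
proof -
  have "Q e x = x - e *s \<tau> x - (e *s \<sigma> x - (e * e) *s x)"
    by (simp add: Q_def N_def M_def lin_simps[OF lin_\<sigma>] scale_right_diff_distrib)
  also have "\<dots> = (1 + 1) *s x - e *s (\<sigma> x + \<tau> x)"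
    unfolding assms scale_left_distrib by (simp add: scale_right_distrib)
  finally show ?thesis by simp
qed

lemma inv_Q_pow: "inv_sub W \<Longrightarrow> x \<in> W \<Longrightarrow> (Q e ^^ l) x \<in> W"
  using pow_mem[of W "Q e"] by (simp add: Q_def inv_N inv_M)

lemma inverse_self: "e * e = 1 \<Longrightarrow> inverse e = (e::'a)"
  by (metis inverse_unique)

text \<open>As \<open>inverse e = e\<close>, the adjoint \<open>M e\<close> is \<open>- e\<close>
  times \<tau> after \<open>N e\<close>. So \<open>Q e\<close> is a unit times the square of
  \<open>N e\<close>: one step of \<open>Q e\<close> is two steps along a Jordan chain.\<close>

lemma Q_pow_eq:
  assumes "e * e = 1" shows "(Q e ^^ i) x = (- e) ^ i *s (\<tau> ^^ i) ((N e ^^ (2 * i)) x)"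
proof (induction i)
  case (Suc i)
  have e0: "e \<noteq> 0" using assms by auto
  have Q1: "Q e y = (- e) *s \<tau> (N e (N e y))" for y
    unfolding Q_def M_conv_N[OF e0] inverse_self[OF assms]
    by (simp add: lin_simps[OF lin_N] opr_\<tau>'[OF opr_N])
  have "(Q e ^^ Suc i) x = (- e) *s \<tau> (N e (N e ((- e) ^ i *s (\<tau> ^^ i) ((N e ^^ (2 * i)) x))))"
    by (simp only: funpow.simps o_apply Suc Q1)
  also have "\<dots> = (- e) ^ Suc i *s \<tau> (N e (N e ((\<tau> ^^ i) ((N e ^^ (2 * i)) x))))"
    by (simp only: lin_scale[OF lin_N] lin_scale[OF lin_\<tau>] scale_scale power_Suc)
  finally show ?case by (simp add: opr_\<tau>_pow[OF opr_N])
qed simp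

lemma Q_pow_ker:
  assumes "e * e = 1" "(N e ^^ m) x = 0" "m \<le> 2 * l" shows "(Q e ^^ l) x = 0"
  unfolding Q_pow_eq[OF assms(1)] N_pow_mono[OF assms(2,3)]
  by (simp only: lin_0[OF lin_pow[OF opr_\<tau>]] scale_zero_right)

lemma top_eigen:
  assumes "(N e ^^ m) x = 0" "0 < m"
  shows "\<sigma> ((N e ^^ (m - 1)) x) = e *s (N e ^^ (m - 1)) x"
proof -
  have "N e ((N e ^^ (m - 1)) x) = (N e ^^ Suc (m - 1)) x" by simp
  then show ?thesis using assms by (simp add: N_eq_0)
qed

lemma sign_pow: "e * e = (1::'a) \<Longrightarrow> (- e) ^ n * e ^ n = (-1) ^ n"
  by (metis mult_minus_left power_mult_distrib)

lemma top_\<tau>_pow: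
  assumes "e * e = 1" "\<sigma> z = e *s z"
  shows "(- e) ^ n *s (\<tau> ^^ n) z = (-1) ^ n *s z"
proof -
  have "e \<noteq> 0" using assms(1) by auto
  then have "\<tau> z = e *s z" using eigen_\<tau>[OF assms(2)] inverse_self[OF assms(1)] by simp
  then have "(\<tau> ^^ n) z = e ^ n *s z" by (rule pow_eigen[OF lin_\<tau>])
  then show ?thesis using sign_pow[OF assms(1)] by simp
qed

text \<open>On the eigenvector at the end of the chain the power of \<tau> in
  \<open>Q_pow_eq\<close> is a scalar, and only a sign remains. So for an odd length a power of
  \<open>Q e\<close> reaches the top exponent.\<close>

lemma Q_top_odd:
  assumes "e * e = 1" "(N e ^^ (2 * n + 1)) x = 0"
  shows "(Q e ^^ n) x = (-1) ^ n *s (N e ^^ (2 * n)) x"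
proof -
  have "\<sigma> ((N e ^^ (2 * n)) x) = e *s (N e ^^ (2 * n)) x" using top_eigen[OF assms(2)] by simp
  then show ?thesis unfolding Q_pow_eq[OF assms(1)] by (rule top_\<tau>_pow[OF assms(1)])
qed

text \<open>For an even length the powers of \<open>Q e\<close> miss the top exponent by one; the
  extra \<open>N e\<close> makes up for it.\<close>

lemma Q_top_even:
  assumes "e * e = 1" "(N e ^^ (2 * n + 2)) x = 0"
  shows "N e ((Q e ^^ n) x) = (-1) ^ n *s (N e ^^ (2 * n + 1)) x"
proof -
  have "N e ((Q e ^^ n) x) = (- e) ^ n *s (\<tau> ^^ n) (N e ((N e ^^ (2 * n)) x))"
    unfolding Q_pow_eq[OF assms(1)] lin_scale[OF lin_N] opr_\<tau>_pow[OF opr_N] ..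
  also have "N e ((N e ^^ (2 * n)) x) = (N e ^^ (2 * n + 1)) x" by simp
  also have "(- e) ^ n *s (\<tau> ^^ n) \<dots> = (-1) ^ n *s (N e ^^ (2 * n + 1)) x"
    by (rule top_\<tau>_pow[OF assms(1)]) (use top_eigen[OF assms(2)] in simp)
  finally show ?thesis .
qed

lemma M_top:
  assumes "e * e = 1" "(N e ^^ m) x = 0" "0 < m"
  shows "(M e ^^ (m - 1)) x = (-1) ^ (m - 1) *s (N e ^^ (m - 1)) x"
proof -
  have "e \<noteq> 0" using assms(1) by auto
  then show ?thesis
    using top_\<tau>_pow[OF assms(1) top_eigen[OF assms(2,3)]] M_pow_conv_N[of e "m - 1" x]
      inverse_self[OF assms(1)] by simp
qed

text \<open>\<open>f_swap\<close> and adjointness move the power to \<open>u\<close> as one of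
  \<open>M e\<close>. There it agrees with the power of \<open>N e\<close> up to
  \<open>(-1) ^ (m - 1)\<close>, and \<sigma> contributes the factor \<open>e\<close>.\<close>

lemma top_symmetric:
  assumes "e * e = 1" "(N e ^^ m) u = 0" "0 < m"
  shows "f u ((N e ^^ (m - 1)) v) = (-1) ^ (m - 1) * e * f v ((N e ^^ (m - 1)) u)"
proof -
  have "f u ((N e ^^ (m - 1)) v) = f v (\<sigma> ((M e ^^ (m - 1)) u))"
    by (simp add: f_swap[of u] f_N_pow opr_\<sigma>'[OF opr_pow[OF opr_M]])
  then show ?thesis
    unfolding M_top[OF assms] lin_scale[OF lin_\<sigma>] top_eigen[OF assms(2,3)] f_simps by simp
qed

text \<open>Swapping the arguments absorbs \<sigma>, and self-adjointness moves the power back.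
  Consequently \<open>f v ((Q 1 ^^ l) (N 1 v))\<close> is zero, which drives
  \<open>Gamma0_adjust\<close> and excludes even \<open>m\<close> in characteristic 2.\<close>

lemma f_Q_\<sigma>: "f v ((Q e ^^ l) (\<sigma> v)) = f v ((Q e ^^ l) v)"
proof -
  have "f v ((Q e ^^ l) (\<sigma> v)) = f ((Q e ^^ l) v) v"
    by (simp add: opr_\<sigma>'[OF opr_Q_pow] f_swap[of _ v])
  then show ?thesis by (simp add: f_Q_pow)
qed

text \<open>\<^term>\<open>Q e\<close> is self-adjoint, and over \<^term>\<open>Q e\<close> the operator \<^term>\<open>\<sigma>\<close> satisfies a quadratic
  equation. Hence the restriction of \<^term>\<open>f\<close> to a cyclic subspace is
  determined by the values \<^term>\<open>f v ((Q e ^^ l) v)\<close>.\<close>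

lemma isotropic_cyclic_aux:
  assumes "e * e = 1" "\<And>l. f v ((Q e ^^ l) v) = 0"
  shows "f v ((Q e ^^ l) ((\<sigma> ^^ i) v)) = 0"
proof (induction i arbitrary: l rule: induct_nat_012)
  case 0 then show ?case by (simp add: assms)
next
  case 1 then show ?case by (simp add: f_Q_\<sigma> assms)
next
  case (ge2 i)
  have "e *s Q e (\<sigma> y) = (2 * e) *s \<sigma> y - (e * e) *s (\<sigma> (\<sigma> y) + y)" for y
    by (simp add: Q_eq[OF assms(1)] scale_right_diff_distrib mult.commute)
  then have *: "\<sigma> (\<sigma> y) = (2 * e) *s \<sigma> y - e *s Q e (\<sigma> y) - y" for y
    by (simp add: assms(1))
  have "(Q e ^^ l) ((\<sigma> ^^ Suc (Suc i)) v) = (2 * e) *s (Q e ^^ l) ((\<sigma> ^^ Suc i) v)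
      - e *s (Q e ^^ Suc l) ((\<sigma> ^^ Suc i) v) - (Q e ^^ l) ((\<sigma> ^^ i) v)"
    using *[of "(\<sigma> ^^ i) v"]
    by (simp add: lin_diff[OF lin_Q_pow] lin_scale[OF lin_Q_pow] funpow_swap1)
  then show ?case using ge2.IH(1)[of l] ge2.IH(2)[of l] ge2.IH(2)[of "Suc l"] by (simp only: f_simps) simp
qed

text \<open>By the isometry property the pairing of \<open>(\<sigma> ^^ i) v\<close> and
  \<open>(\<sigma> ^^ j) v\<close> depends only on \<open>i\<close> and \<open>j\<close> through
  their difference, so \<open>isotropic_cyclic_aux\<close> with \<open>l = 0\<close> covers all
  pairs.\<close>

lemma isotropic_cyclic:
  assumes e: "e * e = 1" and q: "\<And>l. f v ((Q e ^^ l) v) = 0" and W: "inv_sub W" "v \<in> W"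
  shows "\<exists>A. inv_sub A \<and> v \<in> A \<and> A \<subseteq> W \<and> (\<forall>x\<in>A. \<forall>y\<in>A. f x y = 0)"
proof -
  define A where "A = span (range (\<lambda>i. (\<sigma> ^^ i) v))"
  have "inv_sub A" unfolding A_def
  proof (rule inv_span_\<sigma>)
    fix y assume "y \<in> range (\<lambda>i. (\<sigma> ^^ i) v)"
    then obtain i where "y = (\<sigma> ^^ i) v" by auto
    then have "\<sigma> y = (\<sigma> ^^ Suc i) v" by simp
    then show "\<sigma> y \<in> span (range (\<lambda>i. (\<sigma> ^^ i) v))" by (metis rangeI span_base)
  qed
  moreover have "v \<in> A" unfolding A_def by (rule span_base) (auto intro: range_eqI[of _ _ 0])
  moreover have "A \<subseteq> W" unfolding A_def using W inv_\<sigma>_pow inv_subspace by (intro span_minimal) auto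
  moreover have "f x y = 0" if "x \<in> A" "y \<in> A" for x y
    using that unfolding A_def
  proof (rule f_span_zero)
    have z: "f v ((\<sigma> ^^ i) v) = 0" for i using isotropic_cyclic_aux[OF e q, of 0 i] by simp
    fix u w assume "u \<in> range (\<lambda>i. (\<sigma> ^^ i) v)" "w \<in> range (\<lambda>i. (\<sigma> ^^ i) v)"
    then obtain i j where uw: "u = (\<sigma> ^^ i) v" "w = (\<sigma> ^^ j) v" by auto
    have iso: "f ((\<sigma> ^^ n) x) ((\<sigma> ^^ n) y) = f x y" for n x y by (induction n) (auto simp: f_\<sigma>\<sigma>)
    show "f u w = 0"
    proof (cases "i \<le> j")
      case True
      then have "f u w = f ((\<sigma> ^^ i) v) ((\<sigma> ^^ i) ((\<sigma> ^^ (j - i)) v))"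
        using uw by (metis funpow_add le_add_diff_inverse o_apply)
      then show ?thesis using z by (simp add: iso)
    next
      case False
      then have "f u w = f ((\<sigma> ^^ j) ((\<sigma> ^^ (i - j)) v)) ((\<sigma> ^^ j) v)"
        using uw by (metis funpow_add le_add_diff_inverse nat_le_linear o_apply)
      also have "\<dots> = f v ((\<sigma> ^^ Suc (i - j)) v)" by (simp add: iso f_swap[of _ v])
      finally show ?thesis using z by metis
    qed
  qed
  ultimately show ?thesis by blast
qed

text \<open>Adding \<open>c *s (Q e ^^ d) z\<close> to \<open>x\<close> changes
  \<open>f x ((Q e ^^ l) x)\<close> by a quadratic polynomial in \<open>c\<close> whose linear
  coefficient is \<open>f z ((Q e ^^ (l + d)) (x + \<sigma> x))\<close>. It is non-zero for
  \<open>l + d + 1 = J\<close> and zero beyond, so the values are cleared downwards from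
  \<open>l = J - 1\<close>. The quadratic coefficient can survive only for \<open>d = 0\<close>.
  Writing \<open>Suc l = J\<close> in the hypotheses admits \<open>J = 0\<close>.\<close>

lemma isotropic_adjust:
  assumes qc: "quadratically_closed TYPE('a)"
    and h1: "\<And>l. J \<le> l \<Longrightarrow> f v ((Q e ^^ l) v) = 0"
    and h2: "\<And>l. J \<le> l \<Longrightarrow> f z ((Q e ^^ l) (v + \<sigma> v)) = 0"
    and h3: "\<And>l. Suc l = J \<Longrightarrow> f z ((Q e ^^ l) (v + \<sigma> v)) \<noteq> 0"
    and h4: "\<And>l. J \<le> l \<Longrightarrow> f z ((Q e ^^ l) z) = 0"
    and h5: "\<And>l. Suc l = J \<Longrightarrow> 2 * f z ((Q e ^^ l) z) = 0"
  shows "\<exists>y\<in>span (range (\<lambda>i. (Q e ^^ i) z)). \<forall>l. f (v + y) ((Q e ^^ l) (v + y)) = 0"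
proof -
  define Y where "Y = span (range (\<lambda>i. (Q e ^^ i) z))"
  \<comment> \<open>Earlier corrections lie in \<open>Y\<close> and must not disturb the linear
    coefficient. For \<open>y = (Q e ^^ i) z\<close> the expression is twice
    \<open>f z ((Q e ^^ (n + i)) z)\<close>, which \<open>h4\<close> and \<open>h5\<close> make
    zero.\<close>
  have Yz: "f z ((Q e ^^ n) (y + \<sigma> y)) = 0" if n: "J \<le> Suc n" and y: "y \<in> Y" for n y
  proof -
    have "f x ((Q e ^^ n) (y + \<sigma> y)) = 0" if "x \<in> span {z}" for x
    proof (rule f_span_zero[OF that, of _ "range (\<lambda>i. (Q e ^^ n) ((Q e ^^ i) z + \<sigma> ((Q e ^^ i) z)))"])
      have "opr (\<lambda>y. (Q e ^^ n) (y + \<sigma> y))"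
        by (rule opr_comp[OF opr_Q_pow opr_add[OF opr_id opr_\<sigma>]])
      then show "(Q e ^^ n) (y + \<sigma> y) \<in> span (range (\<lambda>i. (Q e ^^ n) ((Q e ^^ i) z + \<sigma> ((Q e ^^ i) z))))"
        by (intro span_induct_lin[OF y[unfolded Y_def], where T="\<lambda>y. (Q e ^^ n) (y + \<sigma> y)"])
          (auto intro: opr_lin span_base)
    next
      fix u w assume "u \<in> {z}" "w \<in> range (\<lambda>i. (Q e ^^ n) ((Q e ^^ i) z + \<sigma> ((Q e ^^ i) z)))"
      then obtain i where uw: "u = z" "w = (Q e ^^ n) ((Q e ^^ i) z + \<sigma> ((Q e ^^ i) z))" by auto
      have "w = (Q e ^^ (n + i)) z + (Q e ^^ (n + i)) (\<sigma> z)"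
        unfolding uw by (simp add: funpow_add lin_add[OF lin_Q_pow] opr_\<sigma>'[OF opr_Q_pow])
      then have "f u w = 2 * f z ((Q e ^^ (n + i)) z)" using uw by (simp add: f_simps f_Q_\<sigma>)
      also have "\<dots> = 0"
        using h4[of "n + i"] h5[of "n + i"] n by (cases "J \<le> n + i") auto
      finally show "f u w = 0" .
    qed
    then show ?thesis by (simp add: span_base)
  qed
  have "\<exists>y\<in>Y. \<forall>l. J \<le> l + d \<longrightarrow> f (v + y) ((Q e ^^ l) (v + y)) = 0" for d
  proof (induction d)
    case 0
    show ?case by (intro bexI[of _ 0]) (auto simp: h1 Y_def span_zero)
  next
    case (Suc d)
    then obtain y where y: "y \<in> Y" "\<And>l. J \<le> l + d \<Longrightarrow> f (v + y) ((Q e ^^ l) (v + y)) = 0" by blast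
    show ?case
    proof (cases "J \<le> d")
      case True then show ?thesis using y by (intro bexI[of _ y]) auto
    next
      case False
      define t where "t = J - Suc d"
      have t: "t + Suc d = J" using False by (simp add: t_def)
      define x where "x = v + y"
      have zx: "f z ((Q e ^^ n) (x + \<sigma> x)) = f z ((Q e ^^ n) (v + \<sigma> v))" if "J \<le> Suc n" for n
      proof -
        have "x + \<sigma> x = (v + \<sigma> v) + (y + \<sigma> y)" by (simp add: x_def \<sigma>_add)
        then show ?thesis using Yz[OF that y(1)] by (simp only: lin_add[OF lin_Q_pow] f_simps) simp
      qed
      have "f z ((Q e ^^ (t + d)) (x + \<sigma> x)) \<noteq> 0" using zx[of "t + d"] h3[of "t + d"] t by simp
      then obtain c where c: "f x ((Q e ^^ t) x) + f z ((Q e ^^ (t + d)) (x + \<sigma> x)) * c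
          + f z ((Q e ^^ (t + 2 * d)) z) * c\<^sup>2 = 0"
        using quadratic_solvable[OF qc] by blast
      define x' where "x' = x + c *s (Q e ^^ d) z"
      have x': "f x' ((Q e ^^ l) x') = f x ((Q e ^^ l) x) + f z ((Q e ^^ (l + d)) (x + \<sigma> x)) * c
          + f z ((Q e ^^ (l + 2 * d)) z) * c\<^sup>2" for l
      proof -
        have QQ: "(Q e ^^ a) ((Q e ^^ b) y) = (Q e ^^ (a + b)) y" for a b y by (simp add: funpow_add)
        have 1: "f x ((Q e ^^ l) ((Q e ^^ d) z)) = f z ((Q e ^^ (l + d)) (\<sigma> x))"
          by (subst f_swap) (simp only: f_Q_pow QQ add.commute)
        have 2: "f ((Q e ^^ d) z) ((Q e ^^ l) y) = f z ((Q e ^^ (l + d)) y)" for y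
          by (simp only: f_Q_pow QQ add.commute)
        have 3: "(Q e ^^ (l + d)) ((Q e ^^ d) z) = (Q e ^^ (l + 2 * d)) z"
          by (simp only: QQ add.assoc mult_2)
        show ?thesis unfolding x'_def
          by (simp only: f_simps lin_add[OF lin_Q_pow] lin_scale[OF lin_Q_pow] 1 2 3)
            (simp add: algebra_simps power2_eq_square)
      qed
      have "f x' ((Q e ^^ l) x') = 0" if l: "J \<le> l + Suc d" for l
      proof (cases "l = t")
        case True then show ?thesis using x'[of t] c by simp
      next
        case False
        then have "J \<le> l + d" using l t by simp
        then show ?thesis
          using x'[of l] y(2)[of l] zx[of "l + d"] h2[of "l + d"] h4[of "l + 2 * d"] by (simp add: x_def)
      qed
      moreover have "x' = v + (y + c *s (Q e ^^ d) z)" by (simp add: x'_def x_def)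
      moreover have "y + c *s (Q e ^^ d) z \<in> Y"
        unfolding Y_def using y(1) by (intro span_add span_scale) (auto simp: Y_def intro: span_base)
      ultimately show ?thesis by metis
    qed
  qed
  from this[of J] show ?thesis unfolding Y_def by auto
qed

text \<open>\<open>v\<close> is corrected by vectors \<open>(Q e ^^ i) z\<close> with
  \<open>z\<close> derived from \<open>w\<close>. The choice of \<open>z\<close> must turn the
  decisive linear coefficient of \<open>isotropic_adjust\<close> into a non-zero multiple of
  \<open>f w ((N e ^^ (m - 1)) v)\<close>; it depends on the parity of \<open>m\<close> and on
  whether 2 is zero.\<close>

lemma isotropic_vector_exists:
  assumes qc: "quadratically_closed TYPE('a)" and e: "e * e = 1" and m: "0 < m"
    and ty: "(e = 1 \<and> even m) \<or> (e = -1 \<and> odd m)"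
    and W: "inv_sub W" "v \<in> W" "w \<in> W"
    and v: "(N e ^^ m) v = 0" and w: "(N e ^^ m) w = 0"
    and vv: "f v ((N e ^^ (m - 1)) v) = 0" and ww: "f w ((N e ^^ (m - 1)) w) = 0"
    and wv: "f w ((N e ^^ (m - 1)) v) \<noteq> 0"
  shows "\<exists>x\<in>W. (N e ^^ m) x = 0 \<and> (\<forall>l. f x ((Q e ^^ l) x) = 0) \<and>
    f w ((N e ^^ (m - 1)) x) = f w ((N e ^^ (m - 1)) v)"
proof -
  \<comment> \<open>Adding an element of \<open>K\<close> changes neither the exponent that kills
    \<open>v\<close> nor its top pairing with \<open>w\<close>. By \<open>ww\<close> the vector
    \<open>w\<close> itself belongs to \<open>K\<close>.\<close>
  define K where "K = {x \<in> W. (N e ^^ m) x = 0 \<and> f w ((N e ^^ (m - 1)) x) = 0}"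
  have linN: "lin (N e ^^ k)" for k by (rule lin_pow[OF opr_N])
  have K: "inv_sub K"
  proof (rule subset_\<sigma>_imp_inv)
    show "subspace K"
      using W(1) by (auto simp: K_def subspace_def lin_simps[OF linN] f_simps inv_0 inv_add inv_scale)
    show "\<sigma> x \<in> K" if "x \<in> K" for x
    proof -
      have x: "x \<in> W" "(N e ^^ m) x = 0" "f w ((N e ^^ (m - 1)) x) = 0" using that by (auto simp: K_def)
      have "(N e ^^ k) (\<sigma> x) = \<sigma> ((N e ^^ k) x)" for k by (rule opr_\<sigma>'[OF opr_pow[OF opr_N]])
      then show ?thesis
        using x top_eigen[OF x(2) m] W(1) by (simp add: K_def inv_\<sigma> lin_0[OF lin_\<sigma>] f_simps)
    qed
  qed
  have wK: "w \<in> K" using W w ww by (simp add: K_def)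
  have fin: ?thesis if z: "z \<in> K" and
    y: "y \<in> span (range (\<lambda>i. (Q e ^^ i) z))" "\<forall>l. f (v + y) ((Q e ^^ l) (v + y)) = 0" for z y
  proof -
    have "span (range (\<lambda>i. (Q e ^^ i) z)) \<subseteq> K"
      using K z inv_Q_pow inv_subspace by (intro span_minimal) auto
    then have "y \<in> K" using y by blast
    then show ?thesis
      using y v W by (intro bexI[of _ "v + y"]) (auto simp: K_def lin_add[OF linN] f_simps inv_add)
  qed
  have Q0: "(Q e ^^ l) x = 0" if "(N e ^^ m) x = 0" "m \<le> 2 * l" for x l
    using Q_pow_ker[OF e that] .
  have \<sigma>ker: "(N e ^^ m) (\<sigma> x) = 0" if "(N e ^^ m) x = 0" for x
    using opr_\<sigma>'[OF opr_pow[OF opr_N], of m e x] that by (simp add: lin_0[OF lin_\<sigma>])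
  show ?thesis
  proof (cases "even m")
    case True
    then have e1: "e = 1" using ty by auto
    obtain n where n: "m = 2 * n + 2"
    proof -
      obtain k where "m = 2 * k" using True by blast
      then have "m = 2 * (k - 1) + 2" using m by simp
      then show ?thesis using that by blast
    qed
    have top: "N e ((Q e ^^ n) x) = (-1) ^ n *s (N e ^^ (m - 1)) x" if "(N e ^^ m) x = 0" for x
      using Q_top_even[OF e, of n x] that n by simp
    show ?thesis
    proof (cases "(2::'a) = 0")
      case False
      \<comment> \<open>Moved to the other side, \<open>M e\<close> becomes \<open>N e\<close>,
        which completes \<open>Q e ^^ n\<close> to the top exponent. As \<open>e = 1\<close>, the
        sum \<open>v + \<sigma> v\<close> contributes the factor 2.\<close>
      have "\<exists>y\<in>span (range (\<lambda>i. (Q e ^^ i) (M e w))). \<forall>l. f (v + y) ((Q e ^^ l) (v + y)) = 0"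
      proof (rule isotropic_adjust[OF qc, where J="Suc n"])
        fix l
        show "f v ((Q e ^^ l) v) = 0" if "Suc n \<le> l" using Q0[OF v, of l] that n by simp
        show "f (M e w) ((Q e ^^ l) (v + \<sigma> v)) = 0" if "Suc n \<le> l"
          using Q0[OF v, of l] Q0[OF \<sigma>ker[OF v], of l] that n by (simp add: lin_add[OF lin_Q_pow])
        show "f (M e w) ((Q e ^^ l) (M e w)) = 0" if "Suc n \<le> l"
          using Q0[OF w, of l] that n by (simp add: opr_M'[OF opr_Q_pow] lin_0[OF lin_M])
        show "f (M e w) ((Q e ^^ l) (v + \<sigma> v)) \<noteq> 0" if "Suc l = Suc n"
        proof -
          have "f (M e w) ((Q e ^^ l) (v + \<sigma> v)) = f w (N e ((Q e ^^ n) v) + N e ((Q e ^^ n) (\<sigma> v)))"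
            using that by (simp add: f_M lin_add[OF lin_Q_pow] lin_add[OF lin_N])
          also have "\<dots> = (-1) ^ n * 2 * f w ((N e ^^ (m - 1)) v)"
            unfolding top[OF v] top[OF \<sigma>ker[OF v]] opr_\<sigma>'[OF opr_pow[OF opr_N]] top_eigen[OF v m]
            unfolding e1 by (simp add: f_simps)
          finally show ?thesis using wv False by simp
        qed
        show "2 * f (M e w) ((Q e ^^ l) (M e w)) = 0" if "Suc l = Suc n"
        proof -
          have "N e ((Q e ^^ n) (M e w)) = (Q e ^^ Suc n) w"
            by (simp add: opr_M'[OF opr_Q_pow] Q_def)
          also have "\<dots> = 0" by (rule Q0[OF w]) (simp add: n)
          finally show ?thesis using that by (simp add: f_M)
        qed
      qed
      then show ?thesis using fin[OF inv_M[OF K wK]] by blast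
    next
      case True
      have neg: "- x = x" for x :: 'v
      proof -
        have "x + x = 2 *s x" by (metis one_add_one scale_left_distrib scale_one)
        then show ?thesis using True by (simp add: minus_unique)
      qed
      have vv': "v + \<sigma> v = N e v" unfolding N_def e1 by (metis neg add.commute diff_conv_add_uminus scale_one)
      \<comment> \<open>The factor 2 is lost, but now \<open>v + \<sigma> v = N e v\<close> supplies
        the missing \<open>N e\<close>, so \<open>w\<close> itself serves; \<open>h5\<close> holds
        because 2 is zero.\<close>
      have "\<exists>y\<in>span (range (\<lambda>i. (Q e ^^ i) w)). \<forall>l. f (v + y) ((Q e ^^ l) (v + y)) = 0"
      proof (rule isotropic_adjust[OF qc, where J="Suc n"])
        fix l
        show "f v ((Q e ^^ l) v) = 0" if "Suc n \<le> l" using Q0[OF v, of l] that n by simp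
        show "f w ((Q e ^^ l) (v + \<sigma> v)) = 0" if "Suc n \<le> l"
          using Q0[OF v, of l] Q0[OF \<sigma>ker[OF v], of l] that n by (simp add: lin_add[OF lin_Q_pow])
        show "f w ((Q e ^^ l) w) = 0" if "Suc n \<le> l" using Q0[OF w, of l] that n by simp
        show "f w ((Q e ^^ l) (v + \<sigma> v)) \<noteq> 0" if "Suc l = Suc n"
          using that wv by (simp add: vv' opr_N'[OF opr_Q_pow] top[OF v] f_simps)
        show "2 * f w ((Q e ^^ l) w) = 0" if "Suc l = Suc n" using True by simp
      qed
      then show ?thesis using fin[OF wK] by blast
    qed
  next
    case False
    then have e1: "e = -1" using ty by auto
    obtain n where n: "m = 2 * n + 1" using False by (rule oddE)
    have top: "(Q e ^^ n) x = (-1) ^ n *s (N e ^^ (m - 1)) x" if "(N e ^^ m) x = 0" for x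
      using Q_top_odd[OF e, of n x] that n by simp
    have vv': "v + \<sigma> v = N e v" using e1 by (simp add: N_def add.commute)
    have MN: "f (N e w) ((Q e ^^ l) (N e x)) = f w ((Q e ^^ Suc l) x)" for l x
      by (simp add: f_N Q_def opr_N'[OF opr_Q_pow] opr_N'[OF opr_M])
    \<comment> \<open>With \<open>e = -1\<close> again \<open>v + \<sigma> v = N e v\<close>.
      Pairing it with \<open>N e w\<close> yields one more factor \<open>Q e\<close>, so
      \<open>J\<close> drops to \<open>n\<close>. The assumption \<open>vv\<close> then supplies
      \<open>h1\<close> at \<open>l = n\<close>, and \<open>ww\<close> supplies
      \<open>h5\<close>.\<close>
    have "\<exists>y\<in>span (range (\<lambda>i. (Q e ^^ i) (N e w))). \<forall>l. f (v + y) ((Q e ^^ l) (v + y)) = 0"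
    proof (rule isotropic_adjust[OF qc, where J=n])
      fix l
      show "f v ((Q e ^^ l) v) = 0" if "n \<le> l"
      proof (cases "l = n")
        case True then show ?thesis using top[OF v] vv by (simp add: f_simps)
      next
        case False then show ?thesis using Q0[OF v, of l] that n by simp
      qed
      show "f (N e w) ((Q e ^^ l) (v + \<sigma> v)) = 0" if "n \<le> l"
        unfolding vv' MN using Q0[OF v, of "Suc l"] that n by simp
      show "f (N e w) ((Q e ^^ l) (v + \<sigma> v)) \<noteq> 0" if "Suc l = n"
        unfolding vv' MN that using wv by (simp add: top[OF v] f_simps)
      show "f (N e w) ((Q e ^^ l) (N e w)) = 0" if "n \<le> l"
        unfolding MN using Q0[OF w, of "Suc l"] that n by simp
      show "2 * f (N e w) ((Q e ^^ l) (N e w)) = 0" if "Suc l = n"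
        unfolding MN that using ww by (simp add: top[OF w] f_simps)
    qed
    then show ?thesis using fin[OF inv_N[OF K wK]] by blast
  qed
qed

end

lemma two_eq_0_iff: "(2::'a::field) = 0 \<longleftrightarrow> CHAR('a) = 2"
proof
  assume "(2::'a) = 0"
  then have "of_nat 2 = (0::'a)" by simp
  then have "CHAR('a) dvd 2" by (simp only: of_nat_eq_0_iff_char_dvd)
  then have "CHAR('a) \<le> 2" "CHAR('a) \<noteq> 0" by (auto dest: dvd_imp_le intro: ccontr)
  moreover have "CHAR('a) \<noteq> 1" using of_nat_CHAR[where 'a='a] by (metis of_nat_1 zero_neq_one)
  ultimately show "CHAR('a) = 2" by linarith
next
  assume "CHAR('a) = 2"
  then have "of_nat 2 = (0::'a)" using of_nat_CHAR[where 'a='a] by simp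
  then show "(2::'a) = 0" by simp
qed

section \<open>The summands \<open>Gamma0_mat\<close> in characteristic 2\<close>

context form_space
begin

text \<open>Adding \<open>c *s (Q 1 ^^ d) (N 1 x)\<close> changes \<open>f x ((Q 1 ^^ l) x)\<close>
  only through values of the same kind: linearly by minus the one at \<open>l + d + 1\<close>,
  quadratically by the one at \<open>l + 2 * d + 1\<close>. With the value at \<open>n\<close>
  normalized to 1, the lower ones are cleared downwards.\<close>

lemma Gamma0_adjust:
  assumes qc: "quadratically_closed TYPE('a)" and n: "(N 1 ^^ (2 * n + 1)) v = 0"
    and W: "inv_sub W" "v \<in> W" and p: "f v ((Q 1 ^^ n) v) \<noteq> 0"
  shows "\<exists>x\<in>W. (N 1 ^^ (2 * n + 1)) x = 0 \<and> (\<forall>l. f x ((Q 1 ^^ l) x) = (if l = n then 1 else 0))"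
proof -
  define K where "K = W \<inter> {x. (N 1 ^^ (2 * n + 1)) x = 0}"
  have K: "inv_sub K" unfolding K_def by (intro inv_Int W inv_ker opr_pow opr_N)
  have Q0: "(Q 1 ^^ l) x = 0" if "x \<in> K" "n < l" for x l
    using Q_pow_ker[of 1 "2 * n + 1" x l] that by (simp add: K_def)
  have Qn: "(Q e ^^ a) ((Q e ^^ b) y) = (Q e ^^ (a + b)) y" for a b y e
    by (simp add: funpow_add)
  have fN: "f x ((Q 1 ^^ a) (N 1 x)) = 0" for a x
    by (simp add: N_def lin_diff[OF lin_Q_pow] f_simps f_Q_\<sigma>)
  have fM: "f x (M 1 ((Q 1 ^^ a) x)) = - f x ((Q 1 ^^ Suc a) x)" for a x
  proof -
    define y where "y = (Q 1 ^^ a) x"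
    have "Q 1 y = 2 *s y - (\<sigma> y + \<tau> y)" using Q_eq[of 1 y] by simp
    then have "Q 1 y = y + y - (\<sigma> y + \<tau> y)" by (metis one_add_one scale_left_distrib scale_one)
    then have "M 1 y = y - \<sigma> y - Q 1 y" by (simp add: M_def algebra_simps)
    then have "f x (M 1 y) = f x y - f x (\<sigma> y) - f x (Q 1 y)" by (simp add: f_simps)
    moreover have "f x (\<sigma> y) = f x y"
      unfolding y_def using f_Q_\<sigma>[of x a 1] by (simp add: opr_\<sigma>'[OF opr_Q_pow])
    ultimately show ?thesis by (simp add: y_def)
  qed
  have step: "f (x + c *s (Q 1 ^^ d) (N 1 x)) ((Q 1 ^^ l) (x + c *s (Q 1 ^^ d) (N 1 x))) =
      f x ((Q 1 ^^ l) x) - c * f x ((Q 1 ^^ (l + d + 1)) x) + c\<^sup>2 * f x ((Q 1 ^^ (l + 2 * d + 1)) x)"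
    for x c d l
  proof -
    have 1: "f x ((Q 1 ^^ l) ((Q 1 ^^ d) (N 1 x))) = 0" by (simp add: Qn fN)
    have 2: "f ((Q 1 ^^ d) (N 1 x)) ((Q 1 ^^ l) x) = - f x ((Q 1 ^^ (l + d + 1)) x)"
      using fM[of x "d + l"] by (simp add: f_Q_pow Qn f_N add.commute)
    have 3: "f ((Q 1 ^^ d) (N 1 x)) ((Q 1 ^^ l) ((Q 1 ^^ d) (N 1 x))) = f x ((Q 1 ^^ (l + 2 * d + 1)) x)"
    proof -
      have "f ((Q 1 ^^ d) (N 1 x)) ((Q 1 ^^ l) ((Q 1 ^^ d) (N 1 x))) =
          f x (M 1 ((Q 1 ^^ (d + (l + d))) (N 1 x)))"
        by (simp only: f_Q_pow Qn f_N)
      also have "M 1 ((Q 1 ^^ (d + (l + d))) (N 1 x)) = (Q 1 ^^ Suc (d + (l + d))) x"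
        by (simp add: Q_def opr_N'[OF opr_Q_pow] opr_N'[OF opr_M])
      also have "Suc (d + (l + d)) = l + 2 * d + 1" by simp
      finally show ?thesis .
    qed
    show ?thesis
      by (simp only: f_simps lin_add[OF lin_Q_pow] lin_scale[OF lin_Q_pow] 1 2 3)
        (simp add: algebra_simps power2_eq_square)
  qed
  have "\<exists>x\<in>K. f x ((Q 1 ^^ n) x) = 1 \<and> (\<forall>l. n \<le> l + d \<longrightarrow> l < n \<longrightarrow> f x ((Q 1 ^^ l) x) = 0)" for d
  proof (induction d)
    case 0
    obtain c where c: "c\<^sup>2 = 1 / f v ((Q 1 ^^ n) v)" using square_root_exists[OF qc] by blast
    have "f (c *s v) ((Q 1 ^^ n) (c *s v)) = c\<^sup>2 * f v ((Q 1 ^^ n) v)"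
      by (simp add: lin_scale[OF lin_Q_pow] f_simps power2_eq_square)
    then have "f (c *s v) ((Q 1 ^^ n) (c *s v)) = 1" using c p by simp
    moreover have "c *s v \<in> K" using K W n by (intro inv_scale) (auto simp: K_def)
    ultimately show ?case by auto
  next
    case (Suc d)
    then obtain x where x: "x \<in> K" "f x ((Q 1 ^^ n) x) = 1"
      "\<And>l. n \<le> l + d \<Longrightarrow> l < n \<Longrightarrow> f x ((Q 1 ^^ l) x) = 0" by blast
    show ?case
    proof (cases "n < Suc d")
      case True then show ?thesis using x by (intro bexI[of _ x]) auto
    next
      case False
      define t where "t = n - Suc d"
      have t: "t + d + 1 = n" using False by (simp add: t_def)
      \<comment> \<open>The linear coefficient is minus the value at \<open>n\<close>, that is -1.
        For \<open>d = 0\<close> the quadratic coefficient is the value at \<open>n\<close> too, so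
        the equation is of Artin-Schreier type; for larger \<open>d\<close> it is zero.\<close>
      have "\<exists>c. f x ((Q 1 ^^ t) x) + (-1) * c + f x ((Q 1 ^^ (t + 2 * d + 1)) x) * c\<^sup>2 = 0"
        by (rule quadratic_solvable[OF qc]) simp
      then obtain c where c: "f x ((Q 1 ^^ t) x) + (-1) * c + f x ((Q 1 ^^ (t + 2 * d + 1)) x) * c\<^sup>2 = 0"
        by blast
      define y where "y = x + c *s (Q 1 ^^ d) (N 1 x)"
      have "y \<in> K" unfolding y_def using x K by (intro inv_add inv_scale inv_Q_pow inv_N)
      moreover have "f y ((Q 1 ^^ n) y) = 1"
        unfolding y_def step using x by (simp add: Q0 del: funpow.simps)
      moreover have "f y ((Q 1 ^^ l) y) = 0" if l: "n \<le> l + Suc d" "l < n" for l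
      proof (cases "l = t")
        case True
        show ?thesis unfolding y_def step True t using c x(2) by (simp add: mult.commute)
      next
        case False
        then have "n \<le> l + d" using l t by simp
        then show ?thesis unfolding y_def step using x l by (simp add: Q0 del: funpow.simps)
      qed
      ultimately show ?thesis by blast
    qed
  qed
  from this[of n] obtain x where x: "x \<in> K" "f x ((Q 1 ^^ n) x) = 1"
    "\<And>l. l < n \<Longrightarrow> f x ((Q 1 ^^ l) x) = 0" by auto
  then have "f x ((Q 1 ^^ l) x) = (if l = n then 1 else 0)" for l
    using Q0[OF x(1), of l] by (cases l n rule: linorder_cases) auto
  then show ?thesis using x(1) by (auto simp: K_def)
qed

text \<open>Since \<^term>\<open>\<tau> = (\<lambda>x. \<sigma> x + Q 1 x)\<close> in characteristic 2, a term \<^term>\<open>(\<tau> ^^ s) ((Q 1 ^^ i) x)\<close>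
  only involves the powers of \<^term>\<open>Q 1\<close> from \<open>i\<close> up to \<open>i + s\<close>.\<close>

lemma char2_pairings:
  assumes two: "(2::'a) = 0" and n: "(N 1 ^^ (2 * n + 1)) x = 0"
    and q: "\<And>l. f x ((Q 1 ^^ l) x) = (if l = n then 1 else 0)"
  shows "f x ((\<tau> ^^ p) ((N 1 ^^ (2 * n)) x)) = 1"
    and "\<And>a b. a < n \<Longrightarrow> b < n \<Longrightarrow> f x ((\<tau> ^^ a) ((N 1 ^^ (a + b)) x)) = 0"
    and "\<And>l. 0 < n \<Longrightarrow> l < 2 * n \<Longrightarrow> f x ((\<tau> ^^ (n - 1)) ((N 1 ^^ l) x)) = 0"
    and "\<And>l. n \<le> l \<Longrightarrow> l < 2 * n \<Longrightarrow>
      f x ((\<tau> ^^ (l + 1 - n)) ((N 1 ^^ l) x)) = (if l = 2 * n - 1 then 1 else 0)"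
proof -
  have dbl: "x + x = 0" for x :: 'v
    using two by (metis one_add_one scale_left_distrib scale_one scale_zero_left)
  have neg: "- x = x" for x :: 'v using dbl[of x] by (simp add: minus_unique)
  have dbl': "c + c = 0" for c :: 'a using two by (metis mult_2 mult_zero_left)
  have neg': "- c = c" for c :: 'a using dbl'[of c] by (simp add: minus_unique)
  have \<tau>: "\<tau> y = \<sigma> y + Q 1 y" for y
  proof -
    have "Q 1 y = - (\<sigma> y + \<tau> y)" using Q_eq[of 1 y] two by simp
    then show ?thesis using dbl[of "\<sigma> y"] by (simp add: neg add.assoc[symmetric])
  qed
  define G where "G = (\<lambda>p l. f x ((\<tau> ^^ p) ((N 1 ^^ l) x)))"
  have C: "f x ((\<tau> ^^ s) ((Q 1 ^^ i) x)) = 0" if "s + i < n" for s i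
    using that
  proof (induction s arbitrary: i rule: induct_nat_012)
    case 0 then show ?case by (simp add: q)
  next
    case 1
    then show ?case using q[of i] q[of "Suc i"] f_Q_\<sigma>[of x i 1]
      by (simp add: \<tau>[of "(Q 1 ^^ i) x"] f_simps opr_\<sigma>'[OF opr_Q_pow])
  next
    case (ge2 s)
    have "(\<tau> ^^ Suc (Suc s)) ((Q 1 ^^ i) x) = (\<tau> ^^ s) ((Q 1 ^^ i) x) + (\<tau> ^^ Suc s) ((Q 1 ^^ Suc i) x)"
      using \<tau>[of "(\<tau> ^^ Suc s) ((Q 1 ^^ i) x)"] opr_\<tau>_pow[OF opr_Q, of 1 "Suc s"] by simp
    then show ?case using ge2.IH(1)[of i] ge2.IH(2)[of "Suc i"] ge2.prems by (simp only: f_simps) simp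
  qed
  have Npow: "(N 1 ^^ (2 * i)) y = (\<sigma> ^^ i) ((Q 1 ^^ i) y)" for i y
    using Q_pow_eq[of 1 i y] neg'[of 1] by simp
  have \<sigma>\<tau>: "(\<tau> ^^ a) ((\<sigma> ^^ b) y) = (\<tau> ^^ (a - b)) y" if "b \<le> a" for a b y
    by (metis funpow_add le_add_diff_inverse2 o_apply \<tau>\<sigma>_pow that)
  \<comment> \<open>By \<open>Npow\<close> an even power of \<open>N 1\<close> contributes a power
    of \<sigma>, which cancels against \<tau> and leaves an expression covered by \<open>C\<close>.
    For odd \<open>l\<close> one factor \<open>N 1\<close>, that is \<sigma> - 1, is left over and
    expanded.\<close>
  have B3: "G (n - 1) l = 0" if l: "l < 2 * n" for l
  proof (cases "even l")
    case True
    then obtain i where i: "l = 2 * i" by blast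
    then have "G (n - 1) l = f x ((\<tau> ^^ (n - 1 - i)) ((Q 1 ^^ i) x))"
      using l by (simp add: G_def Npow \<sigma>\<tau>)
    then show ?thesis using C[of "n - 1 - i" i] i l by simp
  next
    case False
    then obtain i where i: "l = 2 * i + 1" by (rule oddE)
    define s where "s = n - 1 - i"
    have s: "s + i = n - 1" "0 < n" using i l by (auto simp: s_def)
    have "(\<tau> ^^ (n - 1)) ((N 1 ^^ l) x) = N 1 ((\<tau> ^^ s) ((Q 1 ^^ i) x))"
      using i l by (simp add: Npow opr_N'[OF opr_pow[OF opr_\<tau>]] \<sigma>\<tau> s_def)
    then have "G (n - 1) l = f x (\<sigma> ((\<tau> ^^ s) ((Q 1 ^^ i) x)))"
      using C[of s i] s by (simp add: G_def N_def f_simps)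
    also have "\<dots> = 0"
    proof (cases s)
      case 0
      then show ?thesis using f_Q_\<sigma>[of x i 1] q[of i] s by (simp add: opr_\<sigma>'[OF opr_Q_pow])
    next
      case (Suc s')
      then show ?thesis using C[of s' i] s by simp
    qed
    finally show ?thesis .
  qed
  \<comment> \<open>Because \<sigma> = 1 + \<open>N 1\<close>, the identity is \<tau> + \<tau>
    \<open>N 1\<close>. The recursion carries the zeros of \<open>B3\<close> to smaller powers of
    \<tau>, and at \<open>p = n - 1\<close> it yields the value 1 just below the top
    exponent.\<close>
  have R: "G p l = G (Suc p) l + G (Suc p) (Suc l)" for p l
  proof -
    have "(\<tau> ^^ p) y = (\<tau> ^^ Suc p) y + (\<tau> ^^ Suc p) (N 1 y)" for y
    proof -
      have "(\<tau> ^^ Suc p) (\<sigma> y) = (\<tau> ^^ p) y" by (simp add: funpow_swap1)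
      then show ?thesis
        by (simp only: N_def lin_diff[OF lin_pow[OF opr_\<tau>]] scale_one) simp
    qed
    from arg_cong[OF this[of "(N 1 ^^ l) x"], of "f x"] show ?thesis
      by (simp only: G_def f_add_right funpow.simps o_apply)
  qed
  have D: "G (n - 1 - d) l = 0" if "l + d < 2 * n" "d \<le> n - 1" for d l
    using that
  proof (induction d arbitrary: l)
    case 0 then show ?case using B3[of l] by simp
  next
    case (Suc d)
    have "Suc (n - 1 - Suc d) = n - 1 - d" using Suc.prems by simp
    then show ?case using R[of "n - 1 - Suc d" l] Suc.IH[of l] Suc.IH[of "Suc l"] Suc.prems by simp
  qed
  have top: "G p (2 * n) = 1" for p
  proof -
    define z where "z = (N 1 ^^ (2 * n)) x"
    have \<sigma>z: "\<sigma> z = 1 *s z" using top_eigen[OF n] by (simp add: z_def)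
    then have "\<tau> z = 1 *s z" using eigen_\<tau>[OF \<sigma>z] by simp
    then have "(\<tau> ^^ p) z = z" using pow_eigen[OF lin_\<tau>, of z 1 p] by simp
    moreover have "(-1::'a) ^ n = 1" by (simp add: neg'[of 1])
    then have "(Q 1 ^^ n) x = z" using Q_top_odd[OF _ n] by (simp add: z_def)
    ultimately show ?thesis using q[of n] by (simp add: G_def z_def)
  qed
  show "f x ((\<tau> ^^ p) ((N 1 ^^ (2 * n)) x)) = 1" using top by (simp add: G_def)
  show "f x ((\<tau> ^^ a) ((N 1 ^^ (a + b)) x)) = 0" if "a < n" "b < n" for a b
    using D[of "a + b" "n - 1 - a"] that by (simp add: G_def)
  show "f x ((\<tau> ^^ (n - 1)) ((N 1 ^^ l) x)) = 0" if "0 < n" "l < 2 * n" for l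
    using B3[of l] that by (simp add: G_def)
  show "f x ((\<tau> ^^ (l + 1 - n)) ((N 1 ^^ l) x)) = (if l = 2 * n - 1 then 1 else 0)"
    if l: "n \<le> l" "l < 2 * n" for l
  proof (cases "l = 2 * n - 1")
    case True
    have "Suc (n - 1) = n" "Suc l = 2 * n" "l + 1 - n = n" using l True by auto
    then have "G (l + 1 - n) l = 1"
      using R[of "n - 1" l] B3[of l] top[of n] l(2) dbl'[of 1] by (simp add: add_eq_0_iff neg')
    then show ?thesis using True by (simp add: G_def)
  next
    case False
    define d where "d = 2 * n - 2 - l"
    have "n - 1 - d = l + 1 - n" "d \<le> n - 1" "l + d < 2 * n" using l False by (auto simp: d_def)
    then show ?thesis using D[of l d] False by (simp add: G_def)
  qed
qed

lemma Gamma0_piece: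
  assumes qc: "quadratically_closed TYPE('a)" and two: "(2::'a) = 0"
    and m: "odd m" and W: "inv_sub W" and v: "v \<in> W" "(N 1 ^^ m) v = 0"
    and p: "f v ((N 1 ^^ (m - 1)) v) \<noteq> 0"
  shows "\<exists>us. set us \<subseteq> W \<and> gram_matrix f us = Gamma0_mat m \<and> inv_sub (span (set us))"
proof -
  obtain n where n: "m = 2 * n + 1" using m by (rule oddE)
  have "(2::'a) = 0 \<Longrightarrow> (-1::'a) = 1" by (metis add_eq_0_iff one_add_one)
  then have m1: "(-1::'a) = 1" using two by blast
  have "f v ((Q 1 ^^ n) v) \<noteq> 0" using Q_top_odd[of 1 n v] v p n m1 by simp
  then obtain x where x: "x \<in> W" "(N 1 ^^ m) x = 0"
    "\<And>l. f x ((Q 1 ^^ l) x) = (if l = n then 1 else 0)"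
    using Gamma0_adjust[OF qc _ W v(1)] v(2) n by blast
  note P = char2_pairings[OF two x(2)[unfolded n] x(3)]
  \<comment> \<open>Truncated subtraction is intended: no \<tau> for \<open>a < n\<close>, and
    \<open>a + 1 - n\<close> factors above. In \<open>f (g a) (g b)\<close> the net power of \<tau>
    is then \<open>a\<close> if both indices are below \<open>n\<close>, \<open>n - 1\<close> if
    only \<open>b\<close> is, and \<open>a + b + 1 - n\<close> if only \<open>a\<close> is. At
    \<open>a + b + 1 = 2 * n\<close> the last case gives 1 and the second gives 0: this is the
    one-sided second antidiagonal of \<open>Gamma0_mat\<close>.\<close>
  define g where "g = (\<lambda>a. (\<tau> ^^ (a + 1 - n)) ((N 1 ^^ a) x))"
  define us where "us = map (\<lambda>i. g (m - 1 - i)) [0..<m]"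
  have len: "length us = m" by (simp add: us_def)
  have zero: "(N 1 ^^ l) x = 0" if "2 * n < l" for l using N_pow_mono[OF x(2)] that n by simp
  have fg: "f (g a) (g b) = f x ((\<tau> ^^ r) ((N 1 ^^ (a + b)) x))"
    if r: "r + (a + 1 - n) = a + (b + 1 - n)" for a b r
  proof -
    define p q where "p = a + 1 - n" and "q = b + 1 - n"
    have "f (g a) (g b) = f x ((M 1 ^^ a) ((\<sigma> ^^ p) ((\<tau> ^^ q) ((N 1 ^^ b) x))))"
      by (simp add: g_def p_def q_def f_\<tau>_pow f_N_pow)
    also have "(M 1 ^^ a) y = (\<tau> ^^ a) ((N 1 ^^ a) y)" for y
      using M_pow_conv_N[of 1 a y] m1 by simp
    also have "(\<tau> ^^ a) ((N 1 ^^ a) ((\<sigma> ^^ p) ((\<tau> ^^ q) ((N 1 ^^ b) x)))) =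
        (\<tau> ^^ a) ((\<sigma> ^^ p) ((\<tau> ^^ q) ((N 1 ^^ a) ((N 1 ^^ b) x))))"
      by (simp add: opr_\<sigma>_pow[OF opr_pow[OF opr_N]] opr_\<tau>_pow[OF opr_pow[OF opr_N]])
    also have "(N 1 ^^ a) ((N 1 ^^ b) x) = (N 1 ^^ (a + b)) x" by (simp add: funpow_add)
    also have "(\<tau> ^^ a) ((\<sigma> ^^ p) ((\<tau> ^^ q) y)) = (\<tau> ^^ r) y" for y
    proof -
      have "(\<tau> ^^ a) ((\<sigma> ^^ p) ((\<tau> ^^ q) y)) = (\<sigma> ^^ p) ((\<tau> ^^ (a + q)) y)"
        by (simp add: opr_\<sigma>_pow[OF opr_pow[OF opr_\<tau>]] funpow_add)
      also have "a + q = p + r" using r by (simp add: p_def q_def)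
      also have "(\<sigma> ^^ p) ((\<tau> ^^ (p + r)) y) = (\<tau> ^^ r) y" by (simp add: funpow_add)
      finally show ?thesis .
    qed
    finally show ?thesis .
  qed
  have fg': "f (g a) (g b) = (if a + b = 2 * n \<or> (a + b + 1 = 2 * n \<and> a < n) then 1 else 0)"
    if ab: "a \<le> 2 * n" "b \<le> 2 * n" for a b
  proof -
    consider "2 * n < a + b" | "a + b = 2 * n" | "a + b < 2 * n" by linarith
    then show ?thesis
    proof cases
      case 1
      have "(a + (b + 1 - n) - (a + 1 - n)) + (a + 1 - n) = a + (b + 1 - n)" using 1 ab by auto
      from fg[OF this] show ?thesis
        using 1 zero[of "a + b"] by (simp add: lin_0[OF lin_pow[OF opr_\<tau>]])
    next
      case 2
      have "(a + (b + 1 - n) - (a + 1 - n)) + (a + 1 - n) = a + (b + 1 - n)" using 2 by auto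
      from fg[OF this] show ?thesis using 2 P(1) by simp
    next
      case 3
      show ?thesis
      proof (cases "a < n")
        case a: True
        show ?thesis
        proof (cases "b < n")
          case True
          have "a + (a + 1 - n) = a + (b + 1 - n)" using a True by simp
          from fg[OF this] show ?thesis using 3 P(2)[OF a True] a True by auto
        next
          case False
          have "(a + b + 1 - n) + (a + 1 - n) = a + (b + 1 - n)" using a False by simp
          from fg[OF this] show ?thesis using 3 P(4)[of "a + b"] a False by auto
        qed
      next
        case a: False
        then have b: "b < n" "0 < n" using 3 by auto
        have "(n - 1) + (a + 1 - n) = a + (b + 1 - n)" using a b by simp
        from fg[OF this] show ?thesis using 3 P(3)[of "a + b"] a b by simp
      qed
    qed
  qed
  have g: "gram_matrix f us = Gamma0_mat m"
  proof (rule eq_matI)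
    fix i j assume "i < dim_row (Gamma0_mat m :: 'a mat)" "j < dim_col (Gamma0_mat m :: 'a mat)"
    then have ij: "i < m" "j < m" by simp_all
    have "(m - 1 - i) + (m - 1 - j) = 2 * n \<longleftrightarrow> Suc i + Suc j = m + 1"
      "(m - 1 - i) + (m - 1 - j) + 1 = 2 * n \<longleftrightarrow> Suc i + Suc j = m + 2"
      "m - 1 - i < n \<longleftrightarrow> Suc i > (m + 1) div 2"
      using ij n by auto
    then show "gram_matrix f us $$ (i, j) = Gamma0_mat m $$ (i, j)"
      using ij len n fg'[of "m - 1 - i" "m - 1 - j"]
      by (simp add: gram_matrix_def Gamma0_mat_def us_def del: One_nat_def)
  qed (simp_all add: gram_matrix_def len)
  define cs where "cs = map (\<lambda>i. (N 1 ^^ i) x) [0..<m]"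
  have set_cs: "set cs = (\<lambda>i. (N 1 ^^ i) x) ` {..<m}" by (auto simp: cs_def)
  have C: "inv_sub (span (set cs))" unfolding set_cs by (rule chain_inv[OF x(2)])
  have "x \<in> set cs" unfolding set_cs using n by (auto intro!: image_eqI[of _ _ 0])
  then have xC: "x \<in> span (set cs)" by (rule span_base)
  have gW: "g a \<in> U" if "inv_sub U" "x \<in> U" for U a
    unfolding g_def by (intro inv_\<tau>_pow inv_N_pow that)
  have "set us \<subseteq> span (set cs)" using gW[OF C xC] by (auto simp: us_def)
  then have "span (set us) = span (set cs)"
    by (rule indep_list_span_eq[OF Gamma0_gram(1)[OF g]]) (simp add: cs_def len)
  then have "inv_sub (span (set us))" using C by simp
  moreover have "set us \<subseteq> W" using gW[OF W x(1)] by (auto simp: us_def)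
  ultimately show ?thesis using g by blast
qed

section \<open>Splitting off one summand\<close>

lemma summand_gram:
  assumes "admissible_summand s" "gram_matrix f us = summand_mat s"
  shows "indep_list us" "nondeg_on (span (set us))"
proof -
  have "indep_list us \<and> nondeg_on (span (set us))"
    using assms by (cases s) (auto simp: Gamma_gram Gamma0_gram hyperbolic_gram)
  then show "indep_list us" "nondeg_on (span (set us))" by auto
qed

definition block :: "'a summand \<Rightarrow> 'v list \<Rightarrow> bool" where
  "block s us \<longleftrightarrow> admissible_summand s \<and> gram_matrix f us = summand_mat s \<and> inv_sub (span (set us))"

lemma block_gram:
  assumes "block s us" shows "indep_list us" "nondeg_on (span (set us))"
  using assms summand_gram[of s us] by (auto simp: block_def)

text \<open>\<open>isotropic_vector_exists\<close> is applied twice with exchanged roles: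
  \<open>v\<close> is made isotropic against \<open>w\<close>, then \<open>w\<close> against the new
  vector. In between, \<open>top_symmetric\<close> turns the non-zero pairing around.\<close>

lemma hyperbolic_block_exists:
  assumes qc: "quadratically_closed TYPE('a)" and e: "e * e = 1" and m: "0 < m"
    and ty: "(e = 1 \<and> even m) \<or> (e = -1 \<and> odd m)"
    and W: "inv_sub W" "v \<in> W" "w \<in> W"
    and v: "(N e ^^ m) v = 0" and w: "(N e ^^ m) w = 0"
    and vv: "f v ((N e ^^ (m - 1)) v) = 0" and ww: "f w ((N e ^^ (m - 1)) w) = 0"
    and wv: "f w ((N e ^^ (m - 1)) v) \<noteq> 0"
  shows "\<exists>us. set us \<subseteq> W \<and> gram_matrix f us = hyperbolic_jordan m e \<and> inv_sub (span (set us))"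
proof -
  have e0: "e \<noteq> 0" using e by auto
  obtain x where x: "x \<in> W" "(N e ^^ m) x = 0" "\<And>l. f x ((Q e ^^ l) x) = 0"
    "f w ((N e ^^ (m - 1)) x) \<noteq> 0"
    using isotropic_vector_exists[OF qc e m ty W v w vv ww wv] wv by auto
  have xx: "f x ((N e ^^ (m - 1)) x) = 0"
  proof -
    obtain A where A: "inv_sub A" "x \<in> A" "\<forall>x\<in>A. \<forall>y\<in>A. f x y = 0"
      using isotropic_cyclic[OF e x(3) W(1) x(1)] by blast
    then show ?thesis using inv_N_pow by blast
  qed
  have xw: "f x ((N e ^^ (m - 1)) w) \<noteq> 0"
    using top_symmetric[OF e x(2) m, of w] x(4) e0 by simp
  obtain y where y: "y \<in> W" "(N e ^^ m) y = 0" "\<And>l. f y ((Q e ^^ l) y) = 0"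
    "f x ((N e ^^ (m - 1)) y) \<noteq> 0"
    using isotropic_vector_exists[OF qc e m ty W(1) W(3) x(1) w x(2) ww xx xw] xw by auto
  obtain A where A: "inv_sub A" "y \<in> A" "A \<subseteq> W" "\<forall>x\<in>A. \<forall>y\<in>A. f x y = 0"
    using isotropic_cyclic[OF e y(3) W(1) y(1)] by blast
  obtain B where B: "inv_sub B" "x \<in> B" "B \<subseteq> W" "\<forall>x\<in>B. \<forall>y\<in>B. f x y = 0"
    using isotropic_cyclic[OF e x(3) W(1) x(1)] by blast
  have "(M e ^^ m) x = 0" using M_pow_eq_0[OF e0] x(2) inverse_self[OF e] by simp
  then show ?thesis
    using hyperbolic_piece[OF e0 m A(1) B(1) _ _ A(2) B(2) y(2) _ y(4)] A(3,4) B(3,4) by blast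
qed

lemma block_exists:
  assumes qc: "quadratically_closed TYPE('a)" and s: "\<And>x. fold N as x = 0"
    and W: "inv_sub W" "nondeg_on W" and x: "x \<in> W" "x \<noteq> 0"
  shows "\<exists>s us. block s us \<and> set us \<subseteq> W"
proof -
  obtain m a v where m: "0 < m" and v: "v \<in> W" "(N a ^^ m) v = 0" "(N a ^^ (m - 1)) v \<noteq> 0"
    and mx: "\<And>b y j. y \<in> W \<Longrightarrow> (N b ^^ j) y = 0 \<Longrightarrow> (N b ^^ m) y = 0"
    using max_index_exists[OF W(1) x s] by blast
  define z where "z = (N a ^^ (m - 1)) v"
  have \<sigma>z: "\<sigma> z = a *s z" unfolding z_def by (rule top_eigen[OF v(2) m])
  have z: "z \<in> W" "z \<noteq> 0" using v W(1) by (auto simp: z_def inv_N_pow)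
  have a0: "a \<noteq> 0"
  proof
    assume "a = 0"
    then have "\<sigma> z = 0" using \<sigma>z by simp
    then have "z = 0" using \<tau>_\<sigma>[of z] lin_0[OF lin_\<tau>] by simp
    then show False using z by simp
  qed
  obtain y where "y \<in> W" "f y z \<noteq> 0" using W(2) z unfolding nondeg_on_def by blast
  moreover have "(N (inverse a) ^^ 0) (fold N as y) = 0" using s by simp
  ultimately obtain w j where w: "w \<in> W" "f w z \<noteq> 0" "(N (inverse a) ^^ j) w = 0"
    using eigen_partner[OF W(1), of z "inverse a" y 0 as] \<sigma>z a0 by auto
  \<comment> \<open>This is where \<open>m\<close> has to be maximal for all eigenvalues and not
    only for \<open>a\<close>.\<close>
  have wm: "(N (inverse a) ^^ m) w = 0" by (rule mx[OF w(1,3)])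
  show ?thesis
  proof (cases "a\<^sup>2 = 1")
    case False
    define A where "A = W \<inter> {x. (N a ^^ m) x = 0}"
    define B where "B = W \<inter> {x. (N (inverse a) ^^ m) x = 0}"
    have AB: "inv_sub A" "inv_sub B" unfolding A_def B_def by (intro inv_Int W inv_ker opr_pow opr_N)+
    have aa: "a * a \<noteq> 1" using False by (simp add: power2_eq_square)
    have "inverse a * inverse a \<noteq> 1"
    proof
      assume "inverse a * inverse a = 1"
      then have "inverse (a * a) = 1" by simp
      then show False using aa by (metis inverse_eq_1_iff)
    qed
    then have iso: "f x y = 0" if "x \<in> A \<and> y \<in> A \<or> x \<in> B \<and> y \<in> B" for x y
      using that f_ker_orth[of m a x m a y] f_ker_orth[of m "inverse a" x m "inverse a" y] aa
      by (auto simp: A_def B_def)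
    have "v \<in> A" "w \<in> B" using v w wm by (auto simp: A_def B_def)
    then obtain us where us: "set us \<subseteq> A \<union> B" "gram_matrix f us = hyperbolic_jordan m a" "inv_sub (span (set us))"
      using hyperbolic_piece[OF a0 m AB _ _ _ _ v(2) M_pow_eq_0[OF a0 wm]] iso w(2) unfolding z_def by metis
    have "block (Summand_G (2 * m) a) us"
      using us m a0 False by (auto simp: block_def)
    then show ?thesis using us(1) by (auto simp: A_def B_def)
  next
    case True
    then have e: "a * a = 1" by (simp add: power2_eq_square)
    have ia: "inverse a = a" by (rule inverse_self[OF e])
    have wa: "(N a ^^ m) w = 0" using wm ia by simp
    have "(a - 1) * (a + 1) = 0" using e by (simp add: algebra_simps)
    then have a1: "a = 1 \<or> a = -1" by (auto simp: eq_neg_iff_add_eq_0)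
    show ?thesis
    proof (cases "\<exists>u\<in>W. (N a ^^ m) u = 0 \<and> f u ((N a ^^ (m - 1)) u) \<noteq> 0")
      case True
      then obtain u where u: "u \<in> W" "(N a ^^ m) u = 0" "f u ((N a ^^ (m - 1)) u) \<noteq> 0" by blast
      show ?thesis
      proof (cases "(2::'a) = 0")
        case False
        obtain us where us: "set us \<subseteq> W" "gram_matrix f us = Gamma_mat m" "inv_sub (span (set us))"
          using Gamma_piece(2)[OF qc False e m W(1) u] by blast
        have "block (if odd m then Summand_A m else Summand_C m) us"
          using us m False two_eq_0_iff[where 'a='a] by (auto simp: block_def)
        then show ?thesis using us by blast
      next
        case two: True
        then have m1: "(-1::'a) = 1" by (metis add_eq_0_iff one_add_one)
        then have a1: "a = 1" using a1 by metis
        \<comment> \<open>For even \<open>m\<close> the top power of \<open>N 1\<close> is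
          \<open>Q 1 ^^ n\<close> after one \<open>N 1\<close>, and \<open>f_Q_\<sigma>\<close>
          makes its pairing with \<open>u\<close> zero.\<close>
        have "odd m"
        proof
          assume "even m"
          then obtain k where "m = 2 * k" by blast
          then have n: "m = 2 * (k - 1) + 2" using m by simp
          define n where "n = k - 1"
          have n: "m = 2 * n + 2" using n by (simp add: n_def)
          have "f u ((Q 1 ^^ n) (N 1 u)) = 0"
            by (simp add: N_def lin_diff[OF lin_Q_pow] f_simps f_Q_\<sigma>)
          moreover have "(Q 1 ^^ n) (N 1 u) = (N 1 ^^ (m - 1)) u"
            using Q_top_even[of 1 n u] u(2) n a1 m1 by (simp add: opr_N'[OF opr_Q_pow])
          ultimately show False using u(3) a1 by simp
        qed
        then obtain us where us: "set us \<subseteq> W" "gram_matrix f us = Gamma0_mat m" "inv_sub (span (set us))"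
          using Gamma0_piece[OF qc two _ W(1) u(1)] u a1 by blast
        have "block (Summand_B m) us"
          using us m two two_eq_0_iff[where 'a='a] \<open>odd m\<close> by (auto simp: block_def)
        then show ?thesis using us by blast
      qed
    next
      case False
      then have alt: "f u ((N a ^^ (m - 1)) u) = 0" if "u \<in> W" "(N a ^^ m) u = 0" for u
        using that by blast
      have wv: "f w ((N a ^^ (m - 1)) v) \<noteq> 0" using w(2) by (simp add: z_def)
      \<comment> \<open>Polarizing the alternating top form and comparing with
        \<open>top_symmetric\<close> forces \<open>(-1) ^ (m - 1) * a\<close> to be -1. If 2 is
        zero, then 1 = -1 and the parity of \<open>m\<close> is free.\<close>
      have ty: "(a = 1 \<and> even m) \<or> (a = -1 \<and> odd m)"
      proof (cases "(2::'a) = 0")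
        case True
        then have "(-1::'a) = 1" by (metis add_eq_0_iff one_add_one)
        then show ?thesis using a1 by metis
      next
        case False
        have linN: "lin (N a ^^ k)" for k by (rule lin_pow[OF opr_N])
        have "f (v + w) ((N a ^^ (m - 1)) (v + w)) = 0"
          by (rule alt) (use v w wa W(1) in \<open>auto simp: inv_add lin_add[OF linN]\<close>)
        then have "f v ((N a ^^ (m - 1)) w) + f w ((N a ^^ (m - 1)) v) = 0"
          using alt[OF v(1,2)] alt[OF w(1) wa] by (simp add: lin_add[OF linN] f_simps add.commute)
        moreover have "f v ((N a ^^ (m - 1)) w) = (-1) ^ (m - 1) * a * f w ((N a ^^ (m - 1)) v)"
          by (rule top_symmetric[OF e v(2) m])
        ultimately have "((-1) ^ (m - 1) * a + 1) * f w ((N a ^^ (m - 1)) v) = 0"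
          by (simp add: distrib_right)
        then have s: "(-1) ^ (m - 1) * a + 1 = 0" using wv by simp
        show ?thesis
        proof (cases "even m")
          case True
          then have "odd (m - 1)" using m by simp
          then show ?thesis using s True by (simp add: neg_one_odd_power)
        next
          case False
          then have "even (m - 1)" by simp
          then show ?thesis using s False by (simp add: eq_neg_iff_add_eq_0)
        qed
      qed
      obtain us where us: "set us \<subseteq> W" "gram_matrix f us = hyperbolic_jordan m a" "inv_sub (span (set us))"
        using hyperbolic_block_exists[OF qc e m ty W(1) v(1) w(1) v(2) wa alt[OF v(1,2)] alt[OF w(1) wa] wv]
        by blast
      define s where "s = (if even m then Summand_D (2 * m)
        else if (2::'a) = 0 then Summand_E (2 * m) else Summand_F (2 * m) :: 'a summand)"
      have "summand_mat s = hyperbolic_jordan m a"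
        using ty by (auto simp: s_def) (metis add_eq_0_iff one_add_one)+
      moreover have "admissible_summand s"
        using m two_eq_0_iff[where 'a='a] by (auto simp: s_def)
      ultimately have "block s us" using us by (simp add: block_def)
      then show ?thesis using us by blast
    qed
  qed
qed

subsection \<open>Jordan chains inside a block\<close>

definition chain :: "'a \<Rightarrow> 'v \<Rightarrow> nat \<Rightarrow> 'v set" where
  "chain a v k = span ((\<lambda>i. (N a ^^ i) v) ` {..<k})"

lemma chain_list: "chain a v k = span (set (map (\<lambda>i. (N a ^^ i) v) [0..<k]))"
  by (simp add: chain_def atLeast0LessThan)

lemma inv_chain: "(N a ^^ k) v = 0 \<Longrightarrow> inv_sub (chain a v k)"
  unfolding chain_def by (rule chain_inv)

lemma chain_mem: "0 < k \<Longrightarrow> v \<in> chain a v k"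
  unfolding chain_def by (rule span_base) (auto intro!: image_eqI[of _ _ 0])

lemma chain_subset: "inv_sub W \<Longrightarrow> v \<in> W \<Longrightarrow> chain a v k \<subseteq> W"
  unfolding chain_def by (intro span_minimal) (auto simp: inv_N_pow inv_subspace)

lemma chain_indep:
  assumes "(N a ^^ k) v = 0" "(N a ^^ (k - 1)) v \<noteq> 0"
  shows "indep_list (map (\<lambda>i. (N a ^^ i) v) [0..<k])"
  unfolding indep_list_def
proof (intro allI impI)
  fix c j
  assume "(\<Sum>j<length (map (\<lambda>i. (N a ^^ i) v) [0..<k]). c j *s map (\<lambda>i. (N a ^^ i) v) [0..<k] ! j) = 0"
    and j: "j < length (map (\<lambda>i. (N a ^^ i) v) [0..<k])"
  then have s: "(\<Sum>i<k. c i *s (N a ^^ i) v) = 0" and "j < k" by simp_all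
  from \<open>j < k\<close> show "c j = 0"
  proof (induction j rule: less_induct)
    case (less j)
    define r where "r = k - 1 - j"
    have "0 = (N a ^^ r) (\<Sum>i<k. c i *s (N a ^^ i) v)" by (simp add: s lin_0[OF lin_pow[OF opr_N]])
    also have "\<dots> = (\<Sum>i<k. c i *s (N a ^^ (r + i)) v)"
      by (simp add: lin_sum[OF lin_pow[OF opr_N]] lin_scale[OF lin_pow[OF opr_N]] funpow_add)
    also have "\<dots> = (\<Sum>i<k. if i = j then c j *s (N a ^^ (k - 1)) v else 0)"
    proof (rule sum.cong[OF refl])
      fix i assume i: "i \<in> {..<k}"
      consider "i < j" | "i = j" | "j < i" by linarith
      then show "c i *s (N a ^^ (r + i)) v = (if i = j then c j *s (N a ^^ (k - 1)) v else 0)"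
      proof cases
        case 1 then show ?thesis using less by simp
      next
        case 2 then show ?thesis using less.prems by (simp add: r_def)
      next
        case 3
        then have "(N a ^^ (r + i)) v = 0" by (intro N_pow_mono[OF assms(1)]) (simp add: r_def)
        then show ?thesis using 3 by simp
      qed
    qed
    also have "\<dots> = c j *s (N a ^^ (k - 1)) v" using less.prems by simp
    finally show "c j = 0" using assms(2) by simp
  qed
qed

lemma chain_dim:
  assumes "(N a ^^ k) v = 0" "(N a ^^ (k - 1)) v \<noteq> 0"
  shows "dim (chain a v k) = k"
  unfolding chain_list using indep_list_dim[OF chain_indep[OF assms]] by simp

lemma chain_eq:
  assumes v: "(N a ^^ k) v = 0" "(N a ^^ (k - 1)) v \<noteq> 0" and W: "inv_sub W" "v \<in> W" "dim W \<le> k"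
  shows "chain a v k = W"
  using subspace_dim_equal[of "chain a v k" W] chain_subset[OF W(1,2)] chain_dim[OF v] W
  by (simp add: chain_def inv_subspace)

lemma span_eqI_gram:
  assumes nd: "nondeg_on (span (set us))" and x: "x \<in> span (set us)" "y \<in> span (set us)"
    and e: "\<And>j. j < length us \<Longrightarrow> f (us ! j) x = f (us ! j) y"
  shows "x = y"
proof -
  have "f u (x - y) = 0" if "u \<in> span (set us)" for u
  proof (rule f_span_zero[OF that])
    show "x - y \<in> span {x - y}" by (simp add: span_base)
    show "f u w = 0" if "u \<in> set us" "w \<in> {x - y}" for u w
      using that e by (auto simp: in_set_conv_nth f_simps)
  qed
  then have "x - y = 0" using nd x span_diff unfolding nondeg_on_def by blast
  then show ?thesis by simp
qed

text \<open>A basis with Gram matrix \<open>Gamma_mat\<close> or \<open>Gamma0_mat\<close> is a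
  Jordan chain up to lower terms. The extra \<open>N a (e i)\<close> lies one step deeper than
  \<open>e i\<close> and is killed before it can contribute; its coefficient \<open>d\<close> may
  vary with \<open>i\<close>.\<close>

lemma chain_relation:
  assumes "N a (e 0) = 0" "\<And>i. Suc i < k \<Longrightarrow> \<exists>d. N a (e (Suc i)) = c *s e i + d *s N a (e i)"
    and "i < k"
  shows "(N a ^^ Suc i) (e i) = 0 \<and> (N a ^^ i) (e i) = c ^ i *s e 0"
  using assms(3)
proof (induction i)
  case 0 then show ?case using assms(1) by simp
next
  case (Suc i)
  then have IH: "(N a ^^ Suc i) (e i) = 0" "(N a ^^ i) (e i) = c ^ i *s e 0" by auto
  obtain d where d: "N a (e (Suc i)) = c *s e i + d *s N a (e i)" using assms(2) Suc.prems by blast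
  have 1: "(N a ^^ Suc n) (e (Suc i)) = c *s (N a ^^ n) (e i) + d *s (N a ^^ Suc n) (e i)" for n
    by (simp only: funpow_Suc_right o_apply d lin_add[OF lin_pow[OF opr_N]] lin_scale[OF lin_pow[OF opr_N]])
  have 2: "(N a ^^ Suc (Suc i)) (e i) = 0" by (rule N_pow_mono[OF IH(1)]) simp
  show ?case using 1[of "Suc i"] 1[of i] IH 2 by (simp only: scale_zero_right add_0 add_0_right scale_scale power_Suc)
qed

lemma block_nth_neq_0:
  assumes "block s us" "i < length us" shows "us ! i \<noteq> 0"
proof
  assume "us ! i = 0"
  then have "0 \<in> set us" using assms(2) nth_mem by metis
  then show False using indep_list_independent[OF block_gram(1)[OF assms(1)]] dependent_zero by blast
qed

lemma block_length:
  assumes "block s us" shows "0 < length us"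
  using assms unfolding block_def by (cases s) (auto dest!: gram_length)

lemma block_dim: "block s us \<Longrightarrow> dim (span (set us)) = length us"
  by (rule indep_list_dim[OF block_gram(1)])

lemma chain_block_aux:
  assumes b: "block s us" and c: "c \<noteq> 0" and N0: "N a (us ! 0) = 0"
    and r: "\<And>i. Suc i < length us \<Longrightarrow> \<exists>d. N a (us ! Suc i) = c *s us ! i + d *s N a (us ! i)"
  shows "\<exists>v. v \<in> span (set us) \<and> (N a ^^ length us) v = 0 \<and> (N a ^^ (length us - 1)) v \<noteq> 0 \<and>
    chain a v (length us) = span (set us) \<and>
    f v ((N a ^^ (length us - 1)) v) = c ^ (length us - 1) * f (us ! (length us - 1)) (us ! 0)"
proof -
  define k where "k = length us"
  have k: "0 < k" using block_length[OF b] by (simp add: k_def)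
  define v where "v = us ! (k - 1)"
  have "(N a ^^ Suc (k - 1)) v = 0 \<and> (N a ^^ (k - 1)) v = c ^ (k - 1) *s us ! 0"
    unfolding v_def by (rule chain_relation[OF N0 r]) (use k in \<open>auto simp: k_def\<close>)
  then have v: "(N a ^^ k) v = 0" "(N a ^^ (k - 1)) v = c ^ (k - 1) *s us ! 0" using k by auto
  have v0: "(N a ^^ (k - 1)) v \<noteq> 0" using v(2) c block_nth_neq_0[OF b, of 0] k by (simp add: k_def)
  have vU: "v \<in> span (set us)" using k by (intro span_base) (simp add: v_def k_def)
  have "chain a v k = span (set us)"
    using chain_eq[OF v(1) v0 _ vU] b block_dim[OF b] by (simp add: block_def k_def)
  moreover have "f v ((N a ^^ (k - 1)) v) = c ^ (k - 1) * f (us ! (k - 1)) (us ! 0)"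
    unfolding v(2) f_scale_right by (simp add: v_def)
  ultimately show ?thesis using v v0 vU unfolding k_def by blast
qed

text \<open>The Gram matrix forces \<open>us ! i + a *s \<sigma> (us ! i) = us ! Suc i - a *s
  \<sigma> (us ! Suc i)\<close>: each basis vector is the Cayley transform of the next, as in the
  construction. In terms of \<open>N a\<close> this is the recursion of
  \<open>chain_relation\<close> with \<open>c = - 2 * a\<close>.\<close>

lemma Gamma_block:
  assumes b: "block s us" and g: "gram_matrix f us = Gamma_mat k" and two: "(2::'a) \<noteq> 0"
    and a: "a = (-1) ^ (k - 1)"
  shows "\<exists>v. v \<in> span (set us) \<and> (N a ^^ k) v = 0 \<and> (N a ^^ (k - 1)) v \<noteq> 0 \<and> chain a v k = span (set us)"
proof -
  have len: "length us = k" using gram_length[OF g] by simp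
  have k: "0 < k" using block_length[OF b] len by simp
  have aa: "a * a = 1" unfolding a by (simp flip: power_mult_distrib)
  have inv: "inv_sub (span (set us))" using b by (simp add: block_def)
  note eqI = span_eqI_gram[OF block_gram(2)[OF b]]
  have mem: "us ! i \<in> span (set us)" if "i < k" for i using that len by (simp add: span_base)
  have G: "f (us ! i) (us ! j) = (if i + j = k - 1 \<or> i + j = k then (-1) ^ (k - Suc i) else 0)"
    if "i < k" "j < k" for i j
    using gram_nth[OF g, of i j] that len by (auto simp: Gamma_mat_def)
  have sgn: "a * (-1) ^ (k - Suc i) = (-1) ^ (k - Suc j)" if "i + j = k - 1" for i j
  proof -
    have "a = (-1) ^ i * (-1) ^ j" unfolding a that[symmetric] power_add ..
    moreover have "k - Suc i = j" "k - Suc j = i" using that k by auto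
    ultimately show ?thesis by (simp add: mult.assoc flip: power_mult_distrib)
  qed
  have sgn': "a * (-1) ^ (k - Suc i) = - ((-1) ^ (k - Suc j))" if ij: "i + j = k" "i < k" "j < k" for i j
  proof -
    obtain j' where j': "j = Suc j'" using ij by (cases j) auto
    have "a * (-1) ^ (k - Suc i) = (-1) ^ (k - Suc j')" by (rule sgn) (use ij j' in simp)
    also have "k - Suc j' = Suc (k - Suc j)" using ij j' by simp
    finally show ?thesis by simp
  qed
  have sw: "f (us ! j) (\<sigma> (us ! i)) = f (us ! i) (us ! j)" for i j by (simp add: f_swap[of "us ! i"])
  have e0: "us ! 0 = a *s \<sigma> (us ! 0)"
  proof (rule eqI)
    fix j assume j: "j < length us"
    show "f (us ! j) (us ! 0) = f (us ! j) (a *s \<sigma> (us ! 0))"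
      using j k len sgn[of 0 j] by (simp add: f_simps sw G)
  qed (use k inv mem in \<open>auto simp: inv_scale inv_\<sigma>\<close>)
  have es: "us ! i + a *s \<sigma> (us ! i) = us ! Suc i - a *s \<sigma> (us ! Suc i)" if i: "Suc i < k" for i
  proof (rule eqI)
    fix j assume "j < length us"
    then have j: "j < k" by (simp add: len)
    consider "i + j = k - 1" | "i + j = k" | "Suc i + j = k - 1" | "i + j \<noteq> k - 1" "i + j \<noteq> k" "Suc i + j \<noteq> k - 1"
      by blast
    then show "f (us ! j) (us ! i + a *s \<sigma> (us ! i)) = f (us ! j) (us ! Suc i - a *s \<sigma> (us ! Suc i))"
    proof cases
      case 1
      then show ?thesis using i j sgn[of i j] sgn'[of "Suc i" j]
        by (simp add: f_simps sw G add.commute)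
    next
      case 2
      then show ?thesis using i j sgn'[of i j] by (simp add: f_simps sw G add.commute)
    next
      case 3
      then show ?thesis using i j sgn[of "Suc i" j] by (simp add: f_simps sw G add.commute)
    next
      case 4
      then show ?thesis using i j by (auto simp: f_simps sw G add.commute)
    qed
  qed (use i mem inv in \<open>auto simp: inv_scale inv_\<sigma> inv_add inv_diff\<close>)
  have "N a (us ! 0) = 0"
  proof -
    have "a *s us ! 0 = (a * a) *s \<sigma> (us ! 0)" using arg_cong[OF e0, of "\<lambda>x. a *s x"] by simp
    then show ?thesis by (simp add: aa N_def)
  qed
  moreover have "\<exists>d. N a (us ! Suc i) = (- 2 * a) *s us ! i + d *s N a (us ! i)" if "Suc i < length us" for i
  proof -
    have "a *s us ! i + \<sigma> (us ! i) = a *s us ! Suc i - \<sigma> (us ! Suc i)"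
      using arg_cong[OF es[of i], of "\<lambda>x. a *s x"] that len
      by (simp add: scale_right_distrib scale_right_diff_distrib aa)
    then have "N a (us ! Suc i) = - (a *s us ! i) - \<sigma> (us ! i)" by (simp add: N_def algebra_simps)
    also have "\<dots> = (- 2 * a) *s us ! i + (- 1) *s N a (us ! i)"
    proof -
      have "(- 2 * a) *s us ! i = - (a *s us ! i) - a *s us ! i"
        by (metis mult_2 mult_minus_left scale_left_distrib scale_minus_left uminus_add_conv_diff minus_add_distrib)
      then show ?thesis by (simp add: N_def)
    qed
    finally show ?thesis by blast
  qed
  moreover have "- 2 * a \<noteq> 0" using two aa by auto
  ultimately show ?thesis using chain_block_aux[OF b, of "- 2 * a" a] unfolding len by blast
qed

text \<open>Pairing with the basis shows that \<open>N 1 (us ! Suc i)\<close> is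
  \<open>us ! i\<close>, with \<open>N 1 (us ! i)\<close> added for \<open>i \<le> n\<close>, so the
  last vector generates the block. Its top value 1 is what later tells B from E.\<close>

lemma Gamma0_block:
  assumes b: "block s us" and g: "gram_matrix f us = Gamma0_mat k" and two: "(2::'a) = 0"
    and k: "odd k"
  shows "\<exists>v. v \<in> span (set us) \<and> (N 1 ^^ k) v = 0 \<and> (N 1 ^^ (k - 1)) v \<noteq> 0 \<and> chain 1 v k = span (set us)
    \<and> f v ((N 1 ^^ (k - 1)) v) = 1"
proof -
  obtain n where n: "k = 2 * n + 1" using k by (rule oddE)
  have len: "length us = k" using gram_length[OF g] by simp
  have inv: "inv_sub (span (set us))" using b by (simp add: block_def)
  note eqI = span_eqI_gram[OF block_gram(2)[OF b]]
  have mem: "us ! i \<in> span (set us)" if "i < k" for i using that len by (simp add: span_base)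
  have dbl': "c + c = 0" for c :: 'a using two by (metis mult_2 mult_zero_left)
  have neg': "- c = c" for c :: 'a using dbl'[of c] by (simp add: minus_unique)
  have G: "f (us ! i) (us ! j) = (if i + j = 2 * n \<or> i + j = 2 * n + 1 \<and> n < i then 1 else 0)"
    if "i < k" "j < k" for i j
    using gram_nth[OF g, of i j] that len n by (auto simp: Gamma0_mat_def)
  have FN: "f (us ! j) (N 1 (us ! i)) = (if i + j = 2 * n + 1 then 1 else 0)" if ij: "i < k" "j < k" for i j
  proof -
    have "f (us ! j) (N 1 (us ! i)) = f (us ! i) (us ! j) - f (us ! j) (us ! i)"
      by (simp add: N_def f_simps f_swap[of "us ! i"])
    then show ?thesis using ij by (auto simp: G add.commute[of j] neg' dbl'[of 1])
  qed
  have "N 1 (us ! 0) = 0"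
  proof (rule eqI)
    fix j assume "j < length us"
    then show "f (us ! j) (N 1 (us ! 0)) = f (us ! j) 0" using FN[of 0 j] len n by simp
  qed (use n inv mem in \<open>auto simp: inv_N span_zero\<close>)
  moreover have "\<exists>d. N 1 (us ! Suc i) = 1 *s us ! i + d *s N 1 (us ! i)" if "Suc i < length us" for i
  proof -
    have i: "Suc i < k" using that len by simp
    have "N 1 (us ! Suc i) = 1 *s us ! i + (if i \<le> n then 1 else 0) *s N 1 (us ! i)"
    proof (rule eqI)
      fix j assume "j < length us"
      then have j: "j < k" using len by simp
      show "f (us ! j) (N 1 (us ! Suc i)) = f (us ! j) (1 *s us ! i + (if i \<le> n then 1 else 0) *s N 1 (us ! i))"
        using i j dbl'[of 1] by (auto simp: f_simps FN G)
    qed (use i inv mem in \<open>auto simp: inv_N inv_add inv_scale\<close>)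
    then show ?thesis by blast
  qed
  ultimately have "\<exists>v. v \<in> span (set us) \<and> (N 1 ^^ k) v = 0 \<and> (N 1 ^^ (k - 1)) v \<noteq> 0 \<and>
    chain 1 v k = span (set us) \<and> f v ((N 1 ^^ (k - 1)) v) = 1 ^ (k - 1) * f (us ! (k - 1)) (us ! 0)"
    using chain_block_aux[OF b, of 1 1] unfolding len by simp
  moreover have "f (us ! (k - 1)) (us ! 0) = 1" using G[of "k - 1" 0] n by simp
  ultimately show ?thesis by simp
qed

text \<open>This reverses \<open>hyperbolic_piece\<close>: the first half of the basis is a Jordan
  chain for \<open>N a\<close> and the second one for the adjoint \<open>M a\<close>, whose first
  vector therefore generates a chain for \<open>N (inverse a)\<close>.\<close>

lemma hyperbolic_block:
  assumes b: "block s us" and g: "gram_matrix f us = hyperbolic_jordan m a" and a: "a \<noteq> 0"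
  shows "\<exists>v w. (N a ^^ m) v = 0 \<and> (N a ^^ (m - 1)) v \<noteq> 0 \<and>
    (N (inverse a) ^^ m) w = 0 \<and> (N (inverse a) ^^ (m - 1)) w \<noteq> 0 \<and>
    (\<forall>x\<in>chain a v m. \<forall>y\<in>chain a v m. f x y = 0) \<and>
    (\<forall>x\<in>chain (inverse a) w m. \<forall>y\<in>chain (inverse a) w m. f x y = 0) \<and>
    chain a v m \<inter> chain (inverse a) w m \<subseteq> {0} \<and>
    span (set us) = {x + y |x y. x \<in> chain a v m \<and> y \<in> chain (inverse a) w m} \<and>
    f w ((N a ^^ (m - 1)) v) = 1"
proof -
  have len: "length us = 2 * m" using gram_length[OF g] by simp
  have m: "0 < m" using block_length[OF b] len by simp
  have inv: "inv_sub (span (set us))" using b by (simp add: block_def)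
  note nd = block_gram(2)[OF b]
  note eqI = span_eqI_gram[OF nd]
  have mem: "us ! i \<in> span (set us)" if "i < 2 * m" for i using that len by (simp add: span_base)
  define e where "e = (\<lambda>i. us ! i)"
  define d where "d = (\<lambda>j. us ! (m + j))"
  note G = gram_nth[OF g]
  have ee: "f (e i) (e j) = 0" and dd: "f (d i) (d j) = 0"
    and de: "f (d i) (e j) = (if i = j then 1 else 0)"
    and ed: "f (e i) (d j) = (if i = j then a else if i = Suc j then 1 else 0)"
    if "i < m" "j < m" for i j
    using that G[of i j] G[of "m + i" "m + j"] G[of "m + i" j] G[of i "m + j"] len
    by (auto simp: e_def d_def hyperbolic_jordan_index)
  have split: "(\<exists>i<m. us ! j = e i) \<or> (\<exists>i<m. us ! j = d i)" if "j < 2 * m" for j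
  proof (cases "j < m")
    case False
    then have "us ! j = d (j - m)" "j - m < m" using that by (auto simp: d_def)
    then show ?thesis by blast
  qed (auto simp: e_def)
  have Ne: "N a (e i) = (if i = 0 then 0 else e (i - 1))" if i: "i < m" for i
  proof (rule eqI)
    fix j assume "j < length us"
    then consider k where "k < m" "us ! j = e k" | k where "k < m" "us ! j = d k"
      using split len by metis
    then show "f (us ! j) (N a (e i)) = f (us ! j) (if i = 0 then 0 else e (i - 1))"
    proof cases
      case 1
      have "f (e k) (N a (e i)) = f (e i) (e k) - a * f (e k) (e i)"
        by (simp add: N_def f_simps f_swap[of "e i"])
      then show ?thesis using 1 i by (simp add: ee)
    next
      case 2
      have "f (d k) (N a (e i)) = f (e i) (d k) - a * f (d k) (e i)"
        by (simp add: N_def f_simps f_swap[of "e i"])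
      then show ?thesis using 2 i by (auto simp: ed de)
    qed
  qed (use i mem inv in \<open>auto simp: inv_N span_zero e_def\<close>)
  have Md: "M a (d i) = (if Suc i = m then 0 else d (Suc i))" if i: "i < m" for i
  proof -
    define y where "y = M a (d i) - (if Suc i = m then 0 else d (Suc i))"
    have y: "y \<in> span (set us)" unfolding y_def
      using i mem inv by (auto simp: inv_M span_diff d_def)
    \<comment> \<open>The pairings of \<open>y\<close> from the left are the accessible ones, and
      \<open>f u (\<sigma> y) = f y u\<close>; so \<open>\<sigma> y\<close> is tested instead of
      \<open>y\<close>.\<close>
    have "f (us ! j) (\<sigma> y) = f (us ! j) 0" if jl: "j < length us" for j
    proof -
      have fM: "f (M a (d i)) u = f u (d i) - a * f (d i) u" for u
        by (simp add: M_def f_simps f_\<tau> f_swap[of u])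
      consider k where "k < m" "us ! j = e k" | k where "k < m" "us ! j = d k"
        using split len jl by metis
      then have "f y (us ! j) = 0"
      proof cases
        case 1
        have "f y (e k) = f (e k) (d i) - a * f (d i) (e k) - (if Suc i = m then 0 else f (d (Suc i)) (e k))"
          by (simp add: y_def f_diff_left fM)
        then show ?thesis using 1 i ed[of k i] de[of i k] de[of "Suc i" k] by (auto split: if_splits)
      next
        case 2
        have "f y (d k) = f (d k) (d i) - a * f (d i) (d k) - (if Suc i = m then 0 else f (d (Suc i)) (d k))"
          by (simp add: y_def f_diff_left fM)
        then show ?thesis using 2 i dd[of k i] dd[of i k] dd[of "Suc i" k] by simp
      qed
      then show ?thesis using f_swap[of y "us ! j"] by simp
    qed
    then have "\<sigma> y = 0" using eqI[of "\<sigma> y" 0] inv_\<sigma>[OF inv y] by (simp add: span_zero)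
    then have "y = 0" using \<tau>_\<sigma>[of y] lin_0[OF lin_\<tau>] by simp
    then show ?thesis by (simp add: y_def)
  qed
  have Ne': "(N a ^^ k) (e i) = e (i - k)" if "k \<le> i" "i < m" for k i
    using that
  proof (induction k)
    case (Suc k) then show ?case by (simp add: Ne)
  qed simp
  have Md': "(M a ^^ k) (d 0) = d k" if "k < m" for k
    using that
  proof (induction k)
    case (Suc k) then show ?case by (simp add: Md)
  qed simp
  define v w where "v = e (m - 1)" and "w = d 0"
  have vtop: "(N a ^^ (m - 1)) v = e 0" using Ne'[of "m - 1" "m - 1"] m by (simp add: v_def)
  have v1: "(N a ^^ m) v = 0"
  proof -
    have "(N a ^^ Suc (m - 1)) v = N a (e 0)" by (simp only: funpow.simps o_apply vtop)
    then show ?thesis using m Ne[of 0] by simp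
  qed
  have nz: "e i \<noteq> 0" "d i \<noteq> 0" if "i < m" for i
    using that block_nth_neq_0[OF b] len by (auto simp: e_def d_def)
  have v2: "(N a ^^ (m - 1)) v \<noteq> 0" using vtop nz(1)[OF m] by simp
  have w1: "(N (inverse a) ^^ m) w = 0"
  proof -
    have wtop: "(M a ^^ (m - 1)) w = d (m - 1)" using Md'[of "m - 1"] m by (simp add: w_def)
    have "(M a ^^ Suc (m - 1)) w = M a (d (m - 1))" by (simp only: funpow.simps o_apply wtop)
    then have "(M a ^^ m) w = 0" using m Md[of "m - 1"] by simp
    then have "(\<tau> ^^ m) ((N (inverse a) ^^ m) w) = 0" using a by (simp add: M_pow_conv_N)
    then have "(\<sigma> ^^ m) ((\<tau> ^^ m) ((N (inverse a) ^^ m) w)) = 0" by (simp only: lin_0[OF lin_pow[OF opr_\<sigma>]])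
    then show ?thesis by simp
  qed
  have w2: "(N (inverse a) ^^ (m - 1)) w \<noteq> 0"
  proof
    assume "(N (inverse a) ^^ (m - 1)) w = 0"
    then have "(M a ^^ (m - 1)) w = 0" by (rule M_pow_eq_0[OF a])
    then show False using Md'[of "m - 1"] nz(2)[of "m - 1"] m by (simp add: w_def)
  qed
  define E D where "E = span (e ` {..<m})" and "D = span (d ` {..<m})"
  have E: "inv_sub E" unfolding E_def
  proof (rule inv_span_\<sigma>)
    fix y assume "y \<in> e ` {..<m}"
    then obtain i where i: "i < m" "y = e i" by auto
    have "N a (e i) \<in> span (e ` {..<m})" "e i \<in> span (e ` {..<m})"
      using i(1) by (auto simp: Ne intro: span_base span_zero)
    moreover have "\<sigma> y = N a (e i) + a *s e i" using i by (simp add: N_def)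
    ultimately show "\<sigma> y \<in> span (e ` {..<m})" by (simp add: span_add span_scale)
  qed
  have D: "inv_sub D" unfolding D_def
  proof (rule inv_span_\<tau>)
    fix y assume "y \<in> d ` {..<m}"
    then obtain i where i: "i < m" "y = d i" by auto
    have "M a (d i) \<in> span (d ` {..<m})" "d i \<in> span (d ` {..<m})"
      using i(1) by (auto simp: Md intro: span_base span_zero)
    moreover have "\<tau> y = M a (d i) + a *s d i" using i by (simp add: M_def)
    ultimately show "\<tau> y \<in> span (d ` {..<m})" by (simp add: span_add span_scale)
  qed
  have dim_le: "dim (span (g ` {..<m})) \<le> m" for g :: "nat \<Rightarrow> 'v"
    using dim_le_card[of "span (g ` {..<m})" "g ` {..<m}"] card_image_le[of "{..<m}" g] by simp
  have cE: "chain a v m = E"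
    using m dim_le[of e] by (intro chain_eq[OF v1 v2 E]) (auto simp: E_def v_def intro: span_base)
  have cD: "chain (inverse a) w m = D"
    using m dim_le[of d] by (intro chain_eq[OF w1 w2 D]) (auto simp: D_def w_def intro: span_base)
  have isoE: "f x y = 0" if "x \<in> E" "y \<in> E" for x y
    using that unfolding E_def by (rule f_span_zero) (auto simp: ee)
  have isoD: "f x y = 0" if "x \<in> D" "y \<in> D" for x y
    using that unfolding D_def by (rule f_span_zero) (auto simp: dd)
  have U: "span (set us) = {x + y |x y. x \<in> E \<and> y \<in> D}"
  proof -
    have "set us = e ` {..<m} \<union> d ` {..<m}"
    proof (intro equalityI subsetI)
      fix u assume "u \<in> set us"
      then obtain j where "j < 2 * m" "u = us ! j" using len by (auto simp: in_set_conv_nth)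
      then show "u \<in> e ` {..<m} \<union> d ` {..<m}" using split[of j] by auto
    qed (use len in \<open>auto simp: e_def d_def\<close>)
    then show ?thesis by (simp only: span_Un E_def D_def)
  qed
  have "E \<inter> D \<subseteq> {0}"
  proof
    fix x assume x: "x \<in> E \<inter> D"
    then have "x + 0 \<in> span (set us)" unfolding U using inv_0[OF D] by blast
    moreover have "f u x = 0" if u: "u \<in> span (set us)" for u
    proof -
      obtain p q where "u = p + q" "p \<in> E" "q \<in> D" using u unfolding U by blast
      then show ?thesis using x isoE isoD by (simp add: f_simps)
    qed
    ultimately show "x \<in> {0}" using nd unfolding nondeg_on_def by auto
  qed
  moreover have "f w ((N a ^^ (m - 1)) v) = 1" unfolding vtop w_def using de[OF m m] by simp
  ultimately show ?thesis
    using v1 v2 w1 w2 isoE isoD U unfolding cE[symmetric] cD[symmetric] by blast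
qed

end

lemma sorted_wrt_mset:
  assumes "\<And>x y. R x y \<Longrightarrow> R y x"
  shows "sorted_wrt R xs \<Longrightarrow> mset xs = mset ys \<Longrightarrow> sorted_wrt R ys"
proof (induction xs arbitrary: ys)
  case (Cons x xs)
  then have "x \<in> set ys" by (metis list.set_intros(1) set_mset_mset)
  then obtain y1 y2 where y: "ys = y1 @ x # y2" by (meson split_list)
  then have m: "mset xs = mset (y1 @ y2)" using Cons.prems by simp
  then have "sorted_wrt R (y1 @ y2)" using Cons by simp
  moreover have "set xs = set (y1 @ y2)" using m by (metis set_mset_mset)
  then have "\<forall>y\<in>set (y1 @ y2). R x y" using Cons.prems by simp
  ultimately show ?case unfolding y using assms by (auto simp: sorted_wrt_append)
qed simp

context form_space
begin

subsection \<open>Orthogonal decompositions into blocks\<close>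

definition orth :: "'v list \<Rightarrow> 'v list \<Rightarrow> bool" where
  "orth us ws \<longleftrightarrow> (\<forall>u\<in>set us. \<forall>w\<in>set ws. f u w = 0 \<and> f w u = 0)"

lemma orth_sym: "orth us ws \<Longrightarrow> orth ws us" by (auto simp: orth_def)

lemma orth_span:
  assumes "orth us ws" "x \<in> span (set us)" "y \<in> span (set ws)" shows "f x y = 0" "f y x = 0"
  using f_span_zero[OF assms(2,3)] f_span_zero[OF assms(3,2)] assms(1) by (auto simp: orth_def)

definition orth_blocks :: "('a summand \<times> 'v list) list \<Rightarrow> bool" where
  "orth_blocks ps \<longleftrightarrow> (\<forall>p\<in>set ps. block (fst p) (snd p)) \<and> sorted_wrt (\<lambda>p q. orth (snd p) (snd q)) ps"

definition total :: "('a summand \<times> 'v list) list \<Rightarrow> 'v set" where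
  "total ps = span (\<Union>p\<in>set ps. set (snd p))"

lemma total_Nil [simp]: "total [] = {0}" by (simp add: total_def)

lemma total_append: "total (ps @ qs) = {x + y |x y. x \<in> total ps \<and> y \<in> total qs}"
  by (simp add: total_def span_Un)

lemma total_Cons: "total (p # ps) = {x + y |x y. x \<in> span (set (snd p)) \<and> y \<in> total ps}"
  by (simp add: total_def span_Un)

lemma total_subspace: "subspace (total ps)" by (simp add: total_def)

lemma total_mset: "mset ps = mset qs \<Longrightarrow> total ps = total qs"
  unfolding total_def by (metis set_mset_mset)

lemma orth_blocks_mset:
  assumes "mset ps = mset qs" "orth_blocks ps" shows "orth_blocks qs"
proof -
  have "set ps = set qs" using assms(1) by (metis set_mset_mset)
  moreover have "sorted_wrt (\<lambda>p q. orth (snd p) (snd q)) qs"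
    by (rule sorted_wrt_mset[OF _ _ assms(1)]) (use assms(2) in \<open>auto simp: orth_blocks_def orth_sym\<close>)
  ultimately show ?thesis using assms(2) by (auto simp: orth_blocks_def)
qed

lemma orth_total:
  assumes "\<forall>q\<in>set ps. orth us (snd q)" "x \<in> span (set us)" "y \<in> total ps"
  shows "f x y = 0" "f y x = 0"
  using f_span_zero[OF assms(2) assms(3)[unfolded total_def]]
    f_span_zero[OF assms(3)[unfolded total_def] assms(2)] assms(1) by (auto simp: orth_def)

lemma orth_blocks_Cons:
  "orth_blocks (p # ps) \<longleftrightarrow> block (fst p) (snd p) \<and> orth_blocks ps \<and>
    (\<forall>x\<in>span (set (snd p)). \<forall>y\<in>total ps. f x y = 0 \<and> f y x = 0)"
proof
  assume "orth_blocks (p # ps)"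
  then show "block (fst p) (snd p) \<and> orth_blocks ps \<and>
    (\<forall>x\<in>span (set (snd p)). \<forall>y\<in>total ps. f x y = 0 \<and> f y x = 0)"
    using orth_total[of ps "snd p"] by (auto simp: orth_blocks_def)
next
  assume a: "block (fst p) (snd p) \<and> orth_blocks ps \<and>
    (\<forall>x\<in>span (set (snd p)). \<forall>y\<in>total ps. f x y = 0 \<and> f y x = 0)"
  have "orth (snd p) (snd q)" if "q \<in> set ps" for q
    unfolding orth_def
  proof (intro ballI)
    fix u w assume "u \<in> set (snd p)" "w \<in> set (snd q)"
    then have "u \<in> span (set (snd p))" "w \<in> total ps"
      using that by (auto simp: total_def intro: span_base)
    then show "f u w = 0 \<and> f w u = 0" using a by blast
  qed
  then show "orth_blocks (p # ps)" using a by (simp add: orth_blocks_def)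
qed

lemma orth_blocks_append:
  assumes "orth_blocks ps" "orth_blocks qs" "\<forall>x\<in>total ps. \<forall>y\<in>total qs. f x y = 0 \<and> f y x = 0"
  shows "orth_blocks (ps @ qs)"
  using assms
proof (induction ps)
  case (Cons p ps)
  have 1: "total ps \<subseteq> total (p # ps)" "span (set (snd p)) \<subseteq> total (p # ps)"
    unfolding total_def by (intro span_mono; auto)+
  have "orth_blocks (ps @ qs)" using Cons 1 by (simp add: orth_blocks_Cons) blast
  moreover have "f x y = 0 \<and> f y x = 0" if x: "x \<in> span (set (snd p))" and y: "y \<in> total (ps @ qs)" for x y
  proof -
    obtain a b where ab: "y = a + b" "a \<in> total ps" "b \<in> total qs" using y unfolding total_append by blast
    have "f x a = 0 \<and> f a x = 0" using Cons.prems(1) x ab by (simp add: orth_blocks_Cons)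
    moreover have "f x b = 0 \<and> f b x = 0" using Cons.prems(3) x ab 1 by blast
    ultimately show ?thesis by (simp add: ab f_simps)
  qed
  ultimately show ?case using Cons.prems(1) by (simp add: orth_blocks_Cons)
qed simp

lemma inv_total: "orth_blocks ps \<Longrightarrow> inv_sub (total ps)"
proof (induction ps)
  case Nil then show ?case by (simp add: inv_sub_def subspace_def lin_0[OF lin_\<sigma>] lin_0[OF lin_\<tau>])
next
  case (Cons p ps)
  then show ?case unfolding total_Cons by (intro inv_plus) (auto simp: orth_blocks_Cons block_def)
qed

lemma nondeg_on_sum:
  assumes U: "nondeg_on U" "subspace U" and W: "nondeg_on W" "subspace W"
    and o: "\<forall>x\<in>U. \<forall>y\<in>W. f x y = 0 \<and> f y x = 0"
  shows "nondeg_on {x + y |x y. x \<in> U \<and> y \<in> W}"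
  unfolding nondeg_on_def
proof (intro ballI impI)
  fix x assume "x \<in> {x + y |x y. x \<in> U \<and> y \<in> W}" and z: "\<forall>u\<in>{x + y |x y. x \<in> U \<and> y \<in> W}. f u x = 0"
  then obtain a b where ab: "x = a + b" "a \<in> U" "b \<in> W" by blast
  have "f u a = 0" if "u \<in> U" for u
  proof -
    have "u + 0 \<in> {x + y |x y. x \<in> U \<and> y \<in> W}" using that W(2) subspace_0 by blast
    then have "f (u + 0) x = 0" using z by blast
    then show ?thesis using o that ab by (simp add: f_simps)
  qed
  then have "a = 0" using U(1) ab unfolding nondeg_on_def by blast
  have "f w b = 0" if "w \<in> W" for w
  proof -
    have "0 + w \<in> {x + y |x y. x \<in> U \<and> y \<in> W}" using that U(2) subspace_0 by blast
    then have "f (0 + w) x = 0" using z by blast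
    then show ?thesis using o that ab by (simp add: f_simps)
  qed
  then have "b = 0" using W(1) ab unfolding nondeg_on_def by blast
  then show "x = 0" using ab \<open>a = 0\<close> by simp
qed

lemma orth_Int:
  assumes "nondeg_on U" "\<forall>x\<in>U. \<forall>y\<in>W. f x y = 0" shows "U \<inter> W \<subseteq> {0}"
  using assms unfolding nondeg_on_def by blast

lemma dim_total: "orth_blocks ps \<Longrightarrow> dim (total ps) = (\<Sum>p\<leftarrow>ps. length (snd p))"
proof (induction ps)
  case (Cons p ps)
  have b: "block (fst p) (snd p)" using Cons.prems by (simp add: orth_blocks_Cons)
  have "span (set (snd p)) \<inter> total ps \<subseteq> {0}"
    using Cons.prems by (intro orth_Int block_gram(2)[OF b]) (simp add: orth_blocks_Cons)
  then have "dim (total (p # ps)) = dim (span (set (snd p))) + dim (total ps)"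
    unfolding total_Cons by (intro dim_direct_sum) (auto simp: total_subspace)
  then show ?case using Cons block_dim[OF b] by (simp add: orth_blocks_Cons)
qed simp

text \<open>This bound is what allows a decomposition with the largest number of summands to be
  chosen.\<close>

lemma length_le_dim: "orth_blocks ps \<Longrightarrow> length ps \<le> dim (total ps)"
proof -
  assume o: "orth_blocks ps"
  have "length ps = (\<Sum>p\<leftarrow>ps. 1)" by (simp add: sum_list_triv)
  also have "\<dots> \<le> (\<Sum>p\<leftarrow>ps. length (snd p))"
    using o block_length by (intro sum_list_mono) (auto simp: orth_blocks_def Suc_le_eq)
  finally show ?thesis by (simp add: dim_total[OF o])
qed

lemma orth_blocks_perp:
  assumes b: "block s us" and W: "inv_sub W" "set us \<subseteq> W"
    and ps: "orth_blocks ps" "total ps = W \<inter> perp (span (set us))"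
  shows "orth_blocks ((s, us) # ps)" "total ((s, us) # ps) = W"
proof -
  have U: "inv_sub (span (set us))" "nondeg_on (span (set us))"
    using b block_gram(2) by (auto simp: block_def)
  have UW: "span (set us) \<subseteq> W" using W by (simp add: span_minimal inv_subspace)
  show "total ((s, us) # ps) = W"
    unfolding total_Cons using perp_sum[OF U W(1) UW] ps(2) by simp
  have "f x y = 0 \<and> f y x = 0" if "x \<in> span (set us)" "y \<in> total ps" for x y
    using that ps(2) perp_left[OF U(1), of y x] by (auto simp: perp_def)
  then show "orth_blocks ((s, us) # ps)" using b ps by (simp add: orth_blocks_Cons)
qed

lemma block_perp:
  assumes b: "block s us" and W: "inv_sub W" "nondeg_on W" "set us \<subseteq> W"
  shows "inv_sub (W \<inter> perp (span (set us)))" "nondeg_on (W \<inter> perp (span (set us)))"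
    "dim W = length us + dim (W \<inter> perp (span (set us)))"
proof -
  have U: "inv_sub (span (set us))" "nondeg_on (span (set us))"
    using b block_gram(2) by (auto simp: block_def)
  have UW: "span (set us) \<subseteq> W" using W by (simp add: span_minimal inv_subspace)
  show "inv_sub (W \<inter> perp (span (set us)))" using inv_Int[OF W(1) perp_inv[OF U(1)]] .
  show "nondeg_on (W \<inter> perp (span (set us)))" by (rule nondeg_on_perp[OF U W(1,2) UW])
  show "dim W = length us + dim (W \<inter> perp (span (set us)))"
    using dim_perp[OF U W(1) UW] block_dim[OF b] by simp
qed

lemma orth_blocks_exist:
  assumes qc: "quadratically_closed TYPE('a)" and s: "\<And>x. fold N as x = 0"
  shows "inv_sub W \<Longrightarrow> nondeg_on W \<Longrightarrow> \<exists>ps. orth_blocks ps \<and> total ps = W"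
proof (induction "dim W" arbitrary: W rule: less_induct)
  case less
  show ?case
  proof (cases "W = {0}")
    case True
    then show ?thesis by (intro exI[of _ "[]"]) (simp add: orth_blocks_def)
  next
    case False
    then obtain x where "x \<in> W" "x \<noteq> 0" using inv_0[OF less.prems(1)] by blast
    then obtain t us where b: "block t us" "set us \<subseteq> W"
      using block_exists[OF qc s less.prems] by blast
    note p = block_perp[OF b(1) less.prems b(2)]
    have "dim (W \<inter> perp (span (set us))) < dim W" using p(3) block_length[OF b(1)] by simp
    then obtain ps where "orth_blocks ps" "total ps = W \<inter> perp (span (set us))"
      using less.hyps p by blast
    then show ?thesis using orth_blocks_perp[OF b(1) less.prems(1) b(2)] by blast
  qed
qed

text \<open>The identity matrix of size 3 has, in characteristic 2, the same symmetric form as the sum of a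
  one-dimensional form and a hyperbolic plane; here it is lifted to the blocks of type B and E.\<close>

lemma B_E_replacement:
  assumes qc: "quadratically_closed TYPE('a)" and s: "\<And>x. fold N as x = 0"
    and two: "(2::'a) = 0" and l: "odd l" and b1: "block (Summand_B l) us1"
    and b2: "block (Summand_E (2 * l)) us2" and o: "orth us1 us2"
  shows "\<exists>ps. orth_blocks ps \<and> total ps = {x + y |x y. x \<in> span (set us1) \<and> y \<in> span (set us2)} \<and> 3 \<le> length ps"
proof -
  have g1: "gram_matrix f us1 = Gamma0_mat l" and g2: "gram_matrix f us2 = hyperbolic_jordan l 1"
    using b1 b2 by (simp_all add: block_def)
  define T where "T = (N 1 ^^ (l - 1) :: 'v \<Rightarrow> 'v)"
  have linT: "lin T" unfolding T_def by (rule lin_pow[OF opr_N])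
  have l0: "0 < l" using l by (rule odd_pos)
  obtain v where v: "v \<in> span (set us1)" "(N 1 ^^ l) v = 0" "chain 1 v l = span (set us1)" "f v (T v) = 1"
    using Gamma0_block[OF b1 g1 two l] unfolding T_def by blast
  obtain x w where x: "(N 1 ^^ l) x = 0" "T x \<noteq> 0" and w: "(N 1 ^^ l) w = 0"
    and iso: "\<forall>p\<in>chain 1 x l. \<forall>q\<in>chain 1 x l. f p q = 0" "\<forall>p\<in>chain 1 w l. \<forall>q\<in>chain 1 w l. f p q = 0"
    and U2: "span (set us2) = {p + q |p q. p \<in> chain 1 x l \<and> q \<in> chain 1 w l}" and wx: "f w (T x) = 1"
    using hyperbolic_block[OF b2 g2 one_neq_zero] unfolding inverse_1 T_def by blast
  have inv_x: "inv_sub (chain 1 x l)" and inv_w: "inv_sub (chain 1 w l)"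
    using inv_chain x(1) w by blast+
  have xx: "f x (T x) = 0" and ww: "f w (T w) = 0"
    using iso chain_mem[OF l0] inv_N_pow[OF inv_x] inv_N_pow[OF inv_w] unfolding T_def by blast+
  have xU2: "x \<in> span (set us2)" and wU2: "w \<in> span (set us2)"
  proof -
    have "x + 0 \<in> span (set us2)" "0 + w \<in> span (set us2)"
      unfolding U2 using chain_mem[OF l0] inv_0[OF inv_x] inv_0[OF inv_w] by blast+
    then show "x \<in> span (set us2)" "w \<in> span (set us2)" by simp_all
  qed
  have sym: "f p (T q) = f q (T p)" if "(N 1 ^^ l) p = 0" for p q
    using top_symmetric[OF _ that l0, of q] l by (simp add: T_def)
  define W where "W = {x + y |x y. x \<in> span (set us1) \<and> y \<in> span (set us2)}"
  have inv1: "inv_sub (span (set us1))" and inv2: "inv_sub (span (set us2))"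
    using b1 b2 by (simp_all add: block_def)
  have W: "inv_sub W" unfolding W_def by (rule inv_plus[OF inv1 inv2])
  have ndW: "nondeg_on W" unfolding W_def
    by (rule nondeg_on_sum) (auto simp: block_gram(2)[OF b1] block_gram(2)[OF b2] orth_span[OF o])
  have T1: "T p \<in> span (set us1)" if "p \<in> span (set us1)" for p
    unfolding T_def by (rule inv_N_pow[OF inv1 that])
  have T2: "T p \<in> span (set us2)" if "p \<in> span (set us2)" for p
    unfolding T_def by (rule inv_N_pow[OF inv2 that])
  have cross: "f v (T p) = 0" "f p (T v) = 0" if "p \<in> span (set us2)" for p
    using orth_span[OF o v(1) T2[OF that]] orth_span[OF o T1[OF v(1)] that] by simp_all
  have killed: "(N 1 ^^ l) p = 0" if "p \<in> W" for p
  proof -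
    have K: "inv_sub {p. (N 1 ^^ l) p = 0}" by (intro inv_ker opr_pow opr_N)
    have "span (set us1) \<subseteq> {p. (N 1 ^^ l) p = 0}"
      unfolding v(3)[symmetric] by (rule chain_subset[OF K]) (simp add: v)
    moreover have "chain 1 x l \<subseteq> {p. (N 1 ^^ l) p = 0}" "chain 1 w l \<subseteq> {p. (N 1 ^^ l) p = 0}"
      by (intro chain_subset[OF K]; simp add: x w)+
    ultimately have "W \<subseteq> {p. (N 1 ^^ l) p = 0}"
      unfolding W_def U2 using inv_add[OF K] by blast
    then show ?thesis using that by blast
  qed
  have WI: "p + q \<in> W" if "p \<in> span (set us1)" "q \<in> span (set us2)" for p q
    unfolding W_def using that by blast
  \<comment> \<open>For the symmetric form \<open>f p (T q)\<close> the vectors \<open>v\<close>,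
    \<open>x\<close>, \<open>w\<close> give a unit vector plus a hyperbolic plane. There
    \<open>v1\<close> and \<open>v2\<close> are orthonormal, the mixed value being 1 + 1 =
    0.\<close>
  define v1 v2 where "v1 = v + x" and "v2 = v + w"
  have vW: "v1 \<in> W" "v2 \<in> W" unfolding v1_def v2_def using WI v(1) xU2 wU2 by auto
  have v11: "f v1 (T v1) = 1"
    using cross[OF xU2] by (simp add: v1_def lin_add[OF linT] f_simps v xx)
  have v22: "f v2 (T v2) = 1"
    using cross[OF wU2] by (simp add: v2_def lin_add[OF linT] f_simps v ww)
  have v21: "f v2 (T v1) = 0"
    using cross[OF xU2] cross[OF wU2] two by (simp add: v1_def v2_def lin_add[OF linT] f_simps v wx)
  \<comment> \<open>Working inside \<open>C\<close> keeps the top vectors of the new summand on the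
    line of \<open>T v1\<close>. Hence the part \<open>z\<close> of \<open>v2\<close> orthogonal to
    it still has top value 1.\<close>
  define C where "C = {p \<in> W. \<exists>c. T p = c *s T v1}"
  have T\<sigma>: "T (\<sigma> p) = T p" if "p \<in> W" for p
    using top_eigen[OF killed[OF that] l0] by (simp add: T_def opr_\<sigma>'[OF opr_pow[OF opr_N]])
  have C: "inv_sub C"
  proof (rule subset_\<sigma>_imp_inv)
    show "subspace C"
      unfolding subspace_def C_def using W
      by (auto simp: inv_0 inv_add inv_scale lin_simps[OF linT] scale_left_distrib[symmetric]
          intro: exI[of _ 0])
    show "\<sigma> p \<in> C" if "p \<in> C" for p using that T\<sigma>[of p] W by (auto simp: C_def inv_\<sigma>)
  qed
  have v1C: "v1 \<in> C" using vW by (auto simp: C_def intro: exI[of _ 1])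
  obtain us where us: "set us \<subseteq> C" "gram_matrix f us = Gamma0_mat l" "inv_sub (span (set us))"
    using Gamma0_piece[OF qc two l C v1C killed[OF vW(1)]] v11 unfolding T_def by auto
  have b: "block (Summand_B l) us" using us b1 by (simp add: block_def)
  have UC: "span (set us) \<subseteq> C" using us(1) C by (simp add: span_minimal inv_subspace)
  have usW: "set us \<subseteq> W" using us(1) by (auto simp: C_def)
  note ndU = block_gram(2)[OF b]
  obtain g where g: "g \<in> span (set us)" "f g (T g) = 1"
    using Gamma0_block[OF b us(2) two l] unfolding T_def by blast
  obtain c0 where c0: "T g = c0 *s T v1" using g(1) UC by (auto simp: C_def)
  have c00: "c0 \<noteq> 0" using g(2) c0 by auto
  obtain u where u: "u \<in> span (set us)" "v2 - u \<in> perp (span (set us))"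
    using perp_decomp[OF _ ndU] by (metis subspace_span)
  define z where "z = v2 - u"
  have TU: "T p \<in> span (set us)" if "p \<in> span (set us)" for p
    unfolding T_def by (rule inv_N_pow[OF us(3) that])
  have zp: "z \<in> perp (span (set us))" using u by (simp add: z_def)
  have uW: "u \<in> W" using u UC by (auto simp: C_def)
  have zW: "z \<in> W" unfolding z_def using W vW uW by (intro inv_diff)
  have zu: "f z (T p) = 0" if "p \<in> span (set us)" for p
    by (rule perp_left[OF us(3) zp TU[OF that]])
  have "f z (T v1) = 0" using zu[OF g(1)] c00 by (simp add: c0 f_simps)
  then have uv1: "f u (T v1) = 0" using v21 by (simp add: z_def f_simps)
  obtain c where c: "T u = c *s T v1" using u(1) UC by (auto simp: C_def)
  have uu: "f u (T u) = 0" using uv1 by (simp add: c f_simps)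
  have uz: "f u (T z) = 0" using sym[OF killed[OF uW]] zu[OF u(1)] by simp
  have "v2 = u + z" by (simp add: z_def)
  then have zz: "f z (T z) = 1"
    using v22 uu uz zu[OF u(1)] by (simp add: lin_add[OF linT] f_simps)
  define W1 where "W1 = W \<inter> perp (span (set us))"
  note p1 = block_perp[OF b W ndW usW, folded W1_def]
  have zW1: "z \<in> W1" using zW zp by (simp add: W1_def)
  obtain us' where us': "set us' \<subseteq> W1" "gram_matrix f us' = Gamma0_mat l" "inv_sub (span (set us'))"
    using Gamma0_piece[OF qc two l p1(1) zW1 killed[OF zW]] zz unfolding T_def by auto
  have b': "block (Summand_B l) us'" using us' b1 by (simp add: block_def)
  note p2 = block_perp[OF b' p1(1,2) us'(1)]
  obtain ps where ps: "orth_blocks ps" "total ps = W1 \<inter> perp (span (set us'))"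
    using orth_blocks_exist[OF qc s p2(1,2)] by blast
  \<comment> \<open>After two summands of size \<open>l\<close> a space of dimension
    \<open>l\<close> remains, which contributes at least one further block.\<close>
  have "dim W = 3 * l"
  proof -
    have "span (set us1) \<inter> span (set us2) \<subseteq> {0}"
      using orth_span[OF o] by (intro orth_Int block_gram(2)[OF b1]) auto
    then have "dim W = dim (span (set us1)) + dim (span (set us2))"
      unfolding W_def by (intro dim_direct_sum) auto
    then show ?thesis
      using block_dim[OF b1] block_dim[OF b2] gram_length[OF g1] gram_length[OF g2] by simp
  qed
  moreover have "length us = l" "length us' = l"
    using gram_length[OF us(2)] gram_length[OF us'(2)] by simp_all
  ultimately have "dim (total ps) = l" using p1(3) p2(3) ps(2) by simp
  then have "ps \<noteq> []" using l0 by auto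
  note q = orth_blocks_perp[OF b' p1(1) us'(1) ps]
  have "orth_blocks ((Summand_B l, us) # (Summand_B l, us') # ps)"
    "total ((Summand_B l, us) # (Summand_B l, us') # ps) = W"
    using orth_blocks_perp[OF b W usW q(1)] q(2) by (simp_all add: W1_def)
  moreover have "3 \<le> length ((Summand_B l, us) # (Summand_B l, us') # ps)"
    using \<open>ps \<noteq> []\<close> by (cases ps) auto
  ultimately show ?thesis unfolding W_def by blast
qed

lemma canonical_blocks_exist:
  assumes qc: "quadratically_closed TYPE('a)" and s: "\<And>x. fold N as x = 0"
  shows "\<exists>ps. orth_blocks ps \<and> total ps = UNIV \<and> (CHAR('a) = 2 \<longrightarrow>
    \<not> (\<exists>l. odd l \<and> Summand_B l \<in> set (map fst ps) \<and> Summand_E (2 * l) \<in> set (map fst ps)))"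
proof -
  define P where "P = (\<lambda>k. \<exists>ps. orth_blocks ps \<and> total ps = UNIV \<and> length ps = k)"
  have "nondeg_on UNIV" using nondeg by (auto simp: nondeg_on_def)
  then have "\<exists>k. P k" unfolding P_def using orth_blocks_exist[OF qc s inv_UNIV] by blast
  then obtain k0 where k0: "P k0" by blast
  have bound: "k \<le> dim (UNIV :: 'v set)" if "P k" for k using that unfolding P_def using length_le_dim by metis
  define k where "k = Greatest P"
  have "P k" unfolding k_def using k0 bound by (rule GreatestI_nat)
  then obtain ps where ps: "orth_blocks ps" "total ps = UNIV" "length ps = k" unfolding P_def by blast
  have "\<not> (odd l \<and> Summand_B l \<in> set (map fst ps) \<and> Summand_E (2 * l) \<in> set (map fst ps))"
    if ch: "CHAR('a) = 2" for l
  proof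
    assume a: "odd l \<and> Summand_B l \<in> set (map fst ps) \<and> Summand_E (2 * l) \<in> set (map fst ps)"
    have two: "(2::'a) = 0" using ch two_eq_0_iff[where 'a='a] by blast
    obtain us1 us2 where in12: "(Summand_B l, us1) \<in> set ps" "(Summand_E (2 * l), us2) \<in> set ps"
      using a by auto
    define rest where "rest = remove1 (Summand_E (2 * l), us2) (remove1 (Summand_B l, us1) ps)"
    have m: "mset ps = mset ((Summand_B l, us1) # (Summand_E (2 * l), us2) # rest)"
    proof -
      have "(Summand_E (2 * l), us2) \<in> set (remove1 (Summand_B l, us1) ps)" using in12 by simp
      moreover have "mset ys = add_mset y (mset (remove1 y ys))" if "y \<in> set ys"
        for y :: "'a summand \<times> 'v list" and ys using that by simp
      ultimately show ?thesis unfolding rest_def using in12(1) by (metis mset.simps(2))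
    qed
    have ob: "orth_blocks ((Summand_B l, us1) # (Summand_E (2 * l), us2) # rest)"
      by (rule orth_blocks_mset[OF m ps(1)])
    have tot: "total ((Summand_B l, us1) # (Summand_E (2 * l), us2) # rest) = UNIV"
      using total_mset[OF m] ps(2) by simp
    have b: "block (Summand_B l) us1" "block (Summand_E (2 * l)) us2" "orth us1 us2" "orth_blocks rest"
      using ob by (auto simp: orth_blocks_def)
    obtain qs where qs: "orth_blocks qs" "total qs = {x + y |x y. x \<in> span (set us1) \<and> y \<in> span (set us2)}"
      "3 \<le> length qs"
      using B_E_replacement[OF qc s two _ b(1,2,3)] a by blast
    have t12: "total [(Summand_B l, us1), (Summand_E (2 * l), us2)] = total qs"
      unfolding qs(2) by (simp add: total_Cons)
    have "f x y = 0 \<and> f y x = 0" if xy: "x \<in> total qs" "y \<in> total rest" for x y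
    proof -
      obtain p q where pq: "x = p + q" "p \<in> span (set us1)" "q \<in> span (set us2)"
        using xy(1) unfolding qs(2) by blast
      have "0 + y \<in> total ((Summand_E (2 * l), us2) # rest)"
        unfolding total_Cons using xy(2) span_zero by fastforce
      then have "f p y = 0 \<and> f y p = 0" using ob pq by (simp add: orth_blocks_Cons)
      moreover have "f q y = 0 \<and> f y q = 0" using ob pq xy(2) by (simp add: orth_blocks_Cons)
      ultimately show ?thesis by (simp add: pq f_simps)
    qed
    then have "orth_blocks (qs @ rest)" by (intro orth_blocks_append qs b) auto
    moreover have "total (qs @ rest) = UNIV"
      using tot total_append[of "[(Summand_B l, us1), (Summand_E (2 * l), us2)]" rest] t12
      by (simp add: total_append)
    ultimately have "P (length (qs @ rest))" unfolding P_def by blast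
    then have "length (qs @ rest) \<le> k" unfolding k_def using Greatest_le_nat[of P _ "dim (UNIV :: 'v set)"] bound by blast
    moreover have "length ps = Suc (Suc (length rest))" using arg_cong[OF m, of size] by simp
    ultimately show False using qs(3) ps(3) by simp
  qed
  then show ?thesis using ps by blast
qed

end

fun jordan_blocks :: "'a::field summand \<Rightarrow> (nat \<times> 'a) list" where
  "jordan_blocks (Summand_A k) = [(k, 1)]"
| "jordan_blocks (Summand_B k) = [(k, 1)]"
| "jordan_blocks (Summand_C k) = [(k, - 1)]"
| "jordan_blocks (Summand_D k) = [(k div 2, 1), (k div 2, 1)]"
| "jordan_blocks (Summand_E k) = [(k div 2, 1), (k div 2, 1)]"
| "jordan_blocks (Summand_F k) = [(k div 2, - 1), (k div 2, - 1)]"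
| "jordan_blocks (Summand_G k x) = [(k div 2, x), (k div 2, inverse x)]"

text \<open>The dimension of the kernel of the \<open>j\<close>-th power of T - a, for an operator T
  with Jordan blocks \<open>bl\<close> given as pairs of size and eigenvalue.\<close>

definition kernel_size :: "'a \<Rightarrow> nat \<Rightarrow> (nat \<times> 'a) list \<Rightarrow> nat" where
  "kernel_size a j bl = (\<Sum>b\<leftarrow>bl. if a = snd b then min j (fst b) else 0)"

lemma kernel_size_append: "kernel_size a j (xs @ ys) = kernel_size a j xs + kernel_size a j ys"
  by (simp add: kernel_size_def)

text \<open>The negated second difference of \<open>min j n\<close> in \<open>j\<close> is 1 at
  \<open>j = n\<close> and 0 at other positive \<open>j\<close>. The integers avoid truncated
  subtraction.\<close>

lemma count_from_kernel_size:
  assumes "0 < k"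
  shows "int (count_list bl (k, a)) =
    2 * int (kernel_size a k bl) - int (kernel_size a (k - 1) bl) - int (kernel_size a (k + 1) bl)"
proof (induction bl)
  case (Cons b bl)
  obtain n c where b: "b = (n, c)" by fastforce
  show ?case using Cons assms unfolding b by (auto simp: kernel_size_def min_def)
qed (simp add: kernel_size_def)

context form_space
begin

subsection \<open>Invariants of a decomposition\<close>

definition kernel_dim :: "'v set \<Rightarrow> 'a \<Rightarrow> nat \<Rightarrow> nat" where
  "kernel_dim U a j = dim (U \<inter> {x. (N a ^^ j) x = 0})"

text \<open>If the power kills \<open>x + y\<close>, then the images of \<open>x\<close> and
  \<open>y\<close> are opposite, hence lie in \<open>U \<inter> W\<close> and vanish; so the kernel
  splits along the sum.\<close>

lemma kernel_dim_sum:
  assumes U: "inv_sub U" and W: "inv_sub W" and UW: "U \<inter> W \<subseteq> {0}"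
  shows "kernel_dim {x + y |x y. x \<in> U \<and> y \<in> W} a j = kernel_dim U a j + kernel_dim W a j"
proof -
  define K where "K = {x. (N a ^^ j) x = 0}"
  have K: "inv_sub K" unfolding K_def by (intro inv_ker opr_pow opr_N)
  have "{x + y |x y. x \<in> U \<and> y \<in> W} \<inter> K = {x + y |x y. x \<in> U \<inter> K \<and> y \<in> W \<inter> K}"
  proof (intro equalityI subsetI)
    fix z assume "z \<in> {x + y |x y. x \<in> U \<and> y \<in> W} \<inter> K"
    then obtain x y where z: "z = x + y" "x \<in> U" "y \<in> W" "x + y \<in> K" by blast
    have "(N a ^^ j) x + (N a ^^ j) y = 0" using z by (simp add: K_def lin_add[OF lin_pow[OF opr_N]])
    then have e: "(N a ^^ j) x = 0 - (N a ^^ j) y" by (simp add: eq_neg_iff_add_eq_0)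
    have "(N a ^^ j) x \<in> U" "(N a ^^ j) y \<in> W" using z inv_N_pow U W by blast+
    then have "(N a ^^ j) x \<in> U \<inter> W" using inv_diff[OF W inv_0[OF W], of "(N a ^^ j) y"] e by simp
    then have "(N a ^^ j) x = 0" using UW by blast
    then have "x \<in> K" "y \<in> K" using e by (simp_all add: K_def)
    then show "z \<in> {x + y |x y. x \<in> U \<inter> K \<and> y \<in> W \<inter> K}" using z by blast
  next
    fix z assume "z \<in> {x + y |x y. x \<in> U \<inter> K \<and> y \<in> W \<inter> K}"
    then show "z \<in> {x + y |x y. x \<in> U \<and> y \<in> W} \<inter> K" using inv_add[OF K] by blast
  qed
  moreover have "dim {x + y |x y. x \<in> U \<inter> K \<and> y \<in> W \<inter> K} = dim (U \<inter> K) + dim (W \<inter> K)"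
    using UW by (intro dim_direct_sum) (auto simp: inv_subspace inv_Int U W K)
  ultimately show ?thesis by (simp add: kernel_dim_def K_def)
qed

text \<open>The span of the first \<open>k - j\<close> chain members meets the kernel trivially,
  which bounds the dimension of the kernel by \<open>j\<close>; the last \<open>j\<close> members
  fill it.\<close>

lemma chain_ker:
  assumes v: "(N a ^^ k) v = 0" "(N a ^^ (k - 1)) v \<noteq> 0" and j: "j \<le> k"
  shows "chain a v k \<inter> {x. (N a ^^ j) x = 0} = chain a ((N a ^^ (k - j)) v) j"
    and "dim (chain a v k \<inter> {x. (N a ^^ j) x = 0}) = j"
proof -
  define K where "K = {x. (N a ^^ j) x = 0}"
  have K: "inv_sub K" unfolding K_def by (intro inv_ker opr_pow opr_N)
  have k: "0 < k" using v by (cases k) auto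
  have C: "inv_sub (chain a v k)" by (rule inv_chain[OF v(1)])
  have CK: "inv_sub (chain a v k \<inter> K)" by (rule inv_Int[OF C K])
  have Npow: "(N a ^^ p) ((N a ^^ q) v) = (N a ^^ (p + q)) v" for p q by (simp add: funpow_add)
  define L where "L = map (\<lambda>i. (N a ^^ i) v) [0..<k - j]"
  have top: "(N a ^^ (k - j)) ((N a ^^ j) v) = 0" using v(1) j by (simp add: Npow)
  have ind: "\<forall>i<k - j. c i = 0" if c: "(\<Sum>i<k - j. c i *s (N a ^^ (j + i)) v) = 0" for c
  proof (cases "k - j = 0")
    case False
    then have "(N a ^^ (k - j - 1)) ((N a ^^ j) v) \<noteq> 0" using v(2) j by (simp add: Npow)
    then have "indep_list (map (\<lambda>i. (N a ^^ i) ((N a ^^ j) v)) [0..<k - j])"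
      by (rule chain_indep[OF top])
    then show ?thesis using c by (simp add: indep_list_def Npow add.commute)
  qed simp
  have pow: "(N a ^^ j) (\<Sum>i<k - j. c i *s (N a ^^ i) v) = (\<Sum>i<k - j. c i *s (N a ^^ (j + i)) v)" for c
    by (simp add: lin_sum[OF lin_pow[OF opr_N]] lin_scale[OF lin_pow[OF opr_N]] Npow)
  have L: "indep_list L"
    unfolding indep_list_def
  proof (intro allI impI)
    fix c i assume "(\<Sum>i<length L. c i *s L ! i) = 0" and i: "i < length L"
    then have "(\<Sum>i<k - j. c i *s (N a ^^ i) v) = 0" by (simp add: L_def)
    then have "\<forall>i<k - j. c i = 0" using pow[of c] ind[of c] by (simp add: lin_0[OF lin_pow[OF opr_N]])
    then show "c i = 0" using i by (simp add: L_def)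
  qed
  have disj: "chain a v k \<inter> K \<inter> span (set L) \<subseteq> {0}"
  proof
    fix x assume x: "x \<in> chain a v k \<inter> K \<inter> span (set L)"
    then obtain c where c: "x = (\<Sum>i<length L. c i *s L ! i)" using span_list_lincomb by blast
    then have x': "x = (\<Sum>i<k - j. c i *s (N a ^^ i) v)" by (simp add: L_def)
    have "(N a ^^ j) x = 0" using x by (simp add: K_def)
    then have "\<forall>i<k - j. c i = 0" using pow[of c] ind[of c] x' by simp
    then show "x \<in> {0}" using x' by simp
  qed
  have "{x + y |x y. x \<in> chain a v k \<inter> K \<and> y \<in> span (set L)} \<subseteq> chain a v k"
  proof -
    have "set L \<subseteq> chain a v k" using chain_mem[OF k] inv_N_pow[OF C] by (auto simp: L_def)
    then have "span (set L) \<subseteq> chain a v k" using C by (simp add: span_minimal inv_subspace)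
    then show ?thesis using inv_add[OF C] by blast
  qed
  then have "dim {x + y |x y. x \<in> chain a v k \<inter> K \<and> y \<in> span (set L)} \<le> k"
    using dim_subset[of _ "chain a v k"] by (simp add: chain_dim[OF v])
  then have "dim (chain a v k \<inter> K) + dim (span (set L)) \<le> k"
    using dim_direct_sum[OF inv_subspace[OF CK] _ disj] by simp
  then have le: "dim (chain a v k \<inter> K) \<le> j"
    using indep_list_dim[OF L] j by (simp add: L_def)
  have "chain a ((N a ^^ (k - j)) v) j = chain a v k \<inter> K"
  proof (cases "j = 0")
    case True
    have "chain a v k \<inter> K = {0}" using True inv_0[OF C] by (auto simp: K_def)
    then show ?thesis by (simp add: chain_def True)
  next
    case False
    show ?thesis
    proof (rule chain_eq)
      show "(N a ^^ j) ((N a ^^ (k - j)) v) = 0" using v(1) j by (simp add: Npow)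
      show "(N a ^^ (j - 1)) ((N a ^^ (k - j)) v) \<noteq> 0" using v(2) j False by (simp add: Npow)
      then show "(N a ^^ (k - j)) v \<in> chain a v k \<inter> K"
        using v(1) j inv_N_pow[OF C chain_mem[OF k]] by (simp add: K_def Npow)
    qed (use CK le in auto)
  qed
  then show eq: "chain a v k \<inter> {x. (N a ^^ j) x = 0} = chain a ((N a ^^ (k - j)) v) j"
    by (simp add: K_def)
  show "dim (chain a v k \<inter> {x. (N a ^^ j) x = 0}) = j"
  proof (cases "j = 0")
    case True
    then show ?thesis unfolding eq by (simp add: chain_def)
  next
    case False
    show ?thesis unfolding eq
      by (rule chain_dim) (use v j False in \<open>simp_all add: Npow\<close>)
  qed
qed

lemma kernel_dim_chain:
  assumes v: "(N b ^^ k) v = 0" "(N b ^^ (k - 1)) v \<noteq> 0"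
  shows "kernel_dim (chain b v k) a j = kernel_size a j [(k, b)]"
proof -
  have C: "chain b v k \<subseteq> {x. (N b ^^ k) x = 0}"
    by (rule chain_subset[OF inv_ker[OF opr_pow[OF opr_N]]]) (simp add: v)
  show ?thesis
  proof (cases "a = b")
    case True
    show ?thesis
    proof (cases "j \<le> k")
      case j: True
      then show ?thesis using chain_ker(2)[OF v j] True by (simp add: kernel_dim_def kernel_size_def)
    next
      case False
      then have "chain b v k \<subseteq> {x. (N a ^^ j) x = 0}" using C N_pow_mono[of k b _ j] True by auto
      then have "chain b v k \<inter> {x. (N a ^^ j) x = 0} = chain b v k" by blast
      then show ?thesis using chain_dim[OF v] True False by (simp add: kernel_dim_def kernel_size_def)
    qed
  next
    case False
    have "chain b v k \<inter> {x. (N a ^^ j) x = 0} \<subseteq> {0}"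
      using C eigen_ker_disjoint[of j a _ k b] False by blast
    then have "dim (chain b v k \<inter> {x. (N a ^^ j) x = 0}) = 0" by simp
    then show ?thesis using False by (simp add: kernel_dim_def kernel_size_def)
  qed
qed

text \<open>All seven families come down to two shapes: one Jordan chain, or a pair of chains for
  \<open>a\<close> and \<open>inverse a\<close>. The clauses about \<open>Summand_B\<close> serve
  characteristic 2, where B is the only family of the first shape.\<close>

lemma block_cases:
  assumes b: "block s us"
  obtains (single) k a v where "jordan_blocks s = [(k, a)]" "length us = k" "v \<in> span (set us)"
      "(N a ^^ k) v = 0" "(N a ^^ (k - 1)) v \<noteq> 0" "chain a v k = span (set us)"
      "s = Summand_B k \<longrightarrow> f v ((N a ^^ (k - 1)) v) = 1" "(2::'a) = 0 \<longrightarrow> s = Summand_B k"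
  | (double) m a where "jordan_blocks s = [(m, a), (m, inverse a)]" "a \<noteq> 0"
      "gram_matrix f us = hyperbolic_jordan m a" "\<forall>k. s \<noteq> Summand_B k"
proof -
  have adm: "admissible_summand s" and g: "gram_matrix f us = summand_mat s"
    using b by (simp_all add: block_def)
  have ch: "CHAR('a) = 2 \<longleftrightarrow> (2::'a) = 0" using two_eq_0_iff by blast
  show ?thesis
  proof (cases s)
    case (Summand_A k)
    then have g': "gram_matrix f us = Gamma_mat k" using g by simp
    have two: "(2::'a) \<noteq> 0" and "odd k" using adm ch unfolding Summand_A by simp_all
    then have "(1::'a) = (-1) ^ (k - 1)" by simp
    then obtain v where v: "v \<in> span (set us)" "(N 1 ^^ k) v = 0" "(N 1 ^^ (k - 1)) v \<noteq> 0"
      "chain 1 v k = span (set us)" using Gamma_block[OF b g' two] by blast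
    show ?thesis by (rule single[of k 1 v]) (use v two Summand_A gram_length[OF g'] in auto)
  next
    case (Summand_B k)
    then have g': "gram_matrix f us = Gamma0_mat k" using g by simp
    have two: "(2::'a) = 0" and "odd k" using adm ch unfolding Summand_B by simp_all
    then obtain v where v: "v \<in> span (set us)" "(N 1 ^^ k) v = 0" "(N 1 ^^ (k - 1)) v \<noteq> 0"
      "chain 1 v k = span (set us)" "f v ((N 1 ^^ (k - 1)) v) = 1" using Gamma0_block[OF b g' two] by blast
    show ?thesis by (rule single[of k 1 v]) (use v Summand_B gram_length[OF g'] in auto)
  next
    case (Summand_C k)
    then have g': "gram_matrix f us = Gamma_mat k" using g by simp
    have two: "(2::'a) \<noteq> 0" and "1 \<le> k" "even k" using adm ch unfolding Summand_C by simp_all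
    then have "odd (k - 1)" by simp
    then have "(-1::'a) = (-1) ^ (k - 1)" by (rule neg_one_odd_power[symmetric])
    then obtain v where v: "v \<in> span (set us)" "(N (-1) ^^ k) v = 0" "(N (-1) ^^ (k - 1)) v \<noteq> 0"
      "chain (-1) v k = span (set us)" using Gamma_block[OF b g' two] by blast
    show ?thesis by (rule single[of k "-1" v]) (use v two Summand_C gram_length[OF g'] in auto)
  next
    case (Summand_D k)
    show ?thesis by (rule double[of "k div 2" 1]) (use g Summand_D in auto)
  next
    case (Summand_E k)
    show ?thesis by (rule double[of "k div 2" 1]) (use g Summand_E in auto)
  next
    case (Summand_F k)
    show ?thesis by (rule double[of "k div 2" "-1"]) (use g Summand_F in auto)
  next
    case (Summand_G k x)
    show ?thesis by (rule double[of "k div 2" x]) (use g adm Summand_G in auto)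
  qed
qed

lemma kernel_dim_block:
  assumes b: "block s us"
  shows "kernel_dim (span (set us)) a j = kernel_size a j (jordan_blocks s)"
  using b
proof (cases rule: block_cases)
  case (single k c v)
  then show ?thesis using kernel_dim_chain[of k c v a j] by simp
next
  case (double m c)
  obtain v w where v: "(N c ^^ m) v = 0" "(N c ^^ (m - 1)) v \<noteq> 0"
    and w: "(N (inverse c) ^^ m) w = 0" "(N (inverse c) ^^ (m - 1)) w \<noteq> 0"
    and d: "chain c v m \<inter> chain (inverse c) w m \<subseteq> {0}"
      "span (set us) = {x + y |x y. x \<in> chain c v m \<and> y \<in> chain (inverse c) w m}"
    using hyperbolic_block[OF b double(3,2)] by blast
  have "kernel_dim (span (set us)) a j = kernel_size a j [(m, c)] + kernel_size a j [(m, inverse c)]"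
    unfolding d(2) kernel_dim_sum[OF inv_chain[OF v(1)] inv_chain[OF w(1)] d(1)]
      kernel_dim_chain[OF v] kernel_dim_chain[OF w] ..
  then show ?thesis unfolding double(1) by (simp add: kernel_size_def)
qed

lemma kernel_dim_total:
  "orth_blocks ps \<Longrightarrow> kernel_dim (total ps) a j = kernel_size a j (concat (map (jordan_blocks \<circ> fst) ps))"
proof (induction ps)
  case Nil then show ?case by (simp add: kernel_dim_def kernel_size_def dim_eq_0)
next
  case (Cons p ps)
  have b: "block (fst p) (snd p)" using Cons.prems by (simp add: orth_blocks_Cons)
  have "span (set (snd p)) \<inter> total ps \<subseteq> {0}"
    using Cons.prems by (intro orth_Int block_gram(2)[OF b]) (simp add: orth_blocks_Cons)
  then have "kernel_dim (total (p # ps)) a j = kernel_dim (span (set (snd p))) a j + kernel_dim (total ps) a j"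
    unfolding total_Cons using Cons.prems b
    by (intro kernel_dim_sum inv_total) (auto simp: orth_blocks_Cons block_def)
  then show ?case using Cons kernel_dim_block[OF b] by (simp add: orth_blocks_Cons kernel_size_append)
qed

text \<open>Kernel dimensions depend only on \<sigma> and the total space, and second differences
  recover the multiplicities from them.\<close>

lemma jordan_blocks_unique:
  assumes "orth_blocks ps" "orth_blocks qs" "total ps = total qs" "0 < k"
  shows "count_list (concat (map (jordan_blocks \<circ> fst) ps)) (k, a) =
    count_list (concat (map (jordan_blocks \<circ> fst) qs)) (k, a)"
proof -
  have "kernel_size a j (concat (map (jordan_blocks \<circ> fst) ps)) =
      kernel_size a j (concat (map (jordan_blocks \<circ> fst) qs))" for j
    using kernel_dim_total[OF assms(1), of a j] kernel_dim_total[OF assms(2), of a j] assms(3) by simp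
  then have "int (count_list (concat (map (jordan_blocks \<circ> fst) ps)) (k, a)) =
      int (count_list (concat (map (jordan_blocks \<circ> fst) qs)) (k, a))"
    unfolding count_from_kernel_size[OF assms(4)] by simp
  then show ?thesis by simp
qed

text \<open>In characteristic 2, the summands of type B are detected by the following condition, which holds
  on all other blocks.\<close>

definition alternating_at :: "nat \<Rightarrow> 'v set \<Rightarrow> bool" where
  "alternating_at k U \<longleftrightarrow> (\<forall>x\<in>U. (N 1 ^^ k) x = 0 \<longrightarrow> f x ((N 1 ^^ (k - 1)) x) = 0)"

lemma alternating_at_sum:
  assumes U: "inv_sub U" "alternating_at k U" and W: "inv_sub W" "alternating_at k W"
    and UW: "U \<inter> W \<subseteq> {0}" and o: "\<And>x y. x \<in> U \<Longrightarrow> y \<in> W \<Longrightarrow> (N 1 ^^ k) x = 0 \<Longrightarrow> (N 1 ^^ k) y = 0 \<Longrightarrow>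
      f x ((N 1 ^^ (k - 1)) y) + f y ((N 1 ^^ (k - 1)) x) = 0"
  shows "alternating_at k {x + y |x y. x \<in> U \<and> y \<in> W}"
  unfolding alternating_at_def
proof (intro ballI impI)
  fix z assume "z \<in> {x + y |x y. x \<in> U \<and> y \<in> W}" and z0: "(N 1 ^^ k) z = 0"
  then obtain x y where z: "z = x + y" "x \<in> U" "y \<in> W" by blast
  note linN = lin_pow[OF opr_N]
  have "(N 1 ^^ k) x + (N 1 ^^ k) y = 0" using z z0 by (simp add: lin_add[OF linN])
  then have e: "(N 1 ^^ k) x = 0 - (N 1 ^^ k) y" by (simp add: eq_neg_iff_add_eq_0)
  have "(N 1 ^^ k) x \<in> U" "(N 1 ^^ k) y \<in> W" using z inv_N_pow U W by blast+
  then have "(N 1 ^^ k) x \<in> U \<inter> W" using inv_diff[OF W(1) inv_0[OF W(1)], of "(N 1 ^^ k) y"] e by simp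
  then have x0: "(N 1 ^^ k) x = 0" using UW by blast
  then have y0: "(N 1 ^^ k) y = 0" using e by simp
  have "f z ((N 1 ^^ (k - 1)) z) = f x ((N 1 ^^ (k - 1)) x) + f y ((N 1 ^^ (k - 1)) y)
      + (f x ((N 1 ^^ (k - 1)) y) + f y ((N 1 ^^ (k - 1)) x))"
    by (simp add: z lin_add[OF linN] f_simps)
  then show "f z ((N 1 ^^ (k - 1)) z) = 0"
    using o[OF z(2,3) x0 y0] U(2) W(2) z x0 y0 by (simp add: alternating_at_def)
qed

text \<open>In a chain shorter than \<open>k\<close> already \<open>(N 1 ^^ (k - 1)) x = 0\<close>.
  In a longer one the kernel of \<open>N 1 ^^ k\<close> lies in the image of
  \<open>N 1 ^^ (m - k)\<close>. Moved across, this power becomes one of \<open>M 1\<close> and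
  meets \<open>(N 1 ^^ (k - 1)) x\<close>, which \<open>N 1\<close> and hence \<open>M 1\<close>
  annihilate.\<close>

lemma alternating_at_chain:
  assumes v: "(N 1 ^^ m) v = 0" "(N 1 ^^ (m - 1)) v \<noteq> 0" and k: "0 < k" "m \<noteq> k"
  shows "alternating_at k (chain 1 v m)"
  unfolding alternating_at_def
proof (intro ballI impI)
  fix x assume x: "x \<in> chain 1 v m" and x0: "(N 1 ^^ k) x = 0"
  show "f x ((N 1 ^^ (k - 1)) x) = 0"
  proof (cases "m < k")
    case True
    have "chain 1 v m \<subseteq> {x. (N 1 ^^ m) x = 0}"
      by (rule chain_subset[OF inv_ker[OF opr_pow[OF opr_N]]]) (simp add: v)
    then have "(N 1 ^^ m) x = 0" using x by blast
    then have "(N 1 ^^ (k - 1)) x = 0" by (rule N_pow_mono) (use True in simp)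
    then show ?thesis by simp
  next
    case False
    then have mk: "k < m" using k by simp
    define R where "R = range (N 1 ^^ (m - k))"
    have R: "inv_sub R"
    proof (rule subset_\<sigma>_imp_inv)
      note linN = lin_pow[OF opr_N, of "m - k" 1]
      show "subspace R"
        unfolding subspace_def R_def
        by (auto simp: lin_add[OF linN, symmetric] lin_scale[OF linN, symmetric]
            intro: range_eqI[of _ _ 0] simp: lin_0[OF linN])
      show "\<sigma> y \<in> R" if yR: "y \<in> R" for y
      proof -
        obtain z where "y = (N 1 ^^ (m - k)) z" using yR unfolding R_def by blast
        then have "\<sigma> y = (N 1 ^^ (m - k)) (\<sigma> z)" by (simp add: opr_\<sigma>'[OF opr_pow[OF opr_N]])
        then show ?thesis by (simp add: R_def)
      qed
    qed
    have "x \<in> chain 1 ((N 1 ^^ (m - k)) v) k"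
      using chain_ker(1)[OF v less_imp_le[OF mk]] x x0 by blast
    moreover have "chain 1 ((N 1 ^^ (m - k)) v) k \<subseteq> R"
      by (rule chain_subset[OF R]) (simp add: R_def)
    ultimately obtain y where y: "x = (N 1 ^^ (m - k)) y" unfolding R_def by blast
    define z where "z = (N 1 ^^ (k - 1)) x"
    have "N 1 z = (N 1 ^^ Suc (k - 1)) x" by (simp add: z_def)
    then have "N 1 z = 0" using x0 k by simp
    then have "M 1 z = 0" using M_pow_eq_0[of 1 1 z] by simp
    then have "(M 1 ^^ (m - k)) z = 0" using M_pow_mono[of 1 1 z "m - k"] mk by simp
    then show ?thesis using y f_N_pow[of "m - k" 1 y z] by (simp add: z_def)
  qed
qed

text \<open>A hyperbolic block is a sum of two isotropic chains; its mixed terms are equal by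
  \<open>top_symmetric\<close> and cancel in characteristic 2. The remaining blocks are of type B
  with a size other than \<open>k\<close>.\<close>

lemma alternating_at_block:
  assumes two: "(2::'a) = 0" and b: "block s us" and k: "0 < k" and s: "s \<noteq> Summand_B k"
  shows "alternating_at k (span (set us))"
  using b
proof (cases rule: block_cases)
  case (single m a v)
  then have "s = Summand_B m" using two by simp
  then have "a = 1" "m \<noteq> k" using single(1) s by auto
  then show ?thesis using alternating_at_chain[of m v k] single k by simp
next
  case (double m c)
  obtain v w where v: "(N c ^^ m) v = 0" and w: "(N (inverse c) ^^ m) w = 0"
    and iso: "\<forall>x\<in>chain c v m. \<forall>y\<in>chain c v m. f x y = 0"
      "\<forall>x\<in>chain (inverse c) w m. \<forall>y\<in>chain (inverse c) w m. f x y = 0"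
    and d: "chain c v m \<inter> chain (inverse c) w m \<subseteq> {0}"
      "span (set us) = {x + y |x y. x \<in> chain c v m \<and> y \<in> chain (inverse c) w m}"
    using hyperbolic_block[OF b double(3,2)] by blast
  have E: "inv_sub (chain c v m)" and D: "inv_sub (chain (inverse c) w m)"
    using inv_chain v w by blast+
  have m1: "(-1::'a) = 1" using two by (metis add_eq_0_iff one_add_one)
  have dbl: "c + c = 0" for c :: 'a using two by (metis mult_2 mult_zero_left)
  show ?thesis unfolding d(2)
  proof (rule alternating_at_sum[OF E _ D _ d(1)])
    show "alternating_at k (chain c v m)" "alternating_at k (chain (inverse c) w m)"
      using iso inv_N_pow[OF E] inv_N_pow[OF D] by (auto simp: alternating_at_def)
    fix x y assume "(N 1 ^^ k) x = 0"
    then show "f x ((N 1 ^^ (k - 1)) y) + f y ((N 1 ^^ (k - 1)) x) = 0"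
      using top_symmetric[of 1 k x y] k dbl unfolding m1 by simp
  qed
qed

lemma alternating_at_total:
  assumes two: "(2::'a) = 0" and k: "0 < k"
  shows "orth_blocks ps \<Longrightarrow> Summand_B k \<notin> set (map fst ps) \<Longrightarrow> alternating_at k (total ps)"
proof (induction ps)
  case Nil then show ?case by (simp add: alternating_at_def)
next
  case (Cons p ps)
  have b: "block (fst p) (snd p)" using Cons.prems by (simp add: orth_blocks_Cons)
  have o: "f x y = 0" "f y x = 0" if "x \<in> span (set (snd p))" "y \<in> total ps" for x y
    using that Cons.prems by (simp_all add: orth_blocks_Cons)
  have U: "inv_sub (span (set (snd p)))" using b by (simp add: block_def)
  have W: "inv_sub (total ps)" using Cons.prems by (simp add: inv_total orth_blocks_Cons)
  show ?case unfolding total_Cons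
  proof (rule alternating_at_sum[OF U _ W])
    show "alternating_at k (span (set (snd p)))"
      using Cons.prems by (intro alternating_at_block[OF two b k]) auto
    show "alternating_at k (total ps)" using Cons by (simp add: orth_blocks_Cons)
    show "span (set (snd p)) \<inter> total ps \<subseteq> {0}"
      using o by (intro orth_Int block_gram(2)[OF b]) auto
    show "f x ((N 1 ^^ (k - 1)) y) + f y ((N 1 ^^ (k - 1)) x) = 0"
      if "x \<in> span (set (snd p))" "y \<in> total ps" for x y
      using that o inv_N_pow[OF U] inv_N_pow[OF W] by simp
  qed
qed

text \<open>The right-hand side sees only the total space, so the sizes \<open>k\<close> of the B
  summands that occur are the same in any two decompositions.\<close>

lemma Summand_B_iff:
  assumes two: "(2::'a) = 0" and ps: "orth_blocks ps" and k: "0 < k"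
  shows "Summand_B k \<in> set (map fst ps) \<longleftrightarrow> \<not> alternating_at k (total ps)"
proof
  assume "Summand_B k \<in> set (map fst ps)"
  then obtain us where us: "(Summand_B k, us) \<in> set ps" by auto
  then have "block (Summand_B k) us" using ps by (auto simp: orth_blocks_def)
  then obtain v where v: "v \<in> span (set us)" "(N 1 ^^ k) v = 0" "f v ((N 1 ^^ (k - 1)) v) = 1"
    by (cases rule: block_cases) auto
  have "span (set us) \<subseteq> total ps" unfolding total_def using us by (intro span_mono) auto
  then show "\<not> alternating_at k (total ps)" using v by (auto simp: alternating_at_def)
next
  assume "\<not> alternating_at k (total ps)"
  then show "Summand_B k \<in> set (map fst ps)" using alternating_at_total[OF two k ps] by blast
qed

text \<open>The two chains exchange roles in \<open>hyperbolic_piece\<close>. Adjointness and the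
  eigenvalue of the top vector show that the reversed pairing is again non-zero.\<close>

lemma block_interchange:
  assumes b: "block s us" and st: "interchangeable s t"
  shows "\<exists>ws. block t ws \<and> span (set ws) = span (set us)"
proof (cases "s = t")
  case True then show ?thesis using b by blast
next
  case False
  then obtain k a where s: "s = Summand_G k a" and t: "t = Summand_G k (inverse a)"
    using st by (auto simp: interchangeable_def)
  define m where "m = k div 2"
  have g: "gram_matrix f us = hyperbolic_jordan m a" and a: "a \<noteq> 0" "a\<^sup>2 \<noteq> 1" and adm: "admissible_summand s"
    using b s by (auto simp: block_def m_def)
  have ia: "inverse a \<noteq> 0" using a by simp
  have len: "length us = 2 * m" using gram_length[OF g] by simp
  have m: "0 < m" using block_length[OF b] len by simp
  obtain v w where v: "(N a ^^ m) v = 0" "(N a ^^ (m - 1)) v \<noteq> 0"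
    and w: "(N (inverse a) ^^ m) w = 0"
    and iso: "\<forall>x\<in>chain a v m. \<forall>y\<in>chain a v m. f x y = 0"
      "\<forall>x\<in>chain (inverse a) w m. \<forall>y\<in>chain (inverse a) w m. f x y = 0"
    and U: "span (set us) = {x + y |x y. x \<in> chain a v m \<and> y \<in> chain (inverse a) w m}"
    and wv: "f w ((N a ^^ (m - 1)) v) = 1"
    using hyperbolic_block[OF b g a(1)] by blast
  have E: "inv_sub (chain a v m)" and D: "inv_sub (chain (inverse a) w m)"
    using inv_chain v w by blast+
  define z where "z = (N a ^^ (m - 1)) v"
  have \<sigma>z: "\<sigma> z = a *s z" unfolding z_def by (rule top_eigen[OF v(1) m])
  have \<tau>z: "(\<tau> ^^ n) z = inverse a ^ n *s z" for n
    by (rule pow_eigen[OF lin_\<tau> eigen_\<tau>[OF \<sigma>z a(1)]])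
  have "f v ((N (inverse a) ^^ (m - 1)) w) = f ((M (inverse a) ^^ (m - 1)) v) w" by (simp add: f_M_pow)
  also have "\<dots> = (- inverse a) ^ (m - 1) * inverse a ^ (m - 1) * f z w"
    unfolding M_pow_conv_N[OF ia] inverse_inverse_eq z_def[symmetric] \<tau>z f_scale_left by simp
  also have "f z w = a * f w z" by (simp add: f_swap[of z] \<sigma>z f_simps)
  finally have vw: "f v ((N (inverse a) ^^ (m - 1)) w) \<noteq> 0" using a wv by (simp add: z_def)
  have "(M (inverse a) ^^ m) v = 0" using M_pow_eq_0[OF ia] v(1) by simp
  then obtain ws where ws: "set ws \<subseteq> chain (inverse a) w m \<union> chain a v m"
    "gram_matrix f ws = hyperbolic_jordan m (inverse a)" "inv_sub (span (set ws))"
    using hyperbolic_piece[OF ia m D E _ _ chain_mem[OF m] chain_mem[OF m] w _ vw] iso by blast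
  have bt: "block t ws"
    using ws adm unfolding block_def t s by (auto simp: m_def power_inverse)
  have "chain a v m \<subseteq> span (set us)" "chain (inverse a) w m \<subseteq> span (set us)"
  proof -
    have "x + 0 \<in> span (set us)" if "x \<in> chain a v m" for x unfolding U using that inv_0[OF D] by blast
    then show "chain a v m \<subseteq> span (set us)" by auto
    have "0 + x \<in> span (set us)" if "x \<in> chain (inverse a) w m" for x unfolding U using that inv_0[OF E] by blast
    then show "chain (inverse a) w m \<subseteq> span (set us)" by auto
  qed
  then have "set ws \<subseteq> span (set us)" using ws(1) by blast
  moreover have "length us = length ws" using gram_length[OF ws(2)] len by simp
  ultimately have "span (set ws) = span (set us)"
    by (intro indep_list_span_eq[OF block_gram(1)[OF bt]]) simp_all
  then show ?thesis using bt by blast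
qed

lemma orth_blocks_replace:
  "list_all2 (\<lambda>p q. block (fst q) (snd q) \<and> span (set (snd q)) = span (set (snd p))) ps qs \<Longrightarrow>
    orth_blocks ps \<Longrightarrow> orth_blocks qs \<and> total qs = total ps"
proof (induction ps qs rule: list_all2_induct)
  case Nil then show ?case by simp
next
  case (Cons p ps q qs)
  then have "orth_blocks qs \<and> total qs = total ps" by (simp add: orth_blocks_Cons)
  then show ?case using Cons by (simp add: orth_blocks_Cons total_Cons)
qed

text \<open>Unfolding \<open>rel_mset\<close> gives a permutation, a pointwise exchange by
  \<open>block_interchange\<close> and a second permutation. The spans do not change, so
  orthogonality persists.\<close>

lemma orth_blocks_interchange:
  assumes ps: "orth_blocks ps" and r: "rel_mset interchangeable (mset (map fst ps)) (mset ss)"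
  shows "\<exists>qs. orth_blocks qs \<and> total qs = total ps \<and> map fst qs = ss"
proof -
  have perm: "\<exists>qs. mset qs = mset ps \<and> map fst qs = xs" if "mset (map fst ps) = mset xs"
    for ps :: "('a summand \<times> 'v list) list" and xs
    using that
  proof (induction xs arbitrary: ps)
    case (Cons x xs)
    then have "x \<in> set (map fst ps)" by (metis list.set_intros(1) set_mset_mset)
    then obtain p where p: "p \<in> set ps" "fst p = x" by auto
    have "mset (map fst (remove1 p ps)) = mset xs"
      using Cons.prems p by (simp add: image_mset_Diff)
    then obtain qs where "mset qs = mset (remove1 p ps)" "map fst qs = xs" using Cons.IH by blast
    then show ?case using p by (intro exI[of _ "p # qs"]) simp
  qed simp
  obtain xs ys where xy: "mset xs = mset (map fst ps)" "mset ys = mset ss" "list_all2 interchangeable xs ys"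
    using r unfolding rel_mset_def by blast
  obtain qs where qs: "mset qs = mset ps" "map fst qs = xs" using perm[of ps xs] xy(1) by auto
  have oq: "orth_blocks qs" "total qs = total ps"
    using orth_blocks_mset[OF qs(1)[symmetric] ps] total_mset[OF qs(1)] by auto
  have rep: "\<exists>rs. list_all2 (\<lambda>p q. block (fst q) (snd q) \<and> span (set (snd q)) = span (set (snd p))) qs rs \<and>
      map fst rs = ys" if "list_all2 interchangeable (map fst qs) ys" "\<forall>p\<in>set qs. block (fst p) (snd p)"
    for qs ys
    using that
  proof (induction qs arbitrary: ys)
    case (Cons p qs)
    then obtain y ys' where ys: "ys = y # ys'" "interchangeable (fst p) y" "list_all2 interchangeable (map fst qs) ys'"
      by (auto simp: list_all2_Cons1)
    obtain ws where ws: "block y ws" "span (set ws) = span (set (snd p))"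
      using block_interchange[of "fst p" "snd p" y] ys(2) Cons.prems(2) by auto
    obtain rs where rs: "list_all2 (\<lambda>p q. block (fst q) (snd q) \<and> span (set (snd q)) = span (set (snd p))) qs rs"
      "map fst rs = ys'" using Cons.IH[OF ys(3)] Cons.prems by auto
    show ?case by (intro exI[of _ "(y, ws) # rs"]) (use ws rs ys in simp)
  qed simp
  have "\<forall>p\<in>set qs. block (fst p) (snd p)" using oq(1) by (simp add: orth_blocks_def)
  then obtain rs where rs: "list_all2 (\<lambda>p q. block (fst q) (snd q) \<and> span (set (snd q)) = span (set (snd p))) qs rs"
    "map fst rs = ys" using rep[of qs ys] xy(3) qs(2) by auto
  have or: "orth_blocks rs" "total rs = total ps" using orth_blocks_replace[OF rs(1) oq(1)] oq(2) by auto
  obtain ts where ts: "mset ts = mset rs" "map fst ts = ss" using perm[of rs ss] rs(2) xy(2) by auto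
  then show ?thesis
    using orth_blocks_mset[OF ts(1)[symmetric] or(1)] total_mset[OF ts(1)] or(2) by auto
qed

end

subsection \<open>Counting summands\<close>

lemma interchangeable_refl: "interchangeable s s"
  by (simp add: interchangeable_def)

lemma interchangeable_sym: "interchangeable s t \<Longrightarrow> interchangeable t s"
  by (auto simp: interchangeable_def)

lemma interchangeable_trans: "interchangeable s t \<Longrightarrow> interchangeable t r \<Longrightarrow> interchangeable s r"
  by (auto simp: interchangeable_def)

lemma interchangeable_admissible: "interchangeable s t \<Longrightarrow> admissible_summand s \<Longrightarrow> admissible_summand t"
  by (auto simp: interchangeable_def power_inverse)

lemma one_neq_minus_one: "CHAR('a::field) \<noteq> 2 \<Longrightarrow> (1::'a) \<noteq> -1"
  using two_eq_0_iff[where 'a='a] by (metis add.right_inverse one_add_one)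

lemma inverse_eq_minus_one_iff: "inverse y = (-1::'a::field) \<longleftrightarrow> y = -1"
  by (metis inverse_1 inverse_inverse_eq inverse_minus_eq)

text \<open>Every class other than B and E owns a Jordan block that no other admissible summand has.
  The parity of the size separates A from D at the eigenvalue 1 and C from F at -1; for G the
  eigenvalue squares to something other than 1. The multiplicity \<open>c\<close> is 2 for D and F,
  and 1 otherwise.\<close>

lemma jordan_blocks_determine:
  fixes t :: "'a::field summand"
  assumes t: "admissible_summand t" "\<forall>k. t \<noteq> Summand_B k \<and> t \<noteq> Summand_E k"
  shows "\<exists>k a c. 0 < k \<and> 0 < c \<and> (\<forall>s. admissible_summand s \<longrightarrow>
    count_list (jordan_blocks s) (k, a) = (if interchangeable t s then c else 0))"
proof -
  note neq = one_neq_minus_one[where 'a='a]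
  show ?thesis
  proof (cases t)
    case (Summand_A k)
    have "count_list (jordan_blocks s) (k, 1) = (if interchangeable t s then 1 else 0)"
      if "admissible_summand s" for s
      using t that neq unfolding Summand_A by (cases s) (auto simp: interchangeable_def)
    then show ?thesis using t Summand_A by (intro exI[of _ k] exI[of _ 1]) auto
  next
    case (Summand_C k)
    have "count_list (jordan_blocks s) (k, -1) = (if interchangeable t s then 1 else 0)"
      if "admissible_summand s" for s
      using t that neq neq[symmetric] unfolding Summand_C
      by (cases s) (auto simp: interchangeable_def inverse_eq_minus_one_iff power2_eq_1_iff)
    then show ?thesis using t Summand_C by (intro exI[of _ k] exI[of _ "-1"] exI[of _ 1]) auto
  next
    case (Summand_D k)
    then obtain m where m: "k = 2 * m" "even m" "0 < m" using t by auto
    have "count_list (jordan_blocks s) (m, 1) = (if interchangeable t s then 2 else 0)"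
      if "admissible_summand s" for s
      using that neq m unfolding Summand_D by (cases s) (auto simp: interchangeable_def)
    then show ?thesis using m by (intro exI[of _ m] exI[of _ 1] exI[of _ 2]) auto
  next
    case (Summand_F k)
    then obtain m where m: "k = 2 * m" "odd m" "0 < m" "CHAR('a) \<noteq> 2" using t by auto
    have "count_list (jordan_blocks s) (m, -1) = (if interchangeable t s then 2 else 0)"
      if "admissible_summand s" for s
      using that neq neq[symmetric] m unfolding Summand_F
      by (cases s) (auto simp: interchangeable_def inverse_eq_minus_one_iff power2_eq_1_iff)
    then show ?thesis using m by (intro exI[of _ m] exI[of _ "-1"] exI[of _ 2]) auto
  next
    case (Summand_G k x)
    then obtain m where m: "k = 2 * m" "0 < m" "x \<noteq> 0" "x\<^sup>2 \<noteq> 1" using t by auto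
    have x: "x \<noteq> 1" "x \<noteq> -1" using m(4) by (auto simp: power2_eq_1_iff)
    have x': "x \<noteq> inverse x" using m(3,4) by (metis power2_eq_square right_inverse)
    have "count_list (jordan_blocks s) (m, x) = (if interchangeable t s then 1 else 0)"
      if s: "admissible_summand s" for s
    proof (cases s)
      case s': (Summand_G k' y)
      have "inverse y = x \<longleftrightarrow> y = inverse x" by auto
      then show ?thesis using s x x' m unfolding s' Summand_G by (auto simp: interchangeable_def)
    qed (use x s in \<open>auto simp: interchangeable_def Summand_G\<close>)
    then show ?thesis using m by (intro exI[of _ m] exI[of _ x] exI[of _ 1]) auto
  qed (use t in auto)
qed

lemma count_concat_jordan_blocks:
  assumes "\<forall>s\<in>set ss. count_list (jordan_blocks s) b = (if P s then c else 0)"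
  shows "count_list (concat (map jordan_blocks ss)) b = c * length (filter P ss)"
  using assms by (induction ss) auto

text \<open>\<open>Summand_B l\<close> and \<open>Summand_E (2 * l)\<close> share the Jordan block
  \<open>(l, 1)\<close>. By \<open>B\<close> and \<open>BE\<close> at most one of the two occurs,
  and it is the same one in both lists, so counting \<open>(l, 1)\<close> still determines its
  multiplicity.\<close>

lemma summand_counts_eq:
  fixes ss ss' :: "'a::field summand list"
  assumes adm: "\<forall>s\<in>set ss. admissible_summand s" "\<forall>s\<in>set ss'. admissible_summand s"
    and J: "\<And>k a. 0 < k \<Longrightarrow> count_list (concat (map jordan_blocks ss)) (k, a) =
      count_list (concat (map jordan_blocks ss')) (k, a)"
    and B: "\<And>k. CHAR('a) = 2 \<Longrightarrow> 0 < k \<Longrightarrow> Summand_B k \<in> set ss \<longleftrightarrow> Summand_B k \<in> set ss'"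
    and BE: "CHAR('a) = 2 \<longrightarrow> \<not> (\<exists>l. odd l \<and> Summand_B l \<in> set ss \<and> Summand_E (2 * l) \<in> set ss)"
      "CHAR('a) = 2 \<longrightarrow> \<not> (\<exists>l. odd l \<and> Summand_B l \<in> set ss' \<and> Summand_E (2 * l) \<in> set ss')"
  shows "length (filter (interchangeable t) ss) = length (filter (interchangeable t) ss')"
proof -
  have key: ?thesis if k: "0 < k" and c: "0 < c"
    and h: "\<forall>s\<in>set ss. count_list (jordan_blocks s) (k, a) = (if interchangeable t s then c else 0)"
      "\<forall>s\<in>set ss'. count_list (jordan_blocks s) (k, a) = (if interchangeable t s then c else 0)" for k a c
    using J[OF k, of a] c unfolding count_concat_jordan_blocks[OF h(1)] count_concat_jordan_blocks[OF h(2)] by simp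
  have none: ?thesis if "\<forall>s\<in>set ss. \<not> interchangeable t s" "\<forall>s\<in>set ss'. \<not> interchangeable t s"
    using that by (simp add: filter_False)
  show ?thesis
  proof (cases "admissible_summand t")
    case False
    then have "\<not> interchangeable t s" if "admissible_summand s" for s
      using that interchangeable_admissible interchangeable_sym by blast
    then show ?thesis using none adm by blast
  next
    case True
    consider k where "t = Summand_B k" | k where "t = Summand_E k" | "\<forall>k. t \<noteq> Summand_B k \<and> t \<noteq> Summand_E k" by blast
    then show ?thesis
    proof cases
      case (1 k)
      then have k: "0 < k" "odd k" "CHAR('a) = 2" using True by auto
      have it: "interchangeable t s \<longleftrightarrow> s = Summand_B k" for s using 1 by (auto simp: interchangeable_def)
      show ?thesis
      proof (cases "Summand_B k \<in> set ss")
        case False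
        then have "Summand_B k \<notin> set ss'" using B[OF k(3,1)] by blast
        then show ?thesis using False by (intro none) (auto simp: it)
      next
        case True
        have cnt: "count_list (jordan_blocks s) (k, 1) = (if interchangeable t s then 1 else 0)"
          if "admissible_summand s" "s \<noteq> Summand_E (2 * k)" for s
          using that k unfolding it by (cases s) auto
        have E: "Summand_E (2 * k) \<notin> set ss" "Summand_E (2 * k) \<notin> set ss'"
          using True B[OF k(3,1)] BE k by blast+
        show ?thesis
        proof (rule key[of k 1 1])
          show "\<forall>s\<in>set ss. count_list (jordan_blocks s) (k, 1) = (if interchangeable t s then 1 else 0)"
            "\<forall>s\<in>set ss'. count_list (jordan_blocks s) (k, 1) = (if interchangeable t s then 1 else 0)"
            using cnt adm E by metis+
        qed (use k in simp_all)
      qed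
    next
      case (2 k)
      then obtain m where m: "k = 2 * m" "odd m" "0 < m" "CHAR('a) = 2" using True by auto
      have it: "interchangeable t s \<longleftrightarrow> s = Summand_E (2 * m)" for s using 2 m by (auto simp: interchangeable_def)
      show ?thesis
      proof (cases "Summand_B m \<in> set ss")
        case True
        then have "Summand_E (2 * m) \<notin> set ss" "Summand_E (2 * m) \<notin> set ss'"
          using B[OF m(4,3)] BE m by blast+
        then show ?thesis by (intro none) (auto simp: it)
      next
        case False
        have cnt: "count_list (jordan_blocks s) (m, 1) = (if interchangeable t s then 2 else 0)"
          if "admissible_summand s" "s \<noteq> Summand_B m" for s
          using that m unfolding it by (cases s) auto
        have E: "Summand_B m \<notin> set ss" "Summand_B m \<notin> set ss'"
          using False B[OF m(4,3)] by blast+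
        show ?thesis
        proof (rule key[of m 2 1])
          show "\<forall>s\<in>set ss. count_list (jordan_blocks s) (m, 1) = (if interchangeable t s then 2 else 0)"
            "\<forall>s\<in>set ss'. count_list (jordan_blocks s) (m, 1) = (if interchangeable t s then 2 else 0)"
            using cnt adm E by metis+
        qed (use m in simp_all)
      qed
    next
      case 3
      then show ?thesis using jordan_blocks_determine[OF True] key adm by blast
    qed
  qed
qed

text \<open>\<open>interchangeable\<close> is an equivalence relation; mapping every summand to its
  class turns the claim into an equality of multisets.\<close>

lemma rel_mset_interchangeableI:
  fixes ss ss' :: "'a::field summand list"
  assumes "\<And>t. length (filter (interchangeable t) ss) = length (filter (interchangeable t) ss')"
  shows "rel_mset interchangeable (mset ss) (mset ss')"
proof -
  define cls where "cls = (\<lambda>s :: 'a summand. Collect (interchangeable s))"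
  have cls: "cls s = cls t \<longleftrightarrow> interchangeable t s" for s t
    unfolding cls_def using interchangeable_refl interchangeable_sym interchangeable_trans by blast
  have "image_mset cls (mset ss) = image_mset cls (mset ss')"
  proof (rule multiset_eqI)
    fix C
    have c: "count (image_mset cls (mset xs)) C = length (filter (\<lambda>s. cls s = C) xs)" for xs
      by (induction xs) auto
    show "count (image_mset cls (mset ss)) C = count (image_mset cls (mset ss')) C"
    proof (cases "\<exists>t. C = cls t")
      case True
      then obtain t where "C = cls t" by blast
      then show ?thesis unfolding c using assms[of t] by (simp add: cls)
    next
      case False
      then have "filter (\<lambda>s. cls s = C) xs = []" for xs by (auto simp: filter_empty_conv)
      then show ?thesis unfolding c by simp
    qed
  qed
  then have "rel_mset (=) (image_mset cls (mset ss)) (image_mset cls (mset ss'))"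
    by (simp add: multiset.rel_eq)
  then have "rel_mset (\<lambda>s t. cls s = cls t) (mset ss) (mset ss')"
    by (simp add: multiset.rel_map)
  then show ?thesis by (rule multiset.rel_mono_strong) (simp add: cls interchangeable_sym)
qed

lemma interchangeable_Summand_B [simp]: "interchangeable s (Summand_B k) \<longleftrightarrow> s = Summand_B k"
  and interchangeable_Summand_E [simp]: "interchangeable s (Summand_E k) \<longleftrightarrow> s = Summand_E k"
  by (auto simp: interchangeable_def)

lemma rel_mset_ex:
  assumes "rel_mset R (mset xs) (mset ys)" "y \<in> set ys" shows "\<exists>x\<in>set xs. R x y"
proof -
  obtain as bs where "mset as = mset xs" "mset bs = mset ys" "list_all2 R as bs"
    using assms(1) unfolding rel_mset_def by blast
  moreover then have "set as = set xs" "set bs = set ys" by (metis set_mset_mset)+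
  ultimately show ?thesis using assms(2) by (metis in_set_conv_nth list_all2_conv_all_nth)
qed

subsection \<open>Gram matrices of decompositions\<close>

lemma summand_mat_square: "dim_row (summand_mat s) = dim_col (summand_mat s)"
  by (cases s) simp_all

context form_space
begin

lemma gram_append:
  assumes "orth us ws"
  shows "gram_matrix f (us @ ws) = four_block_mat (gram_matrix f us) (0\<^sub>m (length us) (length ws))
    (0\<^sub>m (length ws) (length us)) (gram_matrix f ws)"
proof (rule eq_matI)
  fix i j
  assume "i < dim_row (four_block_mat (gram_matrix f us) (0\<^sub>m (length us) (length ws))
      (0\<^sub>m (length ws) (length us)) (gram_matrix f ws))"
    "j < dim_col (four_block_mat (gram_matrix f us) (0\<^sub>m (length us) (length ws))
      (0\<^sub>m (length ws) (length us)) (gram_matrix f ws))"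
  then have ij: "i < length us + length ws" "j < length us + length ws" by (simp_all add: gram_matrix_def)
  have "f (us ! i) (ws ! (j - length us)) = 0" if "i < length us" "\<not> j < length us"
    using assms that ij by (simp add: orth_def)
  moreover have "f (ws ! (i - length us)) (us ! j) = 0" if "\<not> i < length us" "j < length us"
    using assms that ij by (simp add: orth_def)
  ultimately show "gram_matrix f (us @ ws) $$ (i, j) =
      four_block_mat (gram_matrix f us) (0\<^sub>m (length us) (length ws))
        (0\<^sub>m (length ws) (length us)) (gram_matrix f ws) $$ (i, j)"
    using ij by (auto simp: gram_matrix_def nth_append)
qed (simp_all add: gram_matrix_def)

lemma gram_concat:
  "sorted_wrt orth uss \<Longrightarrow> gram_matrix f (concat uss) = diag_block_mat (map (gram_matrix f) uss)"
proof (induction uss)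
  case Nil then show ?case by (auto simp: gram_matrix_def)
next
  case (Cons us uss)
  have "orth us (concat uss)" using Cons.prems by (auto simp: orth_def)
  then show ?case
    using gram_append[of us "concat uss"] Cons by (simp add: Let_def gram_matrix_def[of f us] flip: Cons.IH)
      (simp add: gram_matrix_def)
qed

lemma gram_split:
  assumes "gram_matrix f vs = diag_block_mat As" "\<forall>A\<in>set As. dim_row A = dim_col A"
  shows "\<exists>uss. concat uss = vs \<and> map (gram_matrix f) uss = As \<and> sorted_wrt orth uss"
  using assms
proof (induction As arbitrary: vs)
  case Nil
  then have "length vs = 0" using gram_length[OF Nil.prems(1)] by simp
  then show ?case by (intro exI[of _ "[]"]) simp
next
  case (Cons A As)
  define D where "D = diag_block_mat As"
  have D: "dim_row D = dim_col D"
    unfolding D_def dim_diag_block_mat using Cons.prems(2) by (intro arg_cong[of _ _ sum_list] map_cong) auto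
  define n where "n = dim_row A"
  have A: "dim_col A = n" using Cons.prems(2) by (simp add: n_def)
  have g: "gram_matrix f vs = four_block_mat A (0\<^sub>m n (dim_row D)) (0\<^sub>m (dim_row D) n) D"
    unfolding Cons.prems(1) diag_block_mat.simps Let_def D_def[symmetric] A D[symmetric] n_def[symmetric] ..
  have len: "length vs = n + dim_row D" using gram_length[OF g] by (simp add: n_def)
  have e: "f (vs ! i) (vs ! j) = (if i < n then if j < n then A $$ (i, j) else 0
      else if j < n then 0 else D $$ (i - n, j - n))" if "i < length vs" "j < length vs" for i j
    using gram_nth[OF g that] that len D A by (auto simp: n_def[symmetric])
  define us ws where "us = take n vs" and "ws = drop n vs"
  have l: "length us = n" "length ws = dim_row D" using len by (simp_all add: us_def ws_def)
  have "gram_matrix f us = A"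
    by (rule eq_matI) (use e l len A in \<open>auto simp: gram_matrix_def us_def n_def[symmetric]\<close>)
  moreover have "gram_matrix f ws = D"
    by (rule eq_matI) (use e l len D in \<open>auto simp: gram_matrix_def ws_def\<close>)
  then obtain uss where uss: "concat uss = ws" "map (gram_matrix f) uss = As" "sorted_wrt orth uss"
    using Cons.IH[of ws] Cons.prems(2) by (auto simp: D_def)
  moreover have "orth us w" if "w \<in> set uss" for w
    unfolding orth_def
  proof (intro ballI)
    fix x y assume "x \<in> set us" "y \<in> set w"
    then have "x \<in> set us" "y \<in> set ws" using that uss(1) by auto
    then obtain i j where "i < n" "x = vs ! i" "j < dim_row D" "y = vs ! (n + j)"
      using l len by (auto simp: in_set_conv_nth us_def ws_def)
    then show "f x y = 0 \<and> f y x = 0" using e len by simp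
  qed
  moreover have "us @ ws = vs" by (simp add: us_def ws_def)
  ultimately show ?case by (intro exI[of _ "us # uss"]) simp
qed

text \<open>The part of \<open>\<sigma> x\<close> outside the summand is orthogonal to the summand
  by projection, and to the others because \<open>f p (\<sigma> x) = f x p\<close>; so it vanishes
  by non-degeneracy.\<close>

lemma orth_decomposition_inv:
  assumes o: "sorted_wrt orth uss" and tot: "span (\<Union>us\<in>set uss. set us) = UNIV"
    and us: "us \<in> set uss" and nd: "nondeg_on (span (set us))"
  shows "inv_sub (span (set us))"
proof (rule subset_\<sigma>_imp_inv)
  fix x assume x: "x \<in> span (set us)"
  have oo: "orth ws us" if ws: "ws \<in> set uss" "ws \<noteq> us" for ws
  proof -
    obtain i j where "i < length uss" "j < length uss" "uss ! i = us" "uss ! j = ws"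
      using us ws(1) by (metis in_set_conv_nth)
    then show ?thesis using o ws(2) orth_sym
      by (cases i j rule: linorder_cases) (auto simp: sorted_wrt_iff_nth_less)
  qed
  obtain u where u: "u \<in> span (set us)" "\<sigma> x - u \<in> perp (span (set us))"
    using perp_decomp[OF _ nd] by (metis subspace_span)
  have "f y (\<sigma> x - u) = 0" for y
  proof (rule f_span_zero[of y "\<Union>us\<in>set uss. set us" _ "{\<sigma> x - u}"])
    show "y \<in> span (\<Union>us\<in>set uss. set us)" using tot by simp
    show "\<sigma> x - u \<in> span {\<sigma> x - u}" by (simp add: span_base)
    fix p q assume "p \<in> (\<Union>us\<in>set uss. set us)" "q \<in> {\<sigma> x - u}"
    then obtain ws where p: "p \<in> set ws" "ws \<in> set uss" and q: "q = \<sigma> x - u" by auto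
    show "f p q = 0"
    proof (cases "ws = us")
      case True
      then show ?thesis using u(2) p q by (simp add: perp_def span_base)
    next
      case False
      have "f x p = 0" "f p u = 0"
        using orth_span[OF oo[OF p(2) False] span_base[OF p(1)]] x u(1) by auto
      then show ?thesis by (simp add: q f_simps flip: f_swap)
    qed
  qed
  then have "\<sigma> x - u = 0" by (rule nondeg)
  then show "\<sigma> x \<in> span (set us)" using u by simp
qed simp

text \<open>The bridge between Gram matrices and orthogonal blocks. From left to right
  \<open>orth_decomposition_inv\<close> adds the invariance; conversely the concatenated lists form
  a basis because they span and their number is the dimension.\<close>

lemma canonical_decomposition_iff:
  "canonical_decomposition scale f ss \<longleftrightarrow>
    (CHAR('a) = 2 \<longrightarrow> \<not> (\<exists>l. odd l \<and> Summand_B l \<in> set ss \<and> Summand_E (2 * l) \<in> set ss)) \<and>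
    (\<exists>ps. orth_blocks ps \<and> total ps = UNIV \<and> map fst ps = ss)"
proof
  assume c: "canonical_decomposition scale f ss"
  then obtain vs where vs: "ordered_basis scale vs"
    "gram_matrix f vs = diag_block_mat (map summand_mat ss)"
    by (auto simp: canonical_decomposition_def)
  obtain uss where uss: "concat uss = vs" "map (gram_matrix f) uss = map summand_mat ss" "sorted_wrt orth uss"
    using gram_split[OF vs(2)] summand_mat_square by auto
  have l: "length uss = length ss" using uss(2) by (metis length_map)
  define ps where "ps = zip ss uss"
  have map_ps: "map fst ps = ss" "map snd ps = uss" using l by (simp_all add: ps_def)
  have set_ps: "(\<Union>p\<in>set ps. set (snd p)) = (\<Union>us\<in>set uss. set us)"
    unfolding map_ps(2)[symmetric] by auto
  have tot: "span (\<Union>us\<in>set uss. set us) = UNIV"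
    using vs(1) uss(1) by (auto simp: ordered_basis_def)
  have "block (fst p) (snd p)" if p: "p \<in> set ps" for p
  proof -
    have "fst p \<in> set ss" "snd p \<in> set uss" using p map_ps by (metis image_eqI set_map)+
    moreover have "gram_matrix f (snd p) = summand_mat (fst p)"
      using p uss(2) l unfolding ps_def in_set_zip by (metis nth_map)
    ultimately show ?thesis
      using c summand_gram orth_decomposition_inv[OF uss(3) tot]
      by (auto simp: block_def canonical_decomposition_def)
  qed
  moreover have "sorted_wrt (\<lambda>p q. orth (snd p) (snd q)) ps"
    using uss(3) unfolding map_ps(2)[symmetric] sorted_wrt_map .
  ultimately have "orth_blocks ps" "total ps = UNIV"
    using tot set_ps by (auto simp: orth_blocks_def total_def)
  then show "(CHAR('a) = 2 \<longrightarrow> \<not> (\<exists>l. odd l \<and> Summand_B l \<in> set ss \<and> Summand_E (2 * l) \<in> set ss)) \<and>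
    (\<exists>ps. orth_blocks ps \<and> total ps = UNIV \<and> map fst ps = ss)"
    using c map_ps(1) by (auto simp: canonical_decomposition_def)
next
  assume a: "(CHAR('a) = 2 \<longrightarrow> \<not> (\<exists>l. odd l \<and> Summand_B l \<in> set ss \<and> Summand_E (2 * l) \<in> set ss)) \<and>
    (\<exists>ps. orth_blocks ps \<and> total ps = UNIV \<and> map fst ps = ss)"
  then obtain ps where ps: "orth_blocks ps" "total ps = UNIV" "map fst ps = ss" by blast
  define vs where "vs = concat (map snd ps)"
  have sp: "span (set vs) = UNIV" using ps(2) by (simp add: total_def vs_def)
  have len: "length vs = dim (UNIV :: 'v set)"
    using dim_total[OF ps(1)] ps(2) by (simp add: vs_def length_concat comp_def)
  have "card (set vs) \<le> dim (UNIV :: 'v set)" using card_length[of vs] len by simp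
  moreover have "dim (UNIV :: 'v set) \<le> card (set vs)" using dim_le_card[of UNIV "set vs"] sp by simp
  ultimately have card: "card (set vs) = dim (UNIV :: 'v set)" by simp
  then have "distinct vs" using len by (simp add: card_distinct)
  moreover have "independent (set vs)"
    using card_eq_dim[of "set vs" UNIV] card sp by simp
  ultimately have "ordered_basis scale vs" using sp by (simp add: ordered_basis_def)
  moreover have "gram_matrix f vs = diag_block_mat (map summand_mat ss)"
  proof -
    have "sorted_wrt orth (map snd ps)" using ps(1) by (simp add: orth_blocks_def sorted_wrt_map)
    then have "gram_matrix f vs = diag_block_mat (map (gram_matrix f) (map snd ps))"
      unfolding vs_def by (rule gram_concat)
    also have "map (gram_matrix f) (map snd ps) = map summand_mat ss"
      using ps(1) unfolding ps(3)[symmetric] by (auto simp: orth_blocks_def block_def)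
    finally show ?thesis .
  qed
  moreover have "\<forall>s\<in>set ss. admissible_summand s"
    using ps(1) unfolding ps(3)[symmetric] by (auto simp: orth_blocks_def block_def)
  ultimately show "canonical_decomposition scale f ss" using a by (auto simp: canonical_decomposition_def)
qed

lemma canonical_decomposition_unique:
  assumes "canonical_decomposition scale f ss" "canonical_decomposition scale f ss'"
  shows "rel_mset interchangeable (mset ss) (mset ss')"
proof -
  obtain ps where ps: "orth_blocks ps" "total ps = UNIV" "map fst ps = ss"
    using assms(1) canonical_decomposition_iff by blast
  obtain qs where qs: "orth_blocks qs" "total qs = UNIV" "map fst qs = ss'"
    using assms(2) canonical_decomposition_iff by blast
  show ?thesis
  proof (rule rel_mset_interchangeableI, rule summand_counts_eq)
    show "\<forall>s\<in>set ss. admissible_summand s" "\<forall>s\<in>set ss'. admissible_summand s"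
      "CHAR('a) = 2 \<longrightarrow> \<not> (\<exists>l. odd l \<and> Summand_B l \<in> set ss \<and> Summand_E (2 * l) \<in> set ss)"
      "CHAR('a) = 2 \<longrightarrow> \<not> (\<exists>l. odd l \<and> Summand_B l \<in> set ss' \<and> Summand_E (2 * l) \<in> set ss')"
      using assms by (simp_all add: canonical_decomposition_def)
    show "count_list (concat (map jordan_blocks ss)) (k, a) =
        count_list (concat (map jordan_blocks ss')) (k, a)" if "0 < k" for k a
      using jordan_blocks_unique[OF ps(1) qs(1) _ that, of a] ps(2,3) qs(2,3) by (auto simp flip: map_map)
    show "Summand_B k \<in> set ss \<longleftrightarrow> Summand_B k \<in> set ss'" if "CHAR('a) = 2" "0 < k" for k
      using Summand_B_iff[OF _ ps(1) that(2)] Summand_B_iff[OF _ qs(1) that(2)] that(1)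
        two_eq_0_iff[where 'a='a] ps(2,3) qs(2,3) by metis
  qed
qed

lemma canonical_decomposition_rel_mset:
  assumes "canonical_decomposition scale f ss" "rel_mset interchangeable (mset ss) (mset ss')"
  shows "canonical_decomposition scale f ss'"
proof -
  obtain ps where ps: "orth_blocks ps" "total ps = UNIV" "map fst ps = ss"
    using assms(1) canonical_decomposition_iff by blast
  obtain qs where qs: "orth_blocks qs" "total qs = total ps" "map fst qs = ss'"
    using orth_blocks_interchange[OF ps(1), of ss'] assms(2) ps(3) by auto
  have "Summand_B l \<in> set ss" if "Summand_B l \<in> set ss'" for l
    using rel_mset_ex[OF assms(2) that] by auto
  moreover have "Summand_E l \<in> set ss" if "Summand_E l \<in> set ss'" for l
    using rel_mset_ex[OF assms(2) that] by auto
  ultimately show ?thesis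
    using assms(1) qs ps(2) unfolding canonical_decomposition_iff by blast
qed

end

subsection \<open>The minimal polynomial of the asymmetry\<close>

context form_space
begin

lemma poly_map_bound:
  assumes "degree p \<le> n" shows "poly_map scale p \<sigma> x = (\<Sum>i\<le>n. coeff p i *s (\<sigma> ^^ i) x)"
  unfolding poly_map_def
  by (rule sum.mono_neutral_left) (use assms in \<open>auto simp: coeff_eq_0\<close>)

lemma poly_map_pCons: "poly_map scale (pCons a p) \<sigma> x = a *s x + \<sigma> (poly_map scale p \<sigma> x)"
proof -
  have "poly_map scale (pCons a p) \<sigma> x = (\<Sum>i\<le>Suc (degree p). coeff (pCons a p) i *s (\<sigma> ^^ i) x)"
    by (rule poly_map_bound) (rule degree_pCons_le)
  also have "\<dots> = a *s x + (\<Sum>i\<le>degree p. coeff p i *s \<sigma> ((\<sigma> ^^ i) x))"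
    by (subst sum.atMost_Suc_shift) simp
  finally show ?thesis by (simp add: poly_map_def lin_sum[OF lin_\<sigma>] \<sigma>_scale)
qed

lemma poly_map_0: "poly_map scale 0 \<sigma> x = 0"
  by (simp add: poly_map_def)

lemma poly_map_add: "poly_map scale (p + q) \<sigma> x = poly_map scale p \<sigma> x + poly_map scale q \<sigma> x"
proof -
  define n where "n = max (degree p) (degree q)"
  have "degree (p + q) \<le> n" "degree p \<le> n" "degree q \<le> n" by (auto simp: n_def degree_add_le_max)
  then show ?thesis
    by (simp add: poly_map_bound[of _ n] scale_left_distrib sum.distrib)
qed

lemma poly_map_smult: "poly_map scale (Polynomial.smult c p) \<sigma> x = c *s poly_map scale p \<sigma> x"
  using poly_map_bound[of "Polynomial.smult c p" "degree p" x]
  by (simp add: degree_smult_le poly_map_def scale_sum_right)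

lemma opr_poly_map: "opr (poly_map scale p \<sigma>)"
proof (induction p)
  case 0
  then show ?case by (simp add: opr_def lin_def poly_map_0 lin_0[OF lin_\<sigma>])
next
  case (pCons a p)
  have "poly_map scale (pCons a p) \<sigma> = (\<lambda>x. a *s x + \<sigma> (poly_map scale p \<sigma> x))"
    by (rule ext) (rule poly_map_pCons)
  then show ?case using opr_add[OF opr_scale[OF opr_id] opr_comp[OF opr_\<sigma> pCons.IH]] by simp
qed

lemma poly_map_mult: "poly_map scale (p * q) \<sigma> x = poly_map scale p \<sigma> (poly_map scale q \<sigma> x)"
proof (induction p)
  case 0 then show ?case by (simp add: poly_map_0)
next
  case (pCons a p)
  then show ?case by (simp add: poly_map_add poly_map_smult poly_map_pCons)
qed

text \<open>It turns the split minimal polynomial into a product of operators \<open>N a\<close>,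
  the only form in which the splitting is used.\<close>

lemma poly_map_linear_factors: "poly_map scale (\<Prod>a\<leftarrow>as. [:- a, 1:]) \<sigma> x = fold N as x"
proof (induction as arbitrary: x)
  case Nil
  have "poly_map scale 1 \<sigma> x = x"
    unfolding one_pCons poly_map_pCons by (simp add: poly_map_0 lin_0[OF lin_\<sigma>])
  then show ?case by simp
next
  case (Cons a as)
  have "poly_map scale [:- a, 1:] \<sigma> y = N a y" for y
    by (simp add: poly_map_pCons poly_map_0 lin_0[OF lin_\<sigma>] N_def \<sigma>_scale)
  then have "poly_map scale (\<Prod>a\<leftarrow>a # as. [:- a, 1:]) \<sigma> x = N a (fold N as x)"
    by (simp only: list.map prod_list.Cons poly_map_mult Cons.IH)
  then show ?case by (simp add: opr_N'[OF opr_fold_N])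
qed

lemma annihilating_poly_vector: "\<exists>p. p \<noteq> 0 \<and> poly_map scale p \<sigma> v = 0"
proof -
  define n where "n = dim (UNIV :: 'v set)"
  define us where "us = map (\<lambda>i. (\<sigma> ^^ i) v) [0..<Suc n]"
  have "\<not> indep_list us"
  proof
    assume "indep_list us"
    then have "length us = dim (span (set us))" by (simp only: indep_list_dim)
    also have "\<dots> \<le> n" unfolding n_def by (rule dim_subset) simp
    finally show False by (simp add: us_def)
  qed
  then obtain c j where c: "(\<Sum>i<length us. c i *s us ! i) = 0" "j < length us" "c j \<noteq> 0"
    unfolding indep_list_def by blast
  define p where "p = (\<Sum>i\<le>n. Polynomial.monom (c i) i)"
  have cf: "coeff p i = (if i \<le> n then c i else 0)" for i
    by (simp add: p_def coeff_sum)
  have "degree p \<le> n" by (rule degree_le) (simp add: cf)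
  then have "poly_map scale p \<sigma> v = (\<Sum>i\<le>n. c i *s (\<sigma> ^^ i) v)"
    by (simp add: poly_map_bound cf)
  also have "\<dots> = (\<Sum>i<length us. c i *s us ! i)"
    by (rule sum.cong) (auto simp: us_def simp del: upt_Suc)
  finally have "poly_map scale p \<sigma> v = 0" using c by simp
  moreover have "p \<noteq> 0" using cf[of j] c by (auto simp: us_def simp del: upt_Suc)
  ultimately show ?thesis by blast
qed

text \<open>Polynomials in \<sigma> commute, so the product of annihilators of the single basis
  vectors kills them all.\<close>

lemma annihilating_poly: "\<exists>p. p \<noteq> 0 \<and> (\<forall>v. poly_map scale p \<sigma> v = 0)"
proof -
  have "\<exists>p. p \<noteq> 0 \<and> (\<forall>v\<in>B. poly_map scale p \<sigma> v = 0)" if "finite B" for B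
    using that
  proof (induction B)
    case empty then show ?case by (intro exI[of _ 1]) simp
  next
    case (insert b B)
    obtain p where p: "p \<noteq> 0" "\<forall>v\<in>B. poly_map scale p \<sigma> v = 0" using insert.IH by blast
    obtain q where q: "q \<noteq> 0" "poly_map scale q \<sigma> b = 0" using annihilating_poly_vector by blast
    have z: "poly_map scale r \<sigma> 0 = 0" for r using lin_0[OF opr_lin[OF opr_poly_map]] .
    have "poly_map scale (p * q) \<sigma> b = 0" by (simp add: poly_map_mult q z)
    moreover have "poly_map scale (p * q) \<sigma> v = 0" if "v \<in> B" for v
      using p(2) that by (subst mult.commute) (simp add: poly_map_mult z)
    ultimately show ?case using p(1) q(1) by (intro exI[of _ "p * q"]) auto
  qed
  from this[OF finite_Basis] obtain p where p: "p \<noteq> 0" "\<forall>v\<in>Basis. poly_map scale p \<sigma> v = 0" by blast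
  have "poly_map scale p \<sigma> v = 0" for v
    using span_induct_lin[OF _ opr_lin[OF opr_poly_map], of v Basis "{0}"] p(2) span_Basis by auto
  then show ?thesis using p(1) by blast
qed

text \<open>The definite description has to be justified: a monic annihilator of least degree
  exists, and the difference of two of them would be an annihilator of smaller degree.\<close>

lemma minimal_poly_annihilates: "poly_map scale (minimal_poly scale \<sigma>) \<sigma> v = 0"
proof -
  define ann where "ann = (\<lambda>p. \<forall>v. poly_map scale p \<sigma> v = 0)"
  define P where "P = (\<lambda>p. lead_coeff p = 1 \<and> ann p \<and> (\<forall>q. q \<noteq> 0 \<and> ann q \<longrightarrow> degree p \<le> degree q))"
  obtain p0 where "p0 \<noteq> 0 \<and> ann p0" using annihilating_poly unfolding ann_def by blast
  then obtain p where p: "p \<noteq> 0 \<and> ann p" "\<And>q. q \<noteq> 0 \<and> ann q \<Longrightarrow> degree p \<le> degree q"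
    using ex_has_least_nat[of "\<lambda>p. p \<noteq> 0 \<and> ann p" p0 degree] by blast
  define r where "r = Polynomial.smult (inverse (lead_coeff p)) p"
  have "P r" unfolding P_def
  proof (intro conjI allI impI)
    show "lead_coeff r = 1" using p(1) by (simp add: r_def)
    show "ann r" using p(1) by (simp add: r_def ann_def poly_map_smult)
    show "degree r \<le> degree q" if "q \<noteq> 0 \<and> ann q" for q using p(2)[OF that] by (simp add: r_def)
  qed
  moreover have "q = r" if "P q" for q
  proof (rule ccontr)
    assume ne: "q \<noteq> r"
    have d: "degree q = degree r"
      using \<open>P q\<close> \<open>P r\<close> unfolding P_def by (metis leading_coeff_0_iff le_antisym zero_neq_one)
    have "poly_map scale (q - r) \<sigma> v = poly_map scale q \<sigma> v - poly_map scale r \<sigma> v" for v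
      using poly_map_add[of "q - r" r v] by (simp add: eq_diff_eq)
    then have "ann (q - r)" using \<open>P q\<close> \<open>P r\<close> by (simp add: P_def ann_def)
    then have "degree q \<le> degree (q - r)" using \<open>P q\<close> ne unfolding P_def by simp
    moreover have "degree (q - r) \<le> degree q" using d by (simp add: degree_diff_le)
    ultimately have "degree (q - r) = degree q" by simp
    moreover have "coeff (q - r) (degree q) = 0" using \<open>P q\<close> \<open>P r\<close> d unfolding P_def by simp
    ultimately have "lead_coeff (q - r) = 0" by simp
    then have "q - r = 0" by (simp only: leading_coeff_0_iff)
    then show False using ne by simp
  qed
  ultimately have "P (minimal_poly scale \<sigma>)"
    unfolding minimal_poly_def P_def ann_def by (rule theI)
  then show ?thesis by (simp add: P_def ann_def)
qed

lemma asymmetry_eq: "asymmetry scale f = \<sigma>"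
  unfolding asymmetry_def
proof (rule the_equality)
  show "Vector_Spaces.linear scale scale \<sigma> \<and> bij \<sigma> \<and> (\<forall>u v. f v u = f u (\<sigma> v))"
    using lin_linear[OF lin_\<sigma>] f_swap o_bij[of \<tau> \<sigma>] by (auto simp: comp_def id_def)
  fix T assume T: "Vector_Spaces.linear scale scale T \<and> bij T \<and> (\<forall>u v. f v u = f u (T v))"
  show "T = \<sigma>"
  proof
    fix v
    have "f u (T v - \<sigma> v) = 0" for u
      using T f_swap[of v u] by (simp add: f_diff_right)
    then have "T v - \<sigma> v = 0" by (rule nondeg)
    then show "T v = \<sigma> v" by simp
  qed
qed

lemma split_factors:
  assumes "split_form scale f" shows "\<exists>as. \<forall>x. fold N as x = 0"
proof -
  obtain as where "minimal_poly scale \<sigma> = (\<Prod>a\<leftarrow>as. [:- a, 1:])"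
    using assms by (auto simp: split_form_def asymmetry_eq)
  then have "fold N as x = 0" for x
    using poly_map_linear_factors[of as x] minimal_poly_annihilates[of x] by simp
  then show ?thesis by blast
qed

end

subsection \<open>Existence of the asymmetry\<close>

text \<open>Solving the Gram system of \<open>Basis\<close> represents the functional
  \<open>f v\<close> by pairing with a vector on the right, which defines \<sigma>. Injectivity
  rests on a trivial left radical, obtained from vectors dual to the basis; finite dimension then
  gives surjectivity.\<close>

lemma form_space_exists:
  fixes scale :: "'a::field \<Rightarrow> 'v::ab_group_add \<Rightarrow> 'v"
  assumes fd: "finite_dimensional_vector_space scale Basis"
    and bil: "bilinear_form scale f" and nondeg: "nondegenerate_form scale f"
  shows "\<exists>\<sigma> \<tau>. form_space scale Basis f \<sigma> \<tau>"
proof -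
  interpret V: finite_dimensional_vector_space scale Basis by (rule fd)
  have add: "f (x + y) z = f x z + f y z" "f z (x + y) = f z x + f z y"
    and sc: "f (scale c x) z = c * f x z" "f z (scale c x) = c * f z x" for x y z c
    using bil by (auto simp: bilinear_form_def Vector_Spaces.linear_iff)
  have zero: "f 0 y = 0" "f y 0 = 0" for y using sc(1)[of 0 0 y] sc(2)[of y 0 0] by simp_all
  have diff: "f z (x - y) = f z x - f z y" for x y z
    using add(2)[of z "x - y" y] by simp
  have sums: "f (sum g A) z = (\<Sum>a\<in>A. f (g a) z)" "f z (sum g A) = (\<Sum>a\<in>A. f z (g a))" for g A z
    by (induction A rule: infinite_finite_induct) (simp_all add: add zero)
  obtain bs where bs: "set bs = Basis" "distinct bs" using finite_distinct_list[OF V.finite_Basis] by blast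
  define n where "n = length bs"
  have "ordered_basis scale bs"
    using bs V.independent_Basis V.span_Basis by (simp add: ordered_basis_def)
  then have inv: "invertible_mat (gram_matrix f bs)" using nondeg by (simp add: nondegenerate_form_def)
  define A where "A = gram_matrix f bs"
  have A: "A \<in> carrier_mat n n" by (simp add: A_def n_def gram_matrix_def)
  obtain B where B: "inverts_mat A B" "inverts_mat B A" using inv unfolding invertible_mat_def A_def by blast
  have dB: "dim_col B = n" using B(1) A unfolding inverts_mat_def by (metis carrier_matD(1) index_mult_mat(3) index_one_mat(3))
  have rB: "dim_row B = n" using B(2) A unfolding inverts_mat_def by (metis carrier_matD(2) index_mult_mat(3) index_one_mat(3))
  have BA: "B * A = 1\<^sub>m n" using B(2) rB unfolding inverts_mat_def by simp
  have Bc: "B \<in> carrier_mat n n" using dB rB by blast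
  have ker: "\<forall>j<n. c j = 0" if c: "\<And>i. i < n \<Longrightarrow> (\<Sum>j<n. f (bs ! i) (bs ! j) * c j) = 0" for c
  proof -
    have "A *\<^sub>v vec n c = 0\<^sub>v n"
      using c A by (intro eq_vecI) (auto simp: A_def gram_matrix_def n_def scalar_prod_def atLeast0LessThan)
    then have "B *\<^sub>v (A *\<^sub>v vec n c) = 0\<^sub>v n"
      using Bc by (intro eq_vecI) (auto simp: scalar_prod_def)
    then have "vec n c = 0\<^sub>v n" using assoc_mult_mat_vec[OF Bc A, of "vec n c"] BA by simp
    then show ?thesis by (metis index_vec index_zero_vec(1))
  qed
  have solve: "\<exists>y. \<forall>i<n. f (bs ! i) y = b i" for b
  proof -
    obtain c where c: "\<forall>i<n. (\<Sum>j<n. f (bs ! i) (bs ! j) * c j) = b i"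
      using square_system_solvable[of n "\<lambda>i j. f (bs ! i) (bs ! j)" b] ker by blast
    then show ?thesis
      by (intro exI[of _ "\<Sum>j<n. scale (c j) (bs ! j)"]) (simp add: sums sc mult.commute)
  qed
  have expand: "\<exists>c. x = (\<Sum>j<n. scale (c j) (bs ! j))" for x
    using V.span_list_lincomb[of x bs] bs V.span_Basis by (simp add: n_def)
  have nd: "x = 0" if z: "\<And>u. f u x = 0" for x
  proof -
    obtain c where c: "x = (\<Sum>j<n. scale (c j) (bs ! j))" using expand by blast
    have "(\<Sum>j<n. f (bs ! i) (bs ! j) * c j) = 0" for i
      using z[of "bs ! i"] by (simp add: c sums sc mult.commute)
    then have "\<forall>j<n. c j = 0" using ker by blast
    then show ?thesis by (simp add: c)
  qed
  have nd_left: "x = 0" if z: "\<And>u. f x u = 0" for x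
  proof -
    obtain c where c: "x = (\<Sum>j<n. scale (c j) (bs ! j))" using expand by blast
    have "c i = 0" if i: "i < n" for i
    proof -
      obtain y where y: "\<forall>k<n. f (bs ! k) y = (if k = i then 1 else 0)"
        using solve[of "\<lambda>k. if k = i then 1 else 0"] by blast
      have "0 = (\<Sum>j<n. c j * f (bs ! j) y)" using z[of y] by (simp add: c sums sc)
      also have "\<dots> = (\<Sum>j<n. if j = i then c j else 0)" by (rule sum.cong) (use y in auto)
      finally show ?thesis using i by simp
    qed
    then show ?thesis by (simp add: c)
  qed
  have "\<exists>y. \<forall>u. f v u = f u y" for v
  proof -
    obtain y where y: "\<forall>i<n. f (bs ! i) y = f v (bs ! i)" using solve[of "\<lambda>i. f v (bs ! i)"] by blast
    have "f v u = f u y" for u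
    proof -
      obtain c where c: "u = (\<Sum>j<n. scale (c j) (bs ! j))" using expand by blast
      show ?thesis unfolding c by (simp add: sums sc y)
    qed
    then show ?thesis by blast
  qed
  then obtain \<sigma> where \<sigma>: "\<And>v u. f v u = f u (\<sigma> v)" by metis
  have eqI: "x = y" if "\<And>u. f u x = f u y" for x y
    using nd[of "x - y"] that by (simp add: diff)
  have \<sigma>_add: "\<sigma> (x + y) = \<sigma> x + \<sigma> y" for x y
    by (rule eqI) (simp add: add flip: \<sigma>)
  have \<sigma>_scale: "\<sigma> (scale c x) = scale c (\<sigma> x)" for c x
    by (rule eqI) (simp add: sc flip: \<sigma>)
  have lin: "Vector_Spaces.linear scale scale \<sigma>"
    by (simp add: Vector_Spaces.linear_iff V.vector_space_axioms \<sigma>_add \<sigma>_scale)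
  have "inj \<sigma>"
  proof (rule injI)
    fix x y assume e: "\<sigma> x = \<sigma> y"
    have "f (x - y) u = 0" for u
    proof -
      have "f x u = f y u" using \<sigma>[of x u] \<sigma>[of y u] e by simp
      moreover have "f x u = f (x - y) u + f y u" using add(1)[of "x - y" y u] by simp
      ultimately show ?thesis by simp
    qed
    then have "x - y = 0" by (rule nd_left)
    then show "x = y" by simp
  qed
  moreover from this have "surj \<sigma>" by (rule V.linear_inj_imp_surj[OF lin])
  ultimately have "form_space scale Basis f \<sigma> (inv_into UNIV \<sigma>)"
    unfolding form_space_def form_space_axioms_def
    using fd add sc \<sigma>_add \<sigma>_scale \<sigma> nd by (simp add: surj_f_inv_f inv_f_f)
  then show ?thesis by blast
qed

text \<open>Order and interchange are absorbed in one \<open>rel_mset\<close>. As an equivalence,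
  the second part also records that every interchange is realized by some basis.\<close>

theorem theorem8p4:
  fixes scale :: "'a::field \<Rightarrow> 'v::ab_group_add \<Rightarrow> 'v"
    and Basis :: "'v set"
    and f :: "'v \<Rightarrow> 'v \<Rightarrow> 'a"
  assumes "quadratically_closed TYPE('a)"
    and "finite_dimensional_vector_space scale Basis"
    and "\<exists>v :: 'v. v \<noteq> 0"
    and "bilinear_form scale f"
    and "nondegenerate_form scale f"
    and "split_form scale f"
  shows "(\<exists>ss. canonical_decomposition scale f ss) \<and>
         (\<forall>ss ss'. canonical_decomposition scale f ss \<longrightarrow>
            (canonical_decomposition scale f ss' \<longleftrightarrow>
             rel_mset interchangeable (mset ss) (mset ss')))"
proof -
  obtain \<sigma> \<tau> where "form_space scale Basis f \<sigma> \<tau>"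
    using form_space_exists assms(2,4,5) by blast
  then interpret form_space scale Basis f \<sigma> \<tau> .
  obtain as where "\<And>x. fold N as x = 0" using split_factors[OF assms(6)] by blast
  then obtain ps where "orth_blocks ps" "total ps = UNIV" "CHAR('a) = 2 \<longrightarrow>
      \<not> (\<exists>l. odd l \<and> Summand_B l \<in> set (map fst ps) \<and> Summand_E (2 * l) \<in> set (map fst ps))"
    using canonical_blocks_exist[OF assms(1)] by blast
  then have "canonical_decomposition scale f (map fst ps)"
    unfolding canonical_decomposition_iff by blast
  then show ?thesis
    using canonical_decomposition_unique canonical_decomposition_rel_mset by blast
qed

end
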